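(* Let $\mathscr{H}_1,\mathscr{H}_2$ be separable Hilbert spaces, $\mathscr{H}=\mathscr{H}_1\otimes\Gamma_s(\mathscr{H}_2)$, and $H=H_{01}\otimes 1+1\otimes H_{02}+H_I$. Assume condition (A$_0$), and assume that at least one of the conditions (A$_I$) and (A$_I'$) holds (all three conditions are spelled out in the context). Then $H$ is essentially self-adjoint on $$D(H_{01}\otimes 1)\cap D(1\otimes H_{02})\cap \bigl(\mathscr{H}_1\otimes f_0(\mathscr{H}_2^{(\cdot)})\bigr).$$
   Context: Notation. $\Gamma_s(\mathscr{H}_2)=\bigoplus_{n=0}^\infty \mathscr{H}_2^{(n)}$ is the symmetric Fock space, where $\mathscr{H}_2^{(n)}=\mathscr{H}_2^{\otimes_s n}$ is the $n$-fold symmetric tensor product and $\mathscr{H}_2^{(0)}=\mathbb{C}$; $\mathscr{H}_2^{(m)}=\{0\}$ for $m<0$. For $\psi\in\mathscr{H}$, $\psi_n$ denotes the orthogonal projection of $\psi$ on $\mathscr{H}_1\otimes\mathscr{H}_2^{(n)}$ ($\psi_m=0$ for $m<0$). $\mathscr{H}_1\otimes f_0(\mathscr{H}_2^{(\cdot)})$ denotes the dense subspace of vectors $\phi\in\mathscr{H}$ for which there is $n\in\mathbb{N}$ with $\phi\in\bigoplus_{j=0}^n\mathscr{H}_1\otimes\mathscr{H}_2^{(j)}$. For a self-adjoint operator $X$, $D(X)$ is its domain, $q_X(\cdot,\cdot)$ its quadratic form and $Q(X)$ its form domain. $H_0=H_{01}\otimes 1+1\otimes H_{02}$. For $n\in\mathbb{N}$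 put $$\mathscr{Q}_n:=Q(H_{01}\otimes 1)\cap Q(1\otimes H_{02})\cap\bigl(\mathscr{H}_1\otimes\mathscr{H}_2^{(n)}\bigr),$$ and for $\phi\in\mathscr{Q}_n$ $$\|\phi\|_{\mathscr{X}_n}^2:=q_{H_{01}\otimes 1}(\phi,\phi)+q_{1\otimes H_{02}}(\phi,\phi)+(|M_1|+|M_2|+1)\|\phi\|^2 ,$$ with $M_1,M_2$ as in (A$_0$). Condition (A$_0$): $H_{01}$ is a self-adjoint operator on $\mathscr{H}_1$ and $H_{02}$ a self-adjoint operator on $\Gamma_s(\mathscr{H}_2)$, both bounded from below, with lower bounds $-M_1$ and $-M_2$ respectively; moreover for every $t\in\mathbb{R}$ and $n\in\mathbb{N}$, $e^{itH_{02}}$ maps $\mathscr{H}_2^{(n)}$ into itself. Condition (A$_I$): $H_I$ is a symmetric operator on $\mathscr{H}$ with domain $D(H_I)$ such that $D(H_0)\cap D(H_I)$ is dense in $\mathscr{H}$. For every $n\in\mathbb{N}$ and $\phi\in\mathscr{Q}_n$ one has $\phi\in D(H_I)$ and $H_I\phi\in\bigoplus_{i=-2}^{2}\mathscr{H}_1\otimes\mathscr{H}_2^{(n+i)}$. There is a constant $C>0$, independent of $n$, such that for all $n\in\mathbb{N}$, $\psi\in\mathscr{H}$, $\phi\in\mathscr{Q}_n$: $$|\langle\psi,H_I\phi\rangle|^2\le C^2\sum_{i=-2}^{2}\|\psi_{n+i}\|^2\Bigl[(n+1)^2\|\phi\|^2+(n+1)\|\phi\|_{\mathscr{X}_n}^2\Bigr].$$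 Condition (A$_I'$): $H_I$ is a symmetric operator on $\mathscr{H}$ with domain $D(H_I)$ such that $D(H_0)\cap D(H_I)$ is dense in $\mathscr{H}$. For every $n\in\mathbb{N}$ and $\phi\in\mathscr{Q}_n$ one has $\phi\in D(H_I)$ and $H_I\phi\in\bigoplus_{i=-2}^{2}\mathscr{H}_1\otimes\mathscr{H}_2^{(n+i)}$. Moreover $H_I=H_{diag}+H_2$, where: (i) $H_{diag}$ is diagonal, i.e. for every $n$ it maps $D(H_{diag})\cap(\mathscr{H}_1\otimes\mathscr{H}_2^{(n)})$ into $\mathscr{H}_1\otimes\mathscr{H}_2^{(n)}$ and this intersection is dense in $\mathscr{H}_1\otimes\mathscr{H}_2^{(n)}$; $H_2$ is non-diagonal, i.e. for every $n$ it maps $D(H_2)\cap(\mathscr{H}_1\otimes\mathscr{H}_2^{(n)})$ into the orthogonal complement of $\mathscr{H}_1\otimes\mathscr{H}_2^{(n)}$. (ii) For every $n\in\mathbb{N}$ there is $C(n)>0$ such that for all $\psi\in\mathscr{H}$, $\phi\in\mathscr{Q}_n$ (with $\mathscr{Q}_n\subseteq D(H_{diag})$): $|\langle\psi,H_{diag}\phi\rangle|^2\le C(n)^2\|\psi_n\|^2\|\phi\|_{\mathscr{X}_n}^2$. (iii) There is $C>0$, independent of $n$, such that for all $n\in\mathbb{N}$, $\psi\in\mathscr{H}$, $\phi\in\mathscr{H}_1\otimes\mathscr{H}_2^{(n)}$ (with $\mathscr{H}_1\otimes\mathscr{H}_2^{(n)}\subseteq D(H_2)$): $|\langle\psi,H_2\phi\rangle|\le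 C(n+1)\|\phi\|\sum_{i\in\{-2,-1,1,2\}}\|\psi_{n+i}\|$. *)

theory Defs
  imports "HOL-Analysis.Analysis"
begin

section \<open>Complex Hilbert spaces\<close>

text \<open>The inner product \<open>cinner\<close> is conjugate linear in its first argument.
  Norm and topology are those of the underlying real Hilbert space, whose inner product
  is the real part of \<open>cinner\<close>.\<close>

class chilbert_space = real_inner + banach +
  fixes scaleC :: "complex \<Rightarrow> 'a \<Rightarrow> 'a"  (infixr \<open>*\<^sub>C\<close> 75)
    and cinner :: "'a \<Rightarrow> 'a \<Rightarrow> complex"
  assumes scaleC_add_right: "c *\<^sub>C (x + y) = c *\<^sub>C x + c *\<^sub>C y"
    and scaleC_add_left: "(c + d) *\<^sub>C x = c *\<^sub>C x + d *\<^sub>C x"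
    and scaleC_scaleC: "c *\<^sub>C d *\<^sub>C x = (c * d) *\<^sub>C x"
    and scaleC_of_real: "complex_of_real r *\<^sub>C x = r *\<^sub>R x"
    and cinner_commute: "cinner x y = cnj (cinner y x)"
    and cinner_add_right: "cinner x (y + z) = cinner x y + cinner x z"
    and cinner_scaleC_right: "cinner x (c *\<^sub>C y) = c * cinner x y"
    and Re_cinner: "Re (cinner x y) = inner x y"

global_interpretation complex_vector:
  vector_space "scaleC :: complex \<Rightarrow> 'a \<Rightarrow> 'a::chilbert_space"
proof
  show "1 *\<^sub>C x = x" for x :: 'a
    using scaleC_of_real[of 1 x] by simp
qed (auto simp: scaleC_add_right scaleC_add_left scaleC_scaleC)

abbreviation csubspace :: "'a::chilbert_space set \<Rightarrow> bool"
  where "csubspace \<equiv> complex_vector.subspace"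

abbreviation cspan :: "'a::chilbert_space set \<Rightarrow> 'a set"
  where "cspan \<equiv> complex_vector.span"

instantiation complex :: chilbert_space
begin

definition scaleC_complex :: "complex \<Rightarrow> complex \<Rightarrow> complex"
  where "scaleC_complex c x = c * x"

definition cinner_complex :: "complex \<Rightarrow> complex \<Rightarrow> complex"
  where "cinner_complex x y = cnj x * y"

instance
  by standard
    (auto simp: scaleC_complex_def cinner_complex_def inner_complex_def algebra_simps
      scaleR_conv_of_real)

end

instantiation prod :: (chilbert_space, chilbert_space) chilbert_space
begin

definition scaleC_prod :: "complex \<Rightarrow> 'a \<times> 'b \<Rightarrow> 'a \<times> 'b"
  where "scaleC_prod c p = (c *\<^sub>C fst p, c *\<^sub>C snd p)"

definition cinner_prod :: "'a \<times> 'b \<Rightarrow> 'a \<times> 'b \<Rightarrow> complex"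
  where "cinner_prod p q = cinner (fst p) (fst q) + cinner (snd p) (snd q)"

instance
proof
  fix p q :: "'a \<times> 'b"
  show "cinner p q = cnj (cinner q p)"
    by (simp add: cinner_prod_def cinner_commute[of "fst p"] cinner_commute[of "snd p"])
qed (auto simp: scaleC_prod_def cinner_prod_def inner_prod_def scaleC_add_right scaleC_add_left
      scaleC_scaleC scaleC_of_real scaleR_prod_def cinner_add_right cinner_scaleC_right
      Re_cinner algebra_simps)

end

definition orth_compl :: "'a::chilbert_space set \<Rightarrow> 'a set"
  where "orth_compl V = {y. \<forall>x\<in>V. cinner x y = 0}"

text \<open>Only used for closed subspaces, where the projection exists and is unique.\<close>

definition orth_proj :: "'a::chilbert_space set \<Rightarrow> 'a \<Rightarrow> 'a"
  where "orth_proj V x = (THE y. y \<in> V \<and> x - y \<in> orth_compl V)"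


section \<open>Unbounded operators\<close>

text \<open>An operator is identified with its graph, so that its domain is \<open>Domain A\<close>,
  extension of operators is inclusion, and the closure of a closable operator is the
  topological closure of its graph.\<close>

type_synonym 'a oper = "('a \<times> 'a) set"

definition is_oper :: "'a::chilbert_space oper \<Rightarrow> bool"
  where "is_oper A \<longleftrightarrow> csubspace A \<and> single_valued A"

definition op_apply :: "'a oper \<Rightarrow> 'a \<Rightarrow> 'a"
  where "op_apply A x = (THE y. (x, y) \<in> A)"

definition op_plus :: "'a::chilbert_space oper \<Rightarrow> 'a oper \<Rightarrow> 'a oper"
  where "op_plus A B = {(x, y + z) |x y z. (x, y) \<in> A \<and> (x, z) \<in> B}"

definition op_restrict :: "'a oper \<Rightarrow> 'a set \<Rightarrow> 'a oper"
  where "op_restrict A D = {(x, y). (x, y) \<in> A \<and> x \<in> D}"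

definition adjoint_op :: "'a::chilbert_space oper \<Rightarrow> 'a oper"
  where "adjoint_op A = {(y, z). \<forall>(x, w)\<in>A. cinner y w = cinner z x}"

definition symmetric_op :: "'a::chilbert_space oper \<Rightarrow> bool"
  where "symmetric_op A \<longleftrightarrow> is_oper A \<and> closure (Domain A) = UNIV \<and> A \<subseteq> adjoint_op A"

definition self_adjoint_op :: "'a::chilbert_space oper \<Rightarrow> bool"
  where "self_adjoint_op A \<longleftrightarrow> is_oper A \<and> closure (Domain A) = UNIV \<and> A = adjoint_op A"

definition ess_self_adjoint_op :: "'a::chilbert_space oper \<Rightarrow> bool"
  where "ess_self_adjoint_op A \<longleftrightarrow> symmetric_op A \<and> self_adjoint_op (closure A)"

definition ess_self_adjoint_on :: "'a::chilbert_space oper \<Rightarrow> 'a set \<Rightarrow> bool"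
  where "ess_self_adjoint_on A D \<longleftrightarrow> D \<subseteq> Domain A \<and> ess_self_adjoint_op (op_restrict A D)"

text \<open>The lower bound need not be optimal.\<close>

definition lower_bound_op :: "'a::chilbert_space oper \<Rightarrow> real \<Rightarrow> bool"
  where "lower_bound_op A m \<longleftrightarrow> (\<forall>(x, y)\<in>A. m * (norm x)\<^sup>2 \<le> Re (cinner x y))"

text \<open>\<open>unitary_group_of A U\<close> says that \<open>U t\<close> is \<open>e\<^bsup>itA\<^esup>\<close> for all real \<open>t\<close>: \<open>U\<close> is a strongly
  continuous one-parameter unitary group whose generator is \<open>iA\<close>. By Stone's theorem
  a self-adjoint \<open>A\<close> has exactly one such \<open>U\<close>.\<close>

definition unitary_group_of :: "'a::chilbert_space oper \<Rightarrow> (real \<Rightarrow> 'a \<Rightarrow> 'a) \<Rightarrow> bool"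
  where "unitary_group_of A U \<longleftrightarrow>
    (\<forall>t. Vector_Spaces.linear scaleC scaleC (U t) \<and> surj (U t) \<and>
         (\<forall>x y. cinner (U t x) (U t y) = cinner x y)) \<and>
    U 0 = id \<and> (\<forall>s t. U (s + t) = U s \<circ> U t) \<and>
    (\<forall>x. continuous_on UNIV (\<lambda>t. U t x)) \<and>
    A = {(x, y). ((\<lambda>t. U t x) has_vector_derivative \<i> *\<^sub>C y) (at 0)}"

text \<open>The quadratic form of a self-adjoint operator \<open>A\<close> that is bounded from below is the closure
  of the form \<open>x, y \<mapsto> \<langle>x, A y\<rangle>\<close> on the domain of \<open>A\<close>. Since \<open>A\<close> is semibounded, a norm-convergent
  sequence \<open>s\<close> for which \<open>\<langle>s m - s n, A (s m - s n)\<rangle>\<close> tends to 0 as \<open>m, n\<close> tend to infinity is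
  the same as a norm-convergent sequence that is Cauchy for the form norm.\<close>

definition form_approx :: "'a::chilbert_space oper \<Rightarrow> (nat \<Rightarrow> 'a) \<Rightarrow> 'a \<Rightarrow> bool"
  where "form_approx A s x \<longleftrightarrow> range s \<subseteq> Domain A \<and> s \<longlonglongrightarrow> x \<and>
    (\<forall>e>0. \<exists>N. \<forall>m\<ge>N. \<forall>n\<ge>N. cmod (cinner (s m - s n) (op_apply A (s m - s n))) < e)"

definition form_domain :: "'a::chilbert_space oper \<Rightarrow> 'a set"
  where "form_domain A = {x. \<exists>s. form_approx A s x}"

definition quad_form :: "'a::chilbert_space oper \<Rightarrow> 'a \<Rightarrow> 'a \<Rightarrow> complex"
  where "quad_form A x y = (THE l. \<forall>s r. form_approx A s x \<longrightarrow> form_approx A r y \<longrightarrow>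
    (\<lambda>n. cinner (s n) (op_apply A (r n))) \<longlonglongrightarrow> l)"


section \<open>Tensor products and the symmetric Fock space\<close>

text \<open>\<open>hilbert_tensor T\<close> says that \<open>'h\<close>, with \<open>T x u\<close> as the elementary tensor \<open>x \<otimes> u\<close>, is the Hilbert
  space tensor product of \<open>'a\<close> and \<open>'f\<close>, which is determined up to a unitary map that respects
  elementary tensors. Bilinearity of \<open>T\<close> follows from the formula for inner products.\<close>

definition hilbert_tensor ::
    "('a::chilbert_space \<Rightarrow> 'f::chilbert_space \<Rightarrow> 'h::chilbert_space) \<Rightarrow> bool"
  where "hilbert_tensor T \<longleftrightarrow>
    (\<forall>x u y v. cinner (T x u) (T y v) = cinner x y * cinner u v) \<and>
    closure (cspan {T x u |x u. True}) = UNIV"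

text \<open>\<open>symmetric_fock S\<close> says that \<open>'f\<close> is the symmetric Fock space over \<open>'b\<close>, where
  \<open>S [x\<^sub>1, \<dots>, x\<^sub>n]\<close> is the orthogonal projection of \<open>x\<^sub>1 \<otimes> \<dots> \<otimes> x\<^sub>n\<close> to the symmetric tensors, that is
  the average of \<open>x\<^bsub>p 1\<^esub> \<otimes> \<dots> \<otimes> x\<^bsub>p n\<^esub>\<close> over all permutations \<open>p\<close>, and \<open>S []\<close> is the vacuum,
  a unit vector. As for \<open>hilbert_tensor\<close>, this determines \<open>'f\<close> and \<open>S\<close> up to a unitary map;
  multilinearity and symmetry of \<open>S\<close> follow from the formula for inner products.\<close>

definition symmetric_fock :: "('b::chilbert_space list \<Rightarrow> 'f::chilbert_space) \<Rightarrow> bool"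
  where "symmetric_fock S \<longleftrightarrow>
    (\<forall>xs ys. cinner (S xs) (S ys) =
      (if length xs = length ys
       then (\<Sum>p | p permutes {..<length xs}. \<Prod>i<length xs. cinner (xs ! i) (ys ! p i))
              / fact (length xs)
       else 0)) \<and>
    closure (cspan (range S)) = UNIV"

text \<open>The particle number is an integer, with zero spaces for negative particle numbers.\<close>

definition fock_sector :: "('b list \<Rightarrow> 'f::chilbert_space) \<Rightarrow> int \<Rightarrow> 'f set"
  where "fock_sector S k =
    (if k < 0 then {0} else closure (cspan {S xs |xs. int (length xs) = k}))"

text \<open>\<open>sector T S k\<close> is \<open>\<H>\<^sub>1 \<otimes> \<H>\<^sub>2\<^bsup>(k)\<^esup>\<close>.\<close>

definition sector ::
    "('a \<Rightarrow> 'f::chilbert_space \<Rightarrow> 'h::chilbert_space) \<Rightarrow> ('b list \<Rightarrow> 'f) \<Rightarrow> int \<Rightarrow> 'h set"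
  where "sector T S k = closure (cspan {T x u |x u. u \<in> fock_sector S k})"

definition sector_sum ::
    "('a \<Rightarrow> 'f::chilbert_space \<Rightarrow> 'h::chilbert_space) \<Rightarrow> ('b list \<Rightarrow> 'f) \<Rightarrow> int set \<Rightarrow> 'h set"
  where "sector_sum T S K = {\<Sum>k\<in>K. v k |v. \<forall>k\<in>K. v k \<in> sector T S k}"

definition finite_particle ::
    "('a \<Rightarrow> 'f::chilbert_space \<Rightarrow> 'h::chilbert_space) \<Rightarrow> ('b list \<Rightarrow> 'f) \<Rightarrow> 'h set"
  where "finite_particle T S = (\<Union>n::nat. sector_sum T S {0..int n})"

definition component ::
    "('a \<Rightarrow> 'f::chilbert_space \<Rightarrow> 'h::chilbert_space) \<Rightarrow> ('b list \<Rightarrow> 'f) \<Rightarrow> int \<Rightarrow> 'h \<Rightarrow> 'h"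
  where "component T S k = orth_proj (sector T S k)"

text \<open>\<open>A \<otimes> 1\<close> and \<open>1 \<otimes> B\<close> are the closures of the operators defined on the algebraic tensor
  products of \<open>Domain A\<close> and \<open>UNIV\<close>, respectively of \<open>UNIV\<close> and \<open>Domain B\<close>.\<close>

definition tensor_one ::
    "('a \<Rightarrow> 'f \<Rightarrow> 'h::chilbert_space) \<Rightarrow> 'a oper \<Rightarrow> 'h oper"
  where "tensor_one T A = closure (cspan {(T x u, T y u) |x y u. (x, y) \<in> A})"

definition one_tensor ::
    "('a \<Rightarrow> 'f \<Rightarrow> 'h::chilbert_space) \<Rightarrow> 'f oper \<Rightarrow> 'h oper"
  where "one_tensor T B = closure (cspan {(T x u, T x v) |x u v. (u, v) \<in> B})"


section \<open>The conditions on the Hamiltonian\<close>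

definition free_op ::
    "('a \<Rightarrow> 'f \<Rightarrow> 'h::chilbert_space) \<Rightarrow> 'a oper \<Rightarrow> 'f oper \<Rightarrow> 'h oper"
  where "free_op T H01 H02 = op_plus (tensor_one T H01) (one_tensor T H02)"

definition Q_space ::
    "('a \<Rightarrow> 'f::chilbert_space \<Rightarrow> 'h::chilbert_space) \<Rightarrow> ('b list \<Rightarrow> 'f) \<Rightarrow>
     'a oper \<Rightarrow> 'f oper \<Rightarrow> nat \<Rightarrow> 'h set"
  where "Q_space T S H01 H02 n =
    form_domain (tensor_one T H01) \<inter> form_domain (one_tensor T H02) \<inter> sector T S (int n)"

text \<open>The square of the norm on \<open>Q_space\<close>; the forms are real on the diagonal.\<close>

definition X_norm_sq ::
    "('a \<Rightarrow> 'f \<Rightarrow> 'h::chilbert_space) \<Rightarrow> 'a oper \<Rightarrow> 'f oper \<Rightarrow> real \<Rightarrow> real \<Rightarrow> 'h \<Rightarrow> real"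
  where "X_norm_sq T H01 H02 M1 M2 \<phi> =
    Re (quad_form (tensor_one T H01) \<phi> \<phi>) + Re (quad_form (one_tensor T H02) \<phi> \<phi>) +
    (\<bar>M1\<bar> + \<bar>M2\<bar> + 1) * (norm \<phi>)\<^sup>2"

definition cond_A0 ::
    "('b list \<Rightarrow> 'f) \<Rightarrow> 'a::chilbert_space oper \<Rightarrow> 'f::chilbert_space oper \<Rightarrow> real \<Rightarrow> real \<Rightarrow> bool"
  where "cond_A0 S H01 H02 M1 M2 \<longleftrightarrow>
    self_adjoint_op H01 \<and> lower_bound_op H01 (- M1) \<and>
    self_adjoint_op H02 \<and> lower_bound_op H02 (- M2) \<and>
    (\<exists>U. unitary_group_of H02 U \<and>
      (\<forall>t. \<forall>n::nat. U t ` fock_sector S (int n) \<subseteq> fock_sector S (int n)))"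

definition cond_common ::
    "('a \<Rightarrow> 'f::chilbert_space \<Rightarrow> 'h::chilbert_space) \<Rightarrow> ('b list \<Rightarrow> 'f) \<Rightarrow>
     'a oper \<Rightarrow> 'f oper \<Rightarrow> 'h oper \<Rightarrow> bool"
  where "cond_common T S H01 H02 HI \<longleftrightarrow>
    symmetric_op HI \<and>
    closure (Domain (free_op T H01 H02) \<inter> Domain HI) = UNIV \<and>
    (\<forall>n. \<forall>\<phi>\<in>Q_space T S H01 H02 n.
      \<phi> \<in> Domain HI \<and> op_apply HI \<phi> \<in> sector_sum T S {int n - 2..int n + 2})"

definition cond_AI ::
    "('a \<Rightarrow> 'f::chilbert_space \<Rightarrow> 'h::chilbert_space) \<Rightarrow> ('b list \<Rightarrow> 'f) \<Rightarrow>
     'a oper \<Rightarrow> 'f oper \<Rightarrow> real \<Rightarrow> real \<Rightarrow> 'h oper \<Rightarrow> bool"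
  where "cond_AI T S H01 H02 M1 M2 HI \<longleftrightarrow>
    cond_common T S H01 H02 HI \<and>
    (\<exists>C>0. \<forall>n \<psi>. \<forall>\<phi>\<in>Q_space T S H01 H02 n.
      (cmod (cinner \<psi> (op_apply HI \<phi>)))\<^sup>2
        \<le> C\<^sup>2 * (\<Sum>i\<in>{-2..2}. (norm (component T S (int n + i) \<psi>))\<^sup>2) *
          ((real n + 1)\<^sup>2 * (norm \<phi>)\<^sup>2 + (real n + 1) * X_norm_sq T H01 H02 M1 M2 \<phi>))"

definition diagonal_op ::
    "('a \<Rightarrow> 'f::chilbert_space \<Rightarrow> 'h::chilbert_space) \<Rightarrow> ('b list \<Rightarrow> 'f) \<Rightarrow> 'h oper \<Rightarrow> bool"
  where "diagonal_op T S A \<longleftrightarrow> (\<forall>n::nat.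
    op_apply A ` (Domain A \<inter> sector T S (int n)) \<subseteq> sector T S (int n) \<and>
    sector T S (int n) \<subseteq> closure (Domain A \<inter> sector T S (int n)))"

definition non_diagonal_op ::
    "('a \<Rightarrow> 'f::chilbert_space \<Rightarrow> 'h::chilbert_space) \<Rightarrow> ('b list \<Rightarrow> 'f) \<Rightarrow> 'h oper \<Rightarrow> bool"
  where "non_diagonal_op T S A \<longleftrightarrow> (\<forall>n::nat.
    op_apply A ` (Domain A \<inter> sector T S (int n)) \<subseteq> orth_compl (sector T S (int n)))"

definition cond_AI' ::
    "('a \<Rightarrow> 'f::chilbert_space \<Rightarrow> 'h::chilbert_space) \<Rightarrow> ('b list \<Rightarrow> 'f) \<Rightarrow>
     'a oper \<Rightarrow> 'f oper \<Rightarrow> real \<Rightarrow> real \<Rightarrow> 'h oper \<Rightarrow> bool"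
  where "cond_AI' T S H01 H02 M1 M2 HI \<longleftrightarrow>
    cond_common T S H01 H02 HI \<and>
    (\<exists>Hdiag H2. is_oper Hdiag \<and> is_oper H2 \<and> HI = op_plus Hdiag H2 \<and>
      diagonal_op T S Hdiag \<and> non_diagonal_op T S H2 \<and>
      (\<forall>n. Q_space T S H01 H02 n \<subseteq> Domain Hdiag \<and>
        (\<exists>C>0. \<forall>\<psi>. \<forall>\<phi>\<in>Q_space T S H01 H02 n.
          (cmod (cinner \<psi> (op_apply Hdiag \<phi>)))\<^sup>2
            \<le> C\<^sup>2 * (norm (component T S (int n) \<psi>))\<^sup>2 * X_norm_sq T H01 H02 M1 M2 \<phi>)) \<and>
      (\<forall>n::nat. sector T S (int n) \<subseteq> Domain H2) \<and>
      (\<exists>C>0. \<forall>n \<psi>. \<forall>\<phi>\<in>sector T S (int n).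
        cmod (cinner \<psi> (op_apply H2 \<phi>))
          \<le> C * (real n + 1) * norm \<phi> *
            (\<Sum>i\<in>{-2, -1, 1, 2}. norm (component T S (int n + i) \<psi>))))"

end

(* Let w be orthogonal to the range of H - z with z = i or z = -i; it suffices to show w = 0.
   On a sector the shifted free operator G = H01 x 1 + 1 x H02 + M has total range, because the
   resolvents R1, R2 of the two summands commute and G (R1 R2 y) = R1 y + R2 y. As the interaction is
   bounded relative to the form norm, w_n is the limit, in this norm, of approximate minimizers
   in the style of the Riesz representation theorem. Hence w_n lies in the form domain and is an
   admissible test vector, so that <w, H_I w_n> = (z + M) |w_n|^2 - |w_n|_X^2.
   Summing imaginary parts over n <= N, symmetry of H_I leaves only boundary terms, which are
   O(N) times the sum of |w_k|^2 over k close to N. If w were not 0, the sum of all |w_k|^2 would thus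
   dominate a multiple of the harmonic series. *)

theory Submission
  imports Defs
begin

section \<open>Complex Hilbert spaces\<close>

text \<open>A deficiency vector \<open>w\<close> lies only in the domain of the adjoint, so nothing
  is known beforehand about the form norm of w_n, and H_I is not assumed to be closed. Once w_n is
  admissible, the one identity for <w, H_I w_n> is used twice. Its imaginary part is Im z |w_n|^2
  and feeds the summation over n. Its real part bounds |w_n|_X^2 by M |w_n|^2 + |<w, H_I w_n>|.
  Under (A_I) the second use is decisive: the bound on H_I contains |w_n|_X again, with weight n + 1
  against (n + 1)^2 for |w_n|^2, and the arithmetic-geometric mean inequality absorbs it, leaving
  |w_n|_X^2 = O(n) times the sum of |w_k|^2 over |k - n| <= 2. The boundary terms then grow linearly
  in n, just slowly enough for the divergence of the harmonic series. Under (A_I') the constant C(n)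
  of the diagonal part may grow at will: that part of H_I w_n stays in sector n and is paired with a
  vector that has no component there.\<close>

lemma cinner_add_left: "cinner (x + y) z = cinner x z + cinner y z"
  by (metis cinner_add_right cinner_commute complex_cnj_add)

lemma cinner_scaleC_left: "cinner (c *\<^sub>C x) y = cnj c * cinner x y"
  by (metis cinner_scaleC_right cinner_commute complex_cnj_mult)

lemma scaleR_scaleC: "r *\<^sub>R x = complex_of_real r *\<^sub>C (x :: 'a::chilbert_space)"
  by (simp add: scaleC_of_real)

lemma cinner_scaleR_left: "cinner (r *\<^sub>R x) y = of_real r * cinner x y"
  by (simp add: scaleR_scaleC cinner_scaleC_left)

lemma cinner_scaleR_right: "cinner x (r *\<^sub>R y) = of_real r * cinner x y"
  by (simp add: scaleR_scaleC cinner_scaleC_right)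

lemma uminus_scaleC: "- x = (-1) *\<^sub>C (x :: 'a::chilbert_space)"
  using complex_vector.scale_minus_left[of 1 x] by simp

lemma cinner_minus_left: "cinner (- x) y = - cinner x y"
  unfolding uminus_scaleC[of x] cinner_scaleC_left by simp

lemma cinner_minus_right: "cinner x (- y) = - cinner x y"
  unfolding uminus_scaleC[of y] cinner_scaleC_right by simp

lemma cinner_diff_left: "cinner (x - y) z = cinner x z - cinner y z"
  using cinner_add_left[of x "- y" z] by (simp add: cinner_minus_left)

lemma cinner_diff_right: "cinner z (x - y) = cinner z x - cinner z y"
  using cinner_add_right[of z x "- y"] by (simp add: cinner_minus_right)

lemma cinner_zero_left [simp]: "cinner 0 x = 0"
  using cinner_add_left[of 0 0 x] by simp

lemma cinner_zero_right [simp]: "cinner x 0 = 0"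
  using cinner_add_right[of x 0 0] by simp

lemma cinner_sum_left: "cinner (sum f A) x = (\<Sum>i\<in>A. cinner (f i) x)"
  by (induction A rule: infinite_finite_induct) (auto simp: cinner_add_left)

lemma cinner_sum_right: "cinner x (sum f A) = (\<Sum>i\<in>A. cinner x (f i))"
  by (induction A rule: infinite_finite_induct) (auto simp: cinner_add_right)

lemma Im_cinner: "Im (cinner x y) = inner (\<i> *\<^sub>C x) y"
  using Re_cinner[of "\<i> *\<^sub>C x" y] by (simp add: cinner_scaleC_left)

lemma cinner_self: "cinner x x = of_real ((norm x)\<^sup>2)"
proof (rule complex_eqI)
  show "Re (cinner x x) = Re (of_real ((norm x)\<^sup>2))"
    by (simp add: Re_cinner power2_norm_eq_inner)
  show "Im (cinner x x) = Im (of_real ((norm x)\<^sup>2))"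
    using arg_cong[OF cinner_commute[of x x], of Im] by simp
qed

lemma cinner_eq_zero_self [simp]: "cinner x x = 0 \<longleftrightarrow> x = 0"
  by (simp add: cinner_self)

lemma cinner_zero_commute: "cinner x y = 0 \<longleftrightarrow> cinner y x = 0"
  by (metis cinner_commute complex_cnj_zero)

lemma norm_scaleC: "norm (c *\<^sub>C x) = cmod c * norm x"
proof -
  have "complex_of_real ((norm (c *\<^sub>C x))\<^sup>2) = of_real ((cmod c * norm x)\<^sup>2)"
  proof -
    have "complex_of_real ((norm (c *\<^sub>C x))\<^sup>2) = cinner (c *\<^sub>C x) (c *\<^sub>C x)"
      by (rule cinner_self[symmetric])
    also have "\<dots> = (c * cnj c) * cinner x x"
      by (simp add: cinner_scaleC_left cinner_scaleC_right)
    also have "\<dots> = of_real ((cmod c * norm x)\<^sup>2)"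
      by (simp only: cinner_self complex_norm_square[symmetric] power_mult_distrib of_real_mult)
    finally show ?thesis .
  qed
  then have "(norm (c *\<^sub>C x))\<^sup>2 = (cmod c * norm x)\<^sup>2"
    using of_real_eq_iff by blast
  then show ?thesis
    by (simp add: power2_eq_iff_nonneg)
qed

text \<open>Rotating one argument by such a phase turns a complex pairing into its modulus, which
  reduces the complex Cauchy-Schwarz inequalities below to real ones.\<close>

lemma exists_phase: "\<exists>u. cmod u = 1 \<and> u * z = of_real (cmod z)"
proof (cases "z = 0")
  case True
  then show ?thesis by (intro exI[of _ 1]) auto
next
  case False
  have "cnj z / of_real (cmod z) * z = (of_real (cmod z))\<^sup>2 / of_real (cmod z)"
    unfolding of_real_power[symmetric] complex_norm_square by (simp add: mult.commute)
  also have "\<dots> = of_real (cmod z)"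
    by (simp add: power2_eq_square)
  finally show ?thesis
    using False by (intro exI[of _ "cnj z / of_real (cmod z)"]) (simp add: norm_divide)
qed

lemma norm_cinner_le: "cmod (cinner x y) \<le> norm x * norm y"
proof -
  obtain u where u: "cmod u = 1" "u * cinner x y = of_real (cmod (cinner x y))"
    using exists_phase by blast
  have "cmod (cinner x y) = Re (cinner x (u *\<^sub>C y))"
    using u(2) by (simp add: cinner_scaleC_right)
  also have "\<dots> \<le> norm x * norm (u *\<^sub>C y)"
    by (simp add: Re_cinner norm_cauchy_schwarz)
  finally show ?thesis
    using u(1) by (simp add: norm_scaleC)
qed

interpretation cinner: bounded_bilinear "cinner :: 'a::chilbert_space \<Rightarrow> 'a \<Rightarrow> complex"
  by unfold_locales
    (auto simp: cinner_add_left cinner_add_right cinner_scaleR_left cinner_scaleR_right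
      scaleR_conv_of_real intro!: exI[of _ 1] norm_cinner_le)

lemma bounded_linear_scaleC: "bounded_linear (\<lambda>x :: 'a::chilbert_space. c *\<^sub>C x)"
  by (rule bounded_linear_intro[of _ "cmod c"])
    (auto simp: scaleC_add_right scaleR_scaleC scaleC_scaleC mult.commute norm_scaleC)

lemma csubspace_scaleR: "csubspace V \<Longrightarrow> x \<in> V \<Longrightarrow> r *\<^sub>R x \<in> V"
  by (simp add: scaleR_scaleC complex_vector.subspace_scale)

lemma closure_csubspace:
  assumes "csubspace V" shows "csubspace (closure V)"
proof (rule complex_vector.subspaceI)
  show "0 \<in> closure V"
    using assms closure_subset complex_vector.subspace_0 by blast
next
  fix x y assume "x \<in> closure V" "y \<in> closure V"
  then obtain f g where "\<forall>n. f n \<in> V" "f \<longlonglongrightarrow> x" "\<forall>n. g n \<in> V" "g \<longlonglongrightarrow> y"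
    unfolding closure_sequential by blast
  then show "x + y \<in> closure V"
    unfolding closure_sequential using assms
    by (intro exI[of _ "\<lambda>n. f n + g n"]) (auto intro: tendsto_add complex_vector.subspace_add)
next
  fix c x assume "x \<in> closure V"
  then obtain f where "\<forall>n. f n \<in> V" "f \<longlonglongrightarrow> x"
    unfolding closure_sequential by blast
  then show "c *\<^sub>C x \<in> closure V"
    unfolding closure_sequential using assms bounded_linear.tendsto[OF bounded_linear_scaleC]
    by (intro exI[of _ "\<lambda>n. c *\<^sub>C f n"]) (auto intro: complex_vector.subspace_scale)
qed

lemma closed_hyperplane: "closed {x. cinner y x = (0::complex)}"
  by (intro closed_Collect_eq continuous_intros cinner.continuous_on)

lemma csubspace_hyperplane: "csubspace {x. cinner y x = 0}"
  by (rule complex_vector.subspaceI) (auto simp: cinner_add_right cinner_scaleC_right)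

lemma orthogonal_closure_cspan:
  assumes "x \<in> closure (cspan B)" "\<And>b. b \<in> B \<Longrightarrow> cinner y b = 0"
  shows "cinner y x = 0"
proof -
  have "cspan B \<subseteq> {x. cinner y x = 0}"
    using assms(2) by (intro complex_vector.span_minimal csubspace_hyperplane) auto
  then have "closure (cspan B) \<subseteq> {x. cinner y x = 0}"
    by (rule closure_minimal[OF _ closed_hyperplane])
  with assms(1) show ?thesis by auto
qed

lemma orthogonal_closure_cspans:
  assumes "x \<in> closure (cspan B)" "y \<in> closure (cspan C)"
    and "\<And>b c. b \<in> B \<Longrightarrow> c \<in> C \<Longrightarrow> cinner b c = 0"
  shows "cinner x y = 0"
proof -
  have "cinner y b = 0" if "b \<in> B" for b
    using orthogonal_closure_cspan[OF assms(2), of b] assms(3)[OF that] cinner_zero_commute by blast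
  from orthogonal_closure_cspan[OF assms(1) this] show ?thesis
    using cinner_zero_commute by blast
qed

section \<open>Quadratic inequalities, approximate minimizers and orthogonal projections\<close>

lemma discriminant_le:
  fixes p q r :: real
  assumes "\<And>t. 0 \<le> p + 2 * t * q + t\<^sup>2 * r" "r \<ge> 0"
  shows "q\<^sup>2 \<le> p * r"
proof (cases "r = 0")
  case True
  have "q = 0"
  proof (rule ccontr)
    assume "q \<noteq> 0"
    \<comment> \<open>At this point the linear function takes the value -1.\<close>
    with assms(1)[of "- (p + 1) / (2 * q)"] True show False
      by (simp add: field_simps)
  qed
  with True show ?thesis by simp
next
  case False
  with \<open>r \<ge> 0\<close> have r: "r > 0" by simp
  have "0 \<le> p + 2 * (- q / r) * q + (- q / r)\<^sup>2 * r"
    by (rule assms(1))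
  also have "\<dots> = p - q\<^sup>2 / r"
    using r by (simp add: power2_eq_square field_simps)
  finally show ?thesis
    using r by (simp add: field_simps)
qed

text \<open>An approximate version of the Riesz representation theorem, which needs no
  completeness: \<open>s\<close> is an approximate minimizer of \<open>b x x - 2 * l x\<close>.\<close>

lemma riesz_approx:
  fixes b :: "'a::real_vector \<Rightarrow> 'a \<Rightarrow> real"
  assumes V: "subspace V"
    and b_add: "\<And>x y z. x \<in> V \<Longrightarrow> y \<in> V \<Longrightarrow> z \<in> V \<Longrightarrow> b x (y + z) = b x y + b x z"
    and b_scale: "\<And>x y r. x \<in> V \<Longrightarrow> y \<in> V \<Longrightarrow> b x (r *\<^sub>R y) = r * b x y"
    and b_sym: "\<And>x y. x \<in> V \<Longrightarrow> y \<in> V \<Longrightarrow> b x y = b y x"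
    and b_pos: "\<And>x. x \<in> V \<Longrightarrow> 0 \<le> b x x"
    and l_add: "\<And>x y. x \<in> V \<Longrightarrow> y \<in> V \<Longrightarrow> l (x + y) = l x + l y"
    and l_scale: "\<And>x r. x \<in> V \<Longrightarrow> l (r *\<^sub>R x) = r * l x"
    and l_bound: "\<And>x. x \<in> V \<Longrightarrow> l x \<le> c * sqrt (b x x)"
    and "e > 0"
  shows "\<exists>s\<in>V. \<forall>x\<in>V. \<bar>b s x - l x\<bar> \<le> e * sqrt (b x x)"
proof -
  define J where "J x = b x x - 2 * l x" for x
  have J_lower: "- (c\<^sup>2) \<le> J x" if "x \<in> V" for x
  proof -
    have "0 \<le> (sqrt (b x x) - c)\<^sup>2" by simp
    also have "\<dots> = b x x - 2 * (c * sqrt (b x x)) + c\<^sup>2"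
      using b_pos[OF that] by (simp add: power2_diff)
    also have "\<dots> \<le> b x x - 2 * l x + c\<^sup>2"
      using l_bound[OF that] by simp
    finally show ?thesis by (simp add: J_def)
  qed
  have bdd: "bdd_below (J ` V)"
    using J_lower by (auto intro!: bdd_belowI)
  have ne: "J ` V \<noteq> {}"
    using subspace_0[OF V] by auto
  have "Inf (J ` V) < Inf (J ` V) + e\<^sup>2"
    using \<open>e > 0\<close> by simp
  then obtain s where s: "s \<in> V" "J s < Inf (J ` V) + e\<^sup>2"
    using cInf_lessD[OF ne] by blast
  show ?thesis
  proof (intro bexI[OF _ s(1)] ballI)
    fix x assume x: "x \<in> V"
    \<comment> \<open>\<open>J\<close> never drops below its infimum along the line through
      \<open>s\<close>, and \<open>J s\<close> is within \<open>e\<^sup>2\<close> of it; the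
      discriminant of this quadratic in \<open>t\<close> is the Euler-Lagrange equation up to
      \<open>e\<close>.\<close>
    have "0 \<le> e\<^sup>2 + 2 * t * (b s x - l x) + t\<^sup>2 * b x x" for t
    proof -
      have tx: "t *\<^sub>R x \<in> V" "s + t *\<^sub>R x \<in> V"
        using V x s(1) by (auto intro: subspace_scale subspace_add)
      have "b (s + t *\<^sub>R x) (s + t *\<^sub>R x) = b s s + t * b s x + (t * b x s + t * (t * b x x))"
        using s(1) x tx by (simp add: b_add b_scale b_sym[OF tx(2) s(1)] b_sym[OF tx(2) x]
            b_sym[OF s(1) x] algebra_simps)
      then have "J (s + t *\<^sub>R x) = J s + 2 * t * (b s x - l x) + t\<^sup>2 * b x x"
        using s(1) x tx b_sym[OF s(1) x]
        by (simp add: J_def l_add l_scale power2_eq_square algebra_simps)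
      moreover have "Inf (J ` V) \<le> J (s + t *\<^sub>R x)"
        using bdd tx(2) by (intro cInf_lower) auto
      ultimately show ?thesis using s(2) by linarith
    qed
    then have "(b s x - l x)\<^sup>2 \<le> e\<^sup>2 * b x x"
      using b_pos[OF x] by (rule discriminant_le)
    then have "sqrt ((b s x - l x)\<^sup>2) \<le> sqrt (e\<^sup>2 * b x x)"
      by (rule real_sqrt_le_mono)
    then show "\<bar>b s x - l x\<bar> \<le> e * sqrt (b x x)"
      using \<open>e > 0\<close> by (simp add: real_sqrt_mult)
  qed
qed

lemma csubspace_subspace: "csubspace V \<Longrightarrow> subspace V"
  by (auto simp: subspace_def complex_vector.subspace_def scaleR_scaleC)

text \<open>For the inner product and the functional \<open>inner x\<close>, approximate minimizers
  are approximate projections. Two of them can be compared on their own difference, which makes the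
  sequence Cauchy, and the limit stays in \<open>V\<close> because \<open>V\<close> is
  closed.\<close>

lemma orth_proj_exists:
  fixes V :: "'a::chilbert_space set"
  assumes V: "csubspace V" "closed V"
  shows "\<exists>y\<in>V. x - y \<in> orth_compl V"
proof -
  have "\<exists>s\<in>V. \<forall>z\<in>V. \<bar>inner s z - inner x z\<bar> \<le> e * sqrt (inner z z)" if "e > 0" for e
    using that
    by (intro riesz_approx[where c = "norm x"])
      (auto simp: V csubspace_subspace inner_add_right inner_commute[of _ x]
        norm_eq_sqrt_inner[symmetric] norm_cauchy_schwarz intro: inner_commute)
  then have "\<forall>n. \<exists>s\<in>V. \<forall>z\<in>V. \<bar>inner s z - inner x z\<bar> \<le> inverse (Suc n) * norm z"
    by (simp add: norm_eq_sqrt_inner)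
  then obtain s where s: "\<And>n. s n \<in> V"
    "\<And>n z. z \<in> V \<Longrightarrow> \<bar>inner (s n) z - inner x z\<bar> \<le> inverse (Suc n) * norm z"
    by metis
  have "norm (s m - s n) \<le> inverse (Suc m) + inverse (Suc n)" for m n
  proof (cases "s m = s n")
    case False
    let ?d = "s m - s n"
    have d: "?d \<in> V" using s V by (simp add: complex_vector.subspace_diff)
    have "norm ?d * norm ?d = (inner (s m) ?d - inner x ?d) - (inner (s n) ?d - inner x ?d)"
      by (simp add: power2_norm_eq_inner[symmetric] power2_eq_square[symmetric] inner_diff_left[symmetric])
    also have "\<dots> \<le> inverse (Suc m) * norm ?d + inverse (Suc n) * norm ?d"
      using s(2)[OF d, of m] s(2)[OF d, of n] by linarith
    also have "\<dots> = (inverse (Suc m) + inverse (Suc n)) * norm ?d"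
      by (simp add: algebra_simps)
    finally show ?thesis using False by (simp add: mult_le_cancel_right)
  qed auto
  note bound = this
  have "Cauchy s"
  proof (rule CauchyI)
    fix e :: real assume "e > 0"
    then obtain N where N: "inverse (real (Suc N)) < e / 2"
      using reals_Archimedean half_gt_zero by blast
    have "norm (s m - s n) < e" if "m \<ge> N" "n \<ge> N" for m n
    proof -
      have "inverse (real (Suc m)) \<le> inverse (real (Suc N))"
        "inverse (real (Suc n)) \<le> inverse (real (Suc N))"
        using that by (auto intro!: le_imp_inverse_le)
      with bound[of m n] N show ?thesis by linarith
    qed
    then show "\<exists>M. \<forall>m\<ge>M. \<forall>n\<ge>M. norm (s m - s n) < e" by blast
  qed
  then obtain y where y: "s \<longlonglongrightarrow> y"
    using Cauchy_convergent convergent_def by blast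
  have yV: "y \<in> V"
    using V(2) s(1) y closed_sequentially by blast
  have orth: "inner z (x - y) = 0" if "z \<in> V" for z
  proof -
    have "(\<lambda>n. \<bar>inner (s n) z - inner x z\<bar>) \<longlonglongrightarrow> 0"
    proof (rule tendsto_sandwich[OF _ _ tendsto_const])
      show "(\<lambda>n. inverse (real (Suc n)) * norm z) \<longlonglongrightarrow> 0"
        using tendsto_mult_left_zero[OF LIMSEQ_inverse_real_of_nat] by simp
    qed (use s(2)[OF that] in auto)
    moreover have "(\<lambda>n. \<bar>inner (s n) z - inner x z\<bar>) \<longlonglongrightarrow> \<bar>inner y z - inner x z\<bar>"
      by (intro tendsto_intros y)
    ultimately have "\<bar>inner y z - inner x z\<bar> = 0"
      using LIMSEQ_unique by blast
    then show ?thesis by (simp add: inner_diff_right inner_commute)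
  qed
  \<comment> \<open>The real inner product gives the real part; the imaginary part comes from
    testing with \<open>\<i> *\<^sub>C z\<close>, which lies in \<open>V\<close> as well.\<close>
  have "cinner z (x - y) = 0" if z: "z \<in> V" for z
  proof (rule complex_eqI)
    show "Re (cinner z (x - y)) = Re 0" using orth[OF z] by (simp add: Re_cinner)
    show "Im (cinner z (x - y)) = Im 0"
      using orth[OF complex_vector.subspace_scale[OF V(1) z]] by (simp add: Im_cinner)
  qed
  with yV show ?thesis by (auto simp: orth_compl_def)
qed

lemma orth_proj_eqI:
  assumes V: "csubspace V" and y: "y \<in> V" "x - y \<in> orth_compl V"
  shows "orth_proj V x = y"
  unfolding orth_proj_def
proof (rule the_equality)
  fix z assume z: "z \<in> V \<and> x - z \<in> orth_compl V"
  have zy: "z - y \<in> V" using V z y by (simp add: complex_vector.subspace_diff)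
  have "cinner (z - y) (z - y) = cinner (z - y) (x - y) - cinner (z - y) (x - z)"
    by (simp add: cinner_diff_right)
  also have "\<dots> = 0" using zy y z by (simp add: orth_compl_def)
  finally show "z = y" by simp
qed (use y in simp)

section \<open>The projection onto a fixed closed subspace\<close>

context
  fixes V :: "'a::chilbert_space set"
  assumes V: "csubspace V" "closed V"
begin

lemma orth_proj_in: "orth_proj V x \<in> V"
  using orth_proj_exists[OF V] orth_proj_eqI[OF V(1)] by metis

lemma orth_proj_orth: "x - orth_proj V x \<in> orth_compl V"
  using orth_proj_exists[OF V] orth_proj_eqI[OF V(1)] by metis

lemma orth_proj_id: "x \<in> V \<Longrightarrow> orth_proj V x = x"
  by (rule orth_proj_eqI[OF V(1)]) (auto simp: orth_compl_def)

lemma orth_proj_zero: "x \<in> orth_compl V \<Longrightarrow> orth_proj V x = 0"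
  by (rule orth_proj_eqI[OF V(1)]) (auto simp: complex_vector.subspace_0 V)

lemma cinner_orth_proj: "y \<in> V \<Longrightarrow> cinner y (orth_proj V x) = cinner y x"
  using orth_proj_orth[of x] by (auto simp: orth_compl_def cinner_diff_right)

lemma cinner_orth_proj_left: "y \<in> V \<Longrightarrow> cinner (orth_proj V x) y = cinner x y"
  by (metis cinner_orth_proj cinner_commute)

lemma orth_proj_add: "orth_proj V (x + y) = orth_proj V x + orth_proj V y"
  using orth_proj_orth[of x] orth_proj_orth[of y]
  by (intro orth_proj_eqI V complex_vector.subspace_add orth_proj_in)
    (auto simp: orth_compl_def cinner_diff_right cinner_add_right)

lemma orth_proj_scaleC: "orth_proj V (c *\<^sub>C x) = c *\<^sub>C orth_proj V x"
  using orth_proj_orth[of x]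
  by (intro orth_proj_eqI V complex_vector.subspace_scale orth_proj_in)
    (auto simp: orth_compl_def cinner_diff_right cinner_scaleC_right)

lemma norm_orth_proj_le: "norm (orth_proj V x) \<le> norm x"
proof (cases "orth_proj V x = 0")
  case False
  have "(norm (orth_proj V x))\<^sup>2 = inner (orth_proj V x) x"
    using cinner_orth_proj[OF orth_proj_in, of x x]
    by (metis Re_cinner power2_norm_eq_inner)
  also have "\<dots> \<le> norm (orth_proj V x) * norm x"
    by (rule norm_cauchy_schwarz)
  finally show ?thesis using False by (simp add: power2_eq_square)
qed simp

lemma bounded_linear_orth_proj: "bounded_linear (orth_proj V)"
  by (rule bounded_linear_intro[of _ 1])
    (auto simp: orth_proj_add orth_proj_scaleC scaleR_scaleC norm_orth_proj_le)

lemma orth_proj_diff: "orth_proj V (x - y) = orth_proj V x - orth_proj V y"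
  by (rule linear_diff[OF bounded_linear.linear[OF bounded_linear_orth_proj]])

lemma orth_proj_sum: "orth_proj V (sum f I) = (\<Sum>i\<in>I. orth_proj V (f i))"
  by (rule linear_sum[OF bounded_linear.linear[OF bounded_linear_orth_proj]])

end

lemma dense_if_orth_trivial:
  fixes V :: "'a::chilbert_space set"
  assumes V: "csubspace V" and "\<And>x. (\<And>y. y \<in> V \<Longrightarrow> cinner y x = 0) \<Longrightarrow> x = 0"
  shows "closure V = UNIV"
proof -
  have "x \<in> closure V" for x
  proof -
    obtain y where y: "y \<in> closure V" "x - y \<in> orth_compl (closure V)"
      using orth_proj_exists[OF closure_csubspace[OF V] closed_closure] by blast
    then have "x - y = 0"
      using closure_subset[of V] by (intro assms(2)) (auto simp: orth_compl_def)
    with y(1) show ?thesis by simp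
  qed
  then show ?thesis by auto
qed

lemma orth_dense:
  fixes x :: "'a::chilbert_space"
  assumes "closure V = UNIV" and "\<And>y. y \<in> V \<Longrightarrow> cinner x y = 0"
  shows "x = 0"
proof -
  have "closure V \<subseteq> {y. cinner x y = 0}"
    using assms(2) by (intro closure_minimal closed_hyperplane) auto
  then have "cinner x x = 0" using assms(1) by blast
  then show ?thesis by simp
qed

section \<open>Unbounded operators\<close>

context
  fixes A :: "'a::chilbert_space oper"
  assumes A: "csubspace A"
begin

lemma oper_add: "(x, y) \<in> A \<Longrightarrow> (x', y') \<in> A \<Longrightarrow> (x + x', y + y') \<in> A"
  using complex_vector.subspace_add[OF A] by fastforce

lemma oper_diff: "(x, y) \<in> A \<Longrightarrow> (x', y') \<in> A \<Longrightarrow> (x - x', y - y') \<in> A"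
  using complex_vector.subspace_diff[OF A] by fastforce

lemma oper_scaleC: "(x, y) \<in> A \<Longrightarrow> (c *\<^sub>C x, c *\<^sub>C y) \<in> A"
  using complex_vector.subspace_scale[OF A, of "(x, y)" c] by (simp add: scaleC_prod_def)

lemma oper_zero: "(0, 0) \<in> A"
  using complex_vector.subspace_0[OF A] by (simp add: zero_prod_def)

lemma csubspace_Domain: "csubspace (Domain A)"
  by (rule complex_vector.subspaceI) (auto intro: oper_zero oper_add oper_scaleC)

lemma csubspace_range_shift: "csubspace ((\<lambda>(x, y). y - z *\<^sub>C x) ` A)"
proof (rule complex_vector.subspaceI)
  show "0 \<in> (\<lambda>(x, y). y - z *\<^sub>C x) ` A"
    using oper_zero by (force intro: rev_image_eqI)
next
  fix u v assume "u \<in> (\<lambda>(x, y). y - z *\<^sub>C x) ` A" "v \<in> (\<lambda>(x, y). y - z *\<^sub>C x) ` A"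
  then obtain x y x' y' where *: "(x, y) \<in> A" "(x', y') \<in> A" "u = y - z *\<^sub>C x" "v = y' - z *\<^sub>C x'"
    by auto
  then show "u + v \<in> (\<lambda>(x, y). y - z *\<^sub>C x) ` A"
    by (intro rev_image_eqI[OF oper_add[OF *(1,2)]]) (simp add: scaleC_add_right)
next
  fix c u assume "u \<in> (\<lambda>(x, y). y - z *\<^sub>C x) ` A"
  then obtain x y where *: "(x, y) \<in> A" "u = y - z *\<^sub>C x"
    by auto
  then show "c *\<^sub>C u \<in> (\<lambda>(x, y). y - z *\<^sub>C x) ` A"
    by (intro rev_image_eqI[OF oper_scaleC[OF *(1), of c]])
      (simp add: complex_vector.scale_right_diff_distrib mult.commute)
qed

text \<open>The map (x, y) -> y - z x is bounded below on the graph, so the image of the complete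
  graph is complete and hence closed; the orthogonality hypothesis makes it dense.\<close>

lemma range_shift_UNIV:
  assumes "closed A"
    and below: "\<And>x y. (x, y) \<in> A \<Longrightarrow> norm x \<le> K * norm (y - z *\<^sub>C x)"
    and orth: "\<And>w. (\<And>x y. (x, y) \<in> A \<Longrightarrow> cinner w (y - z *\<^sub>C x) = 0) \<Longrightarrow> w = 0"
  shows "(\<lambda>(x, y). y - z *\<^sub>C x) ` A = UNIV"
proof -
  let ?f = "\<lambda>(x, y). y - z *\<^sub>C x"
  \<comment> \<open>The graph norm is at most |x| + |y|, and \<open>y\<close> is the image plus
    \<open>z *\<^sub>C x\<close>, whence the three summands.\<close>
  define L where "L = 1 + \<bar>K\<bar> + cmod z * \<bar>K\<bar>"
  have L: "L > 0" by (simp add: L_def add_pos_nonneg)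
  have f: "bounded_linear ?f"
    unfolding split_def
    by (intro bounded_linear_sub bounded_linear_snd
        bounded_linear_compose[OF bounded_linear_scaleC bounded_linear_fst])
  have "complete (?f ` A)"
  proof (rule complete_isometric_image)
    show "0 < 1 / L" using L by simp
    show "subspace A" by (rule csubspace_subspace[OF A])
    show "bounded_linear ?f" by (rule f)
    show "complete A" using \<open>closed A\<close> by (simp add: complete_eq_closed)
    show "\<forall>p\<in>A. 1 / L * norm p \<le> norm (?f p)"
    proof clarify
      fix x y assume xy: "(x, y) \<in> A"
      let ?w = "y - z *\<^sub>C x"
      have x: "norm x \<le> \<bar>K\<bar> * norm ?w"
        using below[OF xy] by (rule order_trans) (simp add: mult_right_mono)
      have "norm y \<le> norm ?w + norm (z *\<^sub>C x)"
        by (metis diff_add_cancel norm_triangle_ineq)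
      also have "\<dots> \<le> norm ?w + cmod z * (\<bar>K\<bar> * norm ?w)"
        using x by (simp add: norm_scaleC mult_left_mono)
      finally have "norm x + norm y \<le> L * norm ?w"
        using x by (simp add: L_def algebra_simps)
      then have "norm (x, y) \<le> L * norm ?w"
        using norm_Pair_le[of x y] by linarith
      then show "1 / L * norm (x, y) \<le> norm (y - z *\<^sub>C x)"
        using L by (simp add: field_simps)
    qed
  qed
  then have cl: "closed (?f ` A)" by (simp add: complete_eq_closed)
  have "closure (?f ` A) = UNIV"
  proof (rule dense_if_orth_trivial[OF csubspace_range_shift])
    fix w assume "\<And>v. v \<in> ?f ` A \<Longrightarrow> cinner v w = 0"
    then have "\<And>x y. (x, y) \<in> A \<Longrightarrow> cinner w (y - z *\<^sub>C x) = 0"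
      by (subst cinner_zero_commute) (force intro: rev_image_eqI)
    then show "w = 0" by (rule orth)
  qed
  with cl show ?thesis by simp
qed

end

section \<open>Values, sums and restrictions of operators\<close>

lemma op_apply_eq: "is_oper A \<Longrightarrow> (x, y) \<in> A \<Longrightarrow> op_apply A x = y"
  unfolding op_apply_def is_oper_def by (blast dest: single_valuedD)

lemma op_apply_in: "is_oper A \<Longrightarrow> x \<in> Domain A \<Longrightarrow> (x, op_apply A x) \<in> A"
  by (auto simp: op_apply_eq)

lemma is_oper_csubspace: "is_oper A \<Longrightarrow> csubspace A"
  by (simp add: is_oper_def)

context
  fixes A :: "'a::chilbert_space oper"
  assumes A: "is_oper A"
begin

lemma op_apply_add:
  "x \<in> Domain A \<Longrightarrow> y \<in> Domain A \<Longrightarrow> op_apply A (x + y) = op_apply A x + op_apply A y"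
  by (intro op_apply_eq[OF A] oper_add is_oper_csubspace op_apply_in A)

lemma op_apply_diff:
  "x \<in> Domain A \<Longrightarrow> y \<in> Domain A \<Longrightarrow> op_apply A (x - y) = op_apply A x - op_apply A y"
  by (intro op_apply_eq[OF A] oper_diff is_oper_csubspace op_apply_in A)

lemma op_apply_scaleC: "x \<in> Domain A \<Longrightarrow> op_apply A (c *\<^sub>C x) = c *\<^sub>C op_apply A x"
  by (intro op_apply_eq[OF A] oper_scaleC is_oper_csubspace op_apply_in A)

lemma op_apply_zero: "op_apply A 0 = 0"
  by (intro op_apply_eq[OF A] oper_zero is_oper_csubspace A)

lemma op_apply_sum:
  assumes "\<And>i. i \<in> I \<Longrightarrow> f i \<in> Domain A"
  shows "sum f I \<in> Domain A \<and> op_apply A (sum f I) = (\<Sum>i\<in>I. op_apply A (f i))"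
  using assms
proof (induction I rule: infinite_finite_induct)
  case (insert i I)
  then show ?case
    using complex_vector.subspace_add[OF csubspace_Domain[OF is_oper_csubspace[OF A]]]
    by (simp add: op_apply_add)
qed (use complex_vector.subspace_0[OF csubspace_Domain[OF is_oper_csubspace[OF A]]]
      op_apply_zero in auto)

end

lemma op_plus_iff:
  assumes "is_oper A" "is_oper B"
  shows "(x, w) \<in> op_plus A B \<longleftrightarrow>
    x \<in> Domain A \<and> x \<in> Domain B \<and> w = op_apply A x + op_apply B x"
  unfolding op_plus_def using op_apply_eq[OF assms(1)] op_apply_eq[OF assms(2)] by blast

lemma is_oper_op_plus:
  assumes A: "is_oper A" and B: "is_oper B"
  shows "is_oper (op_plus A B)"
proof -
  note * = op_plus_iff[OF A B]
  have "csubspace (op_plus A B)"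
    using is_oper_csubspace[OF A] is_oper_csubspace[OF B] A B
    by (intro complex_vector.subspaceI)
      (auto simp: * zero_prod_def scaleC_prod_def op_apply_zero op_apply_add op_apply_scaleC
        scaleC_add_right complex_vector.subspace_0 complex_vector.subspace_add
        complex_vector.subspace_scale csubspace_Domain simp del: Domain_iff Domain.simps)
  moreover have "single_valued (op_plus A B)"
    by (auto simp: single_valued_def *)
  ultimately show ?thesis by (simp add: is_oper_def)
qed

lemma is_oper_op_restrict:
  "is_oper A \<Longrightarrow> csubspace D \<Longrightarrow> is_oper (op_restrict A D)"
  unfolding is_oper_def op_restrict_def
  by (auto simp: single_valued_def zero_prod_def scaleC_prod_def oper_zero oper_add oper_scaleC
      complex_vector.subspace_0 complex_vector.subspace_add complex_vector.subspace_scale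
      intro!: complex_vector.subspaceI)

section \<open>Adjoints, closability and the basic criterion for essential self-adjointness\<close>

lemma subset_adjoint_opD:
  "A \<subseteq> adjoint_op A \<Longrightarrow> (x, y) \<in> A \<Longrightarrow> (x', y') \<in> A \<Longrightarrow> cinner x y' = cinner y x'"
  unfolding adjoint_op_def by blast

lemma subset_adjoint_opI:
  "(\<And>x y x' y'. (x, y) \<in> A \<Longrightarrow> (x', y') \<in> A \<Longrightarrow> cinner x y' = cinner y x') \<Longrightarrow> A \<subseteq> adjoint_op A"
  unfolding adjoint_op_def by auto

text \<open>Each condition on \<open>q\<close> is conjugate linear and continuous, so the adjoint is
  an intersection of closed complex subspaces; closedness and linearity follow at once.\<close>

lemma adjoint_op_altdef: "adjoint_op A = (\<Inter>p\<in>A. {q. cinner (fst q) (snd p) - cinner (snd q) (fst p) = 0})"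
  by (fastforce simp: adjoint_op_def)

lemma closed_adjoint_op: "closed (adjoint_op A)"
  unfolding adjoint_op_altdef
  by (intro closed_INT ballI closed_Collect_eq continuous_intros cinner.continuous_on)

lemma csubspace_adjoint_op: "csubspace (adjoint_op A)"
  unfolding adjoint_op_altdef
  by (intro complex_vector.subspace_Inter ballI, elim imageE)
    (auto intro!: complex_vector.subspaceI
      simp: scaleC_prod_def cinner_add_left cinner_scaleC_left algebra_simps)

lemma single_valued_adjoint_op:
  assumes "closure (Domain A) = UNIV"
  shows "single_valued (adjoint_op A)"
proof (rule single_valuedI)
  fix x y z assume *: "(x, y) \<in> adjoint_op A" "(x, z) \<in> adjoint_op A"
  have "y - z = 0"
    using assms
  proof (rule orth_dense)
    fix u assume "u \<in> Domain A"
    then obtain v where "(u, v) \<in> A" by auto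
    with * have "cinner x v = cinner y u" "cinner x v = cinner z u"
      by (auto simp: adjoint_op_def)
    then show "cinner (y - z) u = 0" by (simp add: cinner_diff_left)
  qed
  then show "y = z" by simp
qed

lemma adjoint_op_closure: "adjoint_op (closure A) = adjoint_op A"
proof
  show "adjoint_op (closure A) \<subseteq> adjoint_op A"
    unfolding adjoint_op_def using closure_subset[of A] by blast
  have "A \<subseteq> {p. cinner y (snd p) - cinner z (fst p) = 0}" if "(y, z) \<in> adjoint_op A" for y z
    using that by (auto simp: adjoint_op_def)
  then have "closure A \<subseteq> {p. cinner y (snd p) - cinner z (fst p) = 0}"
    if "(y, z) \<in> adjoint_op A" for y z
    using that
    by (intro closure_minimal closed_Collect_eq continuous_intros cinner.continuous_on)
  then show "adjoint_op A \<subseteq> adjoint_op (closure A)"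
    by (fastforce simp: adjoint_op_def)
qed

lemma symmetric_closure:
  assumes "A \<subseteq> adjoint_op A" shows "closure A \<subseteq> adjoint_op (closure A)"
  unfolding adjoint_op_closure by (rule closure_minimal[OF assms closed_adjoint_op])

text \<open>The closure remains inside the adjoint, which is closed, and the adjoint is single
  valued by density of the domain.\<close>

lemma is_oper_closure:
  assumes "csubspace A" "A \<subseteq> adjoint_op A" "closure (Domain A) = UNIV"
  shows "is_oper (closure A)"
  using closure_csubspace[OF assms(1)] single_valued_adjoint_op[OF assms(3)]
    closure_minimal[OF assms(2) closed_adjoint_op]
  by (auto simp: is_oper_def intro: single_valued_subset)

lemma symmetric_Im_zero:
  assumes "A \<subseteq> adjoint_op A" "(x, y) \<in> A"
  shows "Im (cinner x y) = 0"
proof -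
  have "cinner x y = cnj (cinner x y)"
    using subset_adjoint_opD[OF assms(1,2,2)] cinner_commute by metis
  then show ?thesis by (metis Im_complex_of_real Reals_cnj_iff complex_is_Real_iff)
qed

text \<open>Asking for every \<open>z\<close> with \<open>z\<^sup>2 = -1\<close> covers both
  deficiency spaces. The closure minus \<open>\<i>\<close> is onto, so every element of the graph of
  the adjoint agrees with one of the closure up to a deficiency vector, which vanishes.\<close>

lemma ess_self_adjoint_opI:
  assumes A: "symmetric_op A"
    and orth: "\<And>w z. z\<^sup>2 = -1 \<Longrightarrow> (\<And>x y. (x, y) \<in> A \<Longrightarrow> cinner w (y - z *\<^sub>C x) = 0) \<Longrightarrow> w = 0"
  shows "ess_self_adjoint_op A"
proof -
  from A have *: "is_oper A" "closure (Domain A) = UNIV" "A \<subseteq> adjoint_op A"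
    by (auto simp: symmetric_op_def)
  let ?B = "closure A"
  have B: "csubspace ?B" "closed ?B" "?B \<subseteq> adjoint_op ?B" "is_oper ?B"
    using * by (auto intro: closure_csubspace is_oper_csubspace symmetric_closure is_oper_closure
        dest: symmetric_closure)
  have "closure (Domain A) \<subseteq> closure (Domain ?B)"
    by (intro closure_mono Domain_mono closure_subset)
  with * have dense: "closure (Domain ?B) = UNIV" by auto
  have range: "(\<lambda>(x, y). y - \<i> *\<^sub>C x) ` ?B = UNIV"
  proof (rule range_shift_UNIV[OF B(1,2)])
    fix x y assume xy: "(x, y) \<in> ?B"
    \<comment> \<open>\<open>cinner x y\<close> is real by symmetry, so the imaginary part comes
      from \<open>\<i> *\<^sub>C x\<close> alone.\<close>
    have "(norm x)\<^sup>2 = - Im (cinner x (y - \<i> *\<^sub>C x))"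
      using symmetric_Im_zero[OF B(3) xy]
      by (simp add: cinner_diff_right cinner_scaleC_right cinner_self)
    also have "\<dots> \<le> norm x * norm (y - \<i> *\<^sub>C x)"
      using abs_Im_le_cmod[of "cinner x (y - \<i> *\<^sub>C x)"] norm_cinner_le[of x "y - \<i> *\<^sub>C x"] by linarith
    finally show "norm x \<le> 1 * norm (y - \<i> *\<^sub>C x)"
      by (cases "x = 0") (auto simp: power2_eq_square)
  next
    fix w assume "\<And>x y. (x, y) \<in> ?B \<Longrightarrow> cinner w (y - \<i> *\<^sub>C x) = 0"
    then show "w = 0"
      using orth[of \<i> w] closure_subset[of A] by auto
  qed
  have "adjoint_op ?B \<subseteq> ?B"
  proof clarify
    fix y z assume yz: "(y, z) \<in> adjoint_op ?B"
    obtain w v where wv: "(w, v) \<in> ?B" "z - \<i> *\<^sub>C y = v - \<i> *\<^sub>C w"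
      using range by (metis (no_types, lifting) UNIV_I case_prod_conv imageE surj_pair)
    have zv: "z - v = \<i> *\<^sub>C (y - w)"
      using wv(2) by (simp add: complex_vector.scale_right_diff_distrib algebra_simps)
    have adj: "(y - w, z - v) \<in> adjoint_op A"
      using oper_diff[OF csubspace_adjoint_op yz] wv(1) B(3) adjoint_op_closure by blast
    \<comment> \<open>The difference is in the kernel of the adjoint minus \<open>\<i>\<close>,
      hence orthogonal to the range of \<open>A + \<i>\<close>; this is the hypothesis at
      \<open>- \<i>\<close>.\<close>
    have "y - w = 0"
    proof (rule orth[of "-\<i>"])
      fix x x' assume "(x, x') \<in> A"
      with adj have "cinner (y - w) x' = cinner (z - v) x"
        by (auto simp: adjoint_op_def)
      then show "cinner (y - w) (x' - (- \<i>) *\<^sub>C x) = 0"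
        unfolding zv cinner_diff_right cinner_scaleC_left cinner_scaleC_right by simp
    qed simp
    with zv wv(1) show "(y, z) \<in> ?B" by simp
  qed
  with B dense A show ?thesis
    by (auto simp: ess_self_adjoint_op_def self_adjoint_op_def)
qed

subsection \<open>Quadratic forms\<close>

locale semibounded_oper =
  fixes A :: "'a::chilbert_space oper" and m :: real
  assumes is_oper: "is_oper A"
    and symmetric: "A \<subseteq> adjoint_op A"
    and lower_bound: "lower_bound_op A m"
begin

text \<open>Subtracting the lower bound makes the form positive semidefinite on the domain, so that
  it obeys Cauchy-Schwarz and the triangle inequality; undoing the shift costs a multiple of the
  squared norm.\<close>

definition form :: "'a \<Rightarrow> 'a \<Rightarrow> complex"
  where "form x y = cinner x (op_apply A y) - of_real m * cinner x y"

definition formq :: "'a \<Rightarrow> real"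
  where "formq x = Re (form x x)"

lemma csubspace_dom: "csubspace (Domain A)"
  by (rule csubspace_Domain[OF is_oper_csubspace[OF is_oper]])

lemmas dom_add = complex_vector.subspace_add[OF csubspace_dom]
  and dom_diff = complex_vector.subspace_diff[OF csubspace_dom]
  and dom_scaleC = complex_vector.subspace_scale[OF csubspace_dom]

lemma cinner_op_apply:
  "x \<in> Domain A \<Longrightarrow> y \<in> Domain A \<Longrightarrow> cinner x (op_apply A y) = cinner (op_apply A x) y"
  by (rule subset_adjoint_opD[OF symmetric op_apply_in[OF is_oper] op_apply_in[OF is_oper]])

lemma form_add_right:
  "y \<in> Domain A \<Longrightarrow> z \<in> Domain A \<Longrightarrow> form x (y + z) = form x y + form x z"
  by (simp add: form_def op_apply_add[OF is_oper] cinner_add_right algebra_simps)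

lemma form_diff_right:
  "y \<in> Domain A \<Longrightarrow> z \<in> Domain A \<Longrightarrow> form x (y - z) = form x y - form x z"
  by (simp add: form_def op_apply_diff[OF is_oper] cinner_diff_right algebra_simps)

lemma form_scaleC_right: "y \<in> Domain A \<Longrightarrow> form x (c *\<^sub>C y) = c * form x y"
  by (simp add: form_def op_apply_scaleC[OF is_oper] cinner_scaleC_right algebra_simps)

lemma form_cnj: "x \<in> Domain A \<Longrightarrow> y \<in> Domain A \<Longrightarrow> form x y = cnj (form y x)"
  by (simp add: form_def cinner_op_apply cinner_commute[symmetric])

lemma form_add_left:
  "x \<in> Domain A \<Longrightarrow> y \<in> Domain A \<Longrightarrow> form (x + y) z = form x z + form y z"
  by (simp add: form_def cinner_add_left algebra_simps)

lemma form_scaleC_left: "form (c *\<^sub>C x) y = cnj c * form x y"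
  by (simp add: form_def cinner_scaleC_left algebra_simps)

lemma formq_nonneg: "x \<in> Domain A \<Longrightarrow> 0 \<le> formq x"
  using lower_bound op_apply_in[OF is_oper]
  by (fastforce simp: lower_bound_op_def formq_def form_def cinner_self)

lemma form_self: "x \<in> Domain A \<Longrightarrow> form x x = of_real (formq x)"
  using form_cnj[of x x] by (auto simp: formq_def complex_eq_iff)

lemma formq_scaleC: "x \<in> Domain A \<Longrightarrow> formq (c *\<^sub>C x) = (cmod c)\<^sup>2 * formq x"
proof -
  assume x: "x \<in> Domain A"
  have "form (c *\<^sub>C x) (c *\<^sub>C x) = (c * cnj c) * form x x"
    using x by (simp add: form_scaleC_left form_scaleC_right)
  then show ?thesis
    unfolding complex_norm_square[symmetric] formq_def by simp
qed

lemma form_cauchy_schwarz: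
  assumes x: "x \<in> Domain A" and y: "y \<in> Domain A"
  shows "cmod (form x y) \<le> sqrt (formq x) * sqrt (formq y)"
proof -
  obtain u where u: "cmod u = 1" "u * form x y = of_real (cmod (form x y))"
    using exists_phase by blast
  let ?y = "u *\<^sub>C y"
  have uy: "?y \<in> Domain A" "form x ?y = of_real (cmod (form x y))"
    using y u by (auto simp: form_scaleC_right intro: dom_scaleC)
  have "0 \<le> formq x + 2 * t * cmod (form x y) + t\<^sup>2 * formq ?y" for t
  proof -
    let ?t = "complex_of_real t"
    have ty: "?t *\<^sub>C ?y \<in> Domain A" by (rule dom_scaleC[OF uy(1)])
    have "form ?y x = of_real (cmod (form x y))"
      using form_cnj[OF uy(1) x] uy(2) by simp
    then have "form (x + ?t *\<^sub>C ?y) (x + ?t *\<^sub>C ?y) =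
        form x x + 2 * ?t * of_real (cmod (form x y)) + ?t\<^sup>2 * form ?y ?y"
      using x uy ty
      by (simp add: form_add_left form_add_right form_scaleC_left form_scaleC_right power2_eq_square
          algebra_simps del: complex_vector.scale_scale)
    then have "formq (x + ?t *\<^sub>C ?y) = formq x + 2 * t * cmod (form x y) + t\<^sup>2 * formq ?y"
      by (simp add: formq_def)
    with formq_nonneg[OF dom_add[OF x ty]] show ?thesis by simp
  qed
  then have "(cmod (form x y))\<^sup>2 \<le> formq x * formq ?y"
    using formq_nonneg[OF uy(1)] by (rule discriminant_le)
  then have "sqrt ((cmod (form x y))\<^sup>2) \<le> sqrt (formq x * formq ?y)"
    by (rule real_sqrt_le_mono)
  then show ?thesis
    using u(1) y by (simp add: formq_scaleC real_sqrt_mult)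
qed

lemma sqrt_formq_triangle:
  assumes x: "x \<in> Domain A" and y: "y \<in> Domain A"
  shows "sqrt (formq (x + y)) \<le> sqrt (formq x) + sqrt (formq y)"
proof (rule real_le_lsqrt)
  have "formq (x + y) = formq x + 2 * Re (form x y) + formq y"
    using x y arg_cong[OF form_cnj[OF x y], of Re]
    by (simp add: formq_def form_add_left form_add_right)
  also have "\<dots> \<le> formq x + 2 * (sqrt (formq x) * sqrt (formq y)) + formq y"
    using form_cauchy_schwarz[OF x y] complex_Re_le_cmod[of "form x y"] by linarith
  also have "\<dots> = (sqrt (formq x) + sqrt (formq y))\<^sup>2"
    using formq_nonneg[OF x] formq_nonneg[OF y] by (simp add: power2_sum)
  finally show "formq (x + y) \<le> (sqrt (formq x) + sqrt (formq y))\<^sup>2" .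
qed (use formq_nonneg x y dom_add in auto)

lemma formq_minus: "x \<in> Domain A \<Longrightarrow> formq (- x) = formq x"
  using formq_scaleC[of x "-1"] by simp

lemma sqrt_formq_diff:
  assumes x: "x \<in> Domain A" and y: "y \<in> Domain A"
  shows "sqrt (formq (x - y)) \<le> sqrt (formq x) + sqrt (formq y)"
    and "\<bar>sqrt (formq x) - sqrt (formq y)\<bar> \<le> sqrt (formq (x - y))"
proof -
  have my: "- y \<in> Domain A"
    using dom_scaleC[OF y, of "-1"] by simp
  show "sqrt (formq (x - y)) \<le> sqrt (formq x) + sqrt (formq y)"
    using sqrt_formq_triangle[OF x my] y by (simp add: formq_minus)
  have "sqrt (formq x) \<le> sqrt (formq (x - y)) + sqrt (formq y)"
    using sqrt_formq_triangle[OF dom_diff[OF x y] y] by simp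
  moreover have "sqrt (formq y) \<le> sqrt (formq (x - y)) + sqrt (formq x)"
    using sqrt_formq_triangle[OF dom_diff[OF y x] x] formq_minus[OF dom_diff[OF x y]] by simp
  ultimately show "\<bar>sqrt (formq x) - sqrt (formq y)\<bar> \<le> sqrt (formq (x - y))" by linarith
qed

text \<open>This bound and the next translate between the Cauchy condition in
  \<open>form_approx\<close>, stated for the unshifted operator, and the positive form
  \<open>formq\<close>.\<close>

lemma formq_le: "formq x \<le> cmod (cinner x (op_apply A x)) + \<bar>m\<bar> * (norm x)\<^sup>2"
proof -
  have "- m * (norm x)\<^sup>2 \<le> \<bar>m\<bar> * (norm x)\<^sup>2"
    by (rule mult_right_mono) auto
  then show ?thesis
    using complex_Re_le_cmod[of "cinner x (op_apply A x)"]
    by (simp add: formq_def form_def cinner_self)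
qed

lemma cmod_le_formq:
  assumes "x \<in> Domain A"
  shows "cmod (cinner x (op_apply A x)) \<le> formq x + \<bar>m\<bar> * (norm x)\<^sup>2"
proof -
  have "cinner x (op_apply A x) = of_real (formq x + m * (norm x)\<^sup>2)"
    using form_self[OF assms] by (simp add: form_def cinner_self algebra_simps)
  then have "cmod (cinner x (op_apply A x)) = \<bar>formq x + m * (norm x)\<^sup>2\<bar>"
    by (metis norm_of_real real_norm_def)
  also have "\<dots> \<le> formq x + \<bar>m * (norm x)\<^sup>2\<bar>"
    using formq_nonneg[OF assms] by linarith
  finally show ?thesis by (simp add: abs_mult)
qed

section \<open>Approximating sequences and closability of the form\<close>

lemma form_approxI:
  assumes dom: "\<And>n. s n \<in> Domain A" and lim: "s \<longlonglongrightarrow> x"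
    and Cauchy: "\<And>e. e > 0 \<Longrightarrow> \<exists>N. \<forall>i\<ge>N. \<forall>j\<ge>N. formq (s i - s j) + (norm (s i - s j))\<^sup>2 < e"
  shows "form_approx A s x"
  unfolding form_approx_def
proof (intro conjI allI impI lim)
  show "range s \<subseteq> Domain A" using dom by auto
  fix e :: real assume "e > 0"
  then have "e / (1 + \<bar>m\<bar>) > 0" by simp
  from Cauchy[OF this] obtain N where N: "\<And>i j. i \<ge> N \<Longrightarrow> j \<ge> N \<Longrightarrow>
      formq (s i - s j) + (norm (s i - s j))\<^sup>2 < e / (1 + \<bar>m\<bar>)" by blast
  have "cmod (cinner (s i - s j) (op_apply A (s i - s j))) < e" if "i \<ge> N" "j \<ge> N" for i j
  proof -
    let ?d = "s i - s j"
    have d: "?d \<in> Domain A" using dom dom_diff by auto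
    have "cmod (cinner ?d (op_apply A ?d)) \<le> formq ?d + \<bar>m\<bar> * (norm ?d)\<^sup>2"
      by (rule cmod_le_formq[OF d])
    also have "\<dots> \<le> (1 + \<bar>m\<bar>) * (formq ?d + (norm ?d)\<^sup>2)"
      using formq_nonneg[OF d] by (simp add: algebra_simps)
    also have "\<dots> < e"
      using N[OF that] by (simp add: field_simps)
    finally show ?thesis .
  qed
  then show "\<exists>N. \<forall>i\<ge>N. \<forall>j\<ge>N. cmod (cinner (s i - s j) (op_apply A (s i - s j))) < e" by blast
qed

lemma form_approx_Cauchy:
  assumes s: "form_approx A s x" and "e > 0"
  obtains N where "\<And>i j. i \<ge> N \<Longrightarrow> j \<ge> N \<Longrightarrow> sqrt (formq (s i - s j)) < e"
proof -
  \<comment> \<open>One half of \<open>e\<^sup>2\<close> is reserved for the unshifted form, the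
    other for the lower bound times the squared norm; \<open>1 + \<bar>m\<bar>\<close> keeps the
    division legal when \<open>m\<close> is zero.\<close>
  let ?e = "e\<^sup>2 / 2"
  have e: "?e > 0" using \<open>e > 0\<close> by simp
  from s e obtain N1 where N1: "\<And>i j. i \<ge> N1 \<Longrightarrow> j \<ge> N1 \<Longrightarrow>
      cmod (cinner (s i - s j) (op_apply A (s i - s j))) < ?e"
    unfolding form_approx_def by meson
  let ?d = "sqrt (?e / (1 + \<bar>m\<bar>))"
  have "Cauchy s" using s by (auto simp: form_approx_def intro: LIMSEQ_imp_Cauchy)
  moreover have "?d > 0" using e by simp
  ultimately obtain N2 where N2: "\<And>i j. i \<ge> N2 \<Longrightarrow> j \<ge> N2 \<Longrightarrow> norm (s i - s j) < ?d"
    using CauchyD by blast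
  have "sqrt (formq (s i - s j)) < e" if "i \<ge> max N1 N2" "j \<ge> max N1 N2" for i j
  proof -
    have "(norm (s i - s j))\<^sup>2 < ?d\<^sup>2"
      using N2[of i j] that by (intro power_strict_mono) auto
    also have "?d\<^sup>2 = ?e / (1 + \<bar>m\<bar>)" using e by simp
    finally have "(1 + \<bar>m\<bar>) * (norm (s i - s j))\<^sup>2 < ?e" by (simp add: field_simps)
    then have "\<bar>m\<bar> * (norm (s i - s j))\<^sup>2 < ?e"
      using zero_le_power2[of "norm (s i - s j)"] unfolding distrib_right mult_1 by linarith
    with formq_le[of "s i - s j"] N1[of i j] that
    have "formq (s i - s j) < e\<^sup>2" by simp
    then show ?thesis using \<open>e > 0\<close> by (metis abs_of_pos real_sqrt_abs real_sqrt_less_iff)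
  qed
  then show ?thesis using that by blast
qed

lemma form_approx_dom: "form_approx A s x \<Longrightarrow> s n \<in> Domain A"
  by (auto simp: form_approx_def)

lemma form_approx_lim: "form_approx A s x \<Longrightarrow> s \<longlonglongrightarrow> x"
  by (auto simp: form_approx_def)

lemma form_approx_convergent:
  assumes s: "form_approx A s x"
  shows "convergent (\<lambda>n. sqrt (formq (s n)))"
proof -
  have "Cauchy (\<lambda>n. sqrt (formq (s n)))"
  proof (rule CauchyI)
    fix e :: real assume "e > 0"
    from form_approx_Cauchy[OF s this] obtain N where
      N: "\<And>i j. i \<ge> N \<Longrightarrow> j \<ge> N \<Longrightarrow> sqrt (formq (s i - s j)) < e" by blast
    have "norm (sqrt (formq (s i)) - sqrt (formq (s j))) < e" if "i \<ge> N" "j \<ge> N" for i j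
      using sqrt_formq_diff(2)[OF form_approx_dom[OF s, of i] form_approx_dom[OF s, of j]]
        N[OF that] by simp
    then show "\<exists>N. \<forall>i\<ge>N. \<forall>j\<ge>N. norm (sqrt (formq (s i)) - sqrt (formq (s j))) < e" by blast
  qed
  then show ?thesis by (simp add: Cauchy_convergent)
qed

lemma form_approx_bounded:
  assumes s: "form_approx A s x"
  obtains K where "K > 0" "\<And>n. sqrt (formq (s n)) \<le> K"
proof -
  have "Bseq (\<lambda>n. sqrt (formq (s n)))"
    by (rule convergent_imp_Bseq[OF form_approx_convergent[OF s]])
  then obtain K where "K > 0" "\<And>n. norm (sqrt (formq (s n))) \<le> K"
    by (auto simp: Bseq_def)
  then show ?thesis using that by (auto simp: abs_le_iff)
qed

text \<open>The form is closable: \<open>formq (d n)\<close> is nearly \<open>form (d n) (d N)\<close> for a fixed large \<open>N\<close>,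
  and this tends to \<open>0\<close> because \<open>A (d N)\<close> is a fixed vector.\<close>

lemma form_approx_0:
  assumes d: "form_approx A d 0"
  shows "(\<lambda>n. sqrt (formq (d n))) \<longlonglongrightarrow> 0"
proof -
  note dom = form_approx_dom[OF d]
  obtain K where K: "K > 0" "\<And>n. sqrt (formq (d n)) \<le> K"
    using form_approx_bounded[OF d] by blast
  have "(\<lambda>n. formq (d n)) \<longlonglongrightarrow> 0"
  proof (rule LIMSEQ_I)
    fix e :: real assume e: "e > 0"
    then have "e / (2 * K) > 0" using K by simp
    from form_approx_Cauchy[OF d this] obtain N where
      N: "\<And>i j. i \<ge> N \<Longrightarrow> j \<ge> N \<Longrightarrow> sqrt (formq (d i - d j)) < e / (2 * K)" by blast
    have "(\<lambda>n. form (d n) (d N)) \<longlonglongrightarrow> cinner 0 (op_apply A (d N)) - of_real m * cinner 0 (d N)"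
      unfolding form_def
      by (intro tendsto_intros cinner.tendsto form_approx_lim[OF d])
    then have "(\<lambda>n. form (d n) (d N)) \<longlonglongrightarrow> 0" by simp
    from LIMSEQ_D[OF this half_gt_zero[OF e]] obtain N' where
      N': "\<And>n. n \<ge> N' \<Longrightarrow> cmod (form (d n) (d N)) < e / 2" by auto
    have "norm (formq (d n) - 0) < e" if n: "n \<ge> max N N'" for n
    proof -
      have dd: "d n - d N \<in> Domain A" using dom dom_diff by auto
      have "formq (d n) = Re (form (d n) (d n - d N)) + Re (form (d n) (d N))"
        using dom by (simp add: formq_def form_diff_right)
      also have "\<dots> \<le> cmod (form (d n) (d n - d N)) + cmod (form (d n) (d N))"
        by (intro add_mono complex_Re_le_cmod)
      also have "cmod (form (d n) (d n - d N)) \<le> sqrt (formq (d n)) * sqrt (formq (d n - d N))"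
        using dom dd by (intro form_cauchy_schwarz)
      also have "\<dots> \<le> K * (e / (2 * K))"
        using K N[of n N] n formq_nonneg[OF dd] by (intro mult_mono) auto
      also have "K * (e / (2 * K)) = e / 2" using K by simp
      finally show ?thesis using N'[of n] n formq_nonneg[OF dom[of n]] by simp
    qed
    then show "\<exists>no. \<forall>n\<ge>no. norm (formq (d n) - 0) < e" by blast
  qed
  from tendsto_real_sqrt[OF this] show ?thesis by simp
qed

lemma form_approx_diff:
  assumes s: "form_approx A s x" and r: "form_approx A r y"
  shows "form_approx A (\<lambda>n. s n - r n) (x - y)"
proof (rule form_approxI)
  show lim: "(\<lambda>n. s n - r n) \<longlonglongrightarrow> x - y"
    using s r by (intro tendsto_diff form_approx_lim)
  show "s n - r n \<in> Domain A" for n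
    using s r by (intro dom_diff form_approx_dom)
  fix e :: real assume e: "e > 0"
  \<comment> \<open>Two seminorms below this value leave \<open>formq\<close> of the difference
    below \<open>e / 2\<close>; the other half is for the squared norm.\<close>
  let ?e = "sqrt (e / 2) / 2"
  have "?e > 0" using e by simp
  obtain N1 where N1: "\<And>i j. i \<ge> N1 \<Longrightarrow> j \<ge> N1 \<Longrightarrow> sqrt (formq (s i - s j)) < ?e"
    using form_approx_Cauchy[OF s \<open>?e > 0\<close>] by blast
  obtain N2 where N2: "\<And>i j. i \<ge> N2 \<Longrightarrow> j \<ge> N2 \<Longrightarrow> sqrt (formq (r i - r j)) < ?e"
    using form_approx_Cauchy[OF r \<open>?e > 0\<close>] by blast
  have "Cauchy (\<lambda>n. s n - r n)" by (rule LIMSEQ_imp_Cauchy[OF lim])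
  moreover have "sqrt (e / 2) > 0" using e by simp
  ultimately obtain N3 where
    N3: "\<And>i j. i \<ge> N3 \<Longrightarrow> j \<ge> N3 \<Longrightarrow> norm ((s i - r i) - (s j - r j)) < sqrt (e / 2)"
    using CauchyD by blast
  have "formq ((s i - r i) - (s j - r j)) + (norm ((s i - r i) - (s j - r j)))\<^sup>2 < e"
    if ij: "i \<ge> max N1 (max N2 N3)" "j \<ge> max N1 (max N2 N3)" for i j
  proof -
    have eq: "(s i - r i) - (s j - r j) = (s i - s j) - (r i - r j)" by simp
    have "sqrt (formq ((s i - r i) - (s j - r j))) \<le> sqrt (formq (s i - s j)) + sqrt (formq (r i - r j))"
      unfolding eq using form_approx_dom[OF s] form_approx_dom[OF r]
      by (intro sqrt_formq_diff dom_diff)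
    also have "\<dots> < ?e + ?e" using N1[of i j] N2[of i j] ij by (intro add_strict_mono) auto
    finally have "formq ((s i - r i) - (s j - r j)) < e / 2" by simp
    moreover have "(norm ((s i - r i) - (s j - r j)))\<^sup>2 < (sqrt (e / 2))\<^sup>2"
      using N3[of i j] ij by (intro power_strict_mono) auto
    ultimately show ?thesis using e by simp
  qed
  then show "\<exists>N. \<forall>i\<ge>N. \<forall>j\<ge>N.
      formq (s i - r i - (s j - r j)) + (norm (s i - r i - (s j - r j)))\<^sup>2 < e" by blast
qed

text \<open>By closability the difference of two sequences with the same limit is also negligible
  for the form, while \<open>formq\<close> of one of them stays bounded; Cauchy-Schwarz does the
  rest.\<close>

lemma form_approx_same_limit:
  assumes s: "form_approx A s x" and r: "form_approx A r x"
  shows "(\<lambda>n. form (s n) (r n) - form (s n) (s n)) \<longlonglongrightarrow> 0"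
proof -
  note doms = form_approx_dom[OF s] and domr = form_approx_dom[OF r]
  obtain K where K: "K > 0" "\<And>n. sqrt (formq (s n)) \<le> K"
    using form_approx_bounded[OF s] by blast
  have "form_approx A (\<lambda>n. r n - s n) 0"
    using form_approx_diff[OF r s] by simp
  from form_approx_0[OF this] have "(\<lambda>n. K * sqrt (formq (r n - s n))) \<longlonglongrightarrow> 0"
    using tendsto_mult_right_zero by blast
  then show ?thesis
  proof (rule Lim_null_comparison[rotated])
    have "norm (form (s n) (r n) - form (s n) (s n)) \<le> K * sqrt (formq (r n - s n))" for n
    proof -
      have "form (s n) (r n) - form (s n) (s n) = form (s n) (r n - s n)"
        using doms domr by (simp add: form_diff_right)
      also have "norm \<dots> \<le> sqrt (formq (s n)) * sqrt (formq (r n - s n))"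
        using doms domr by (intro form_cauchy_schwarz dom_diff)
      also have "\<dots> \<le> K * sqrt (formq (r n - s n))"
        using K formq_nonneg[OF dom_diff[OF domr doms]] by (intro mult_right_mono) auto
      finally show ?thesis .
    qed
    then show "\<forall>\<^sub>F n in sequentially.
        norm (form (s n) (r n) - form (s n) (s n)) \<le> K * sqrt (formq (r n - s n))"
      by (intro always_eventually) blast
  qed
qed

text \<open>\<open>quad_form\<close> is a definite description over two independent sequences, so a
  limit must be shown to exist and to be the same for every pair.\<close>

lemma quad_form_tendsto:
  assumes s: "form_approx A s x"
  shows "(\<lambda>n. cinner (s n) (op_apply A (s n))) \<longlonglongrightarrow> quad_form A x x"
proof -
  obtain l where "(\<lambda>n. sqrt (formq (s n))) \<longlonglongrightarrow> l"
    using form_approx_convergent[OF s] by (auto simp: convergent_def)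
  then have "(\<lambda>n. complex_of_real ((sqrt (formq (s n)))\<^sup>2)) \<longlonglongrightarrow> of_real (l\<^sup>2)"
    by (intro tendsto_intros)
  then have ss: "(\<lambda>n. form (s n) (s n)) \<longlonglongrightarrow> of_real (l\<^sup>2)"
    using form_approx_dom[OF s] formq_nonneg by (simp add: form_self)
  define L where "L = of_real (l\<^sup>2) + of_real m * cinner x x"
  have *: "(\<lambda>n. cinner (p n) (op_apply A (r n))) \<longlonglongrightarrow> L"
    if p: "form_approx A p x" and r: "form_approx A r x" for p r
  proof -
    note doms = form_approx_dom[OF s] and domp = form_approx_dom[OF p]
    have "(\<lambda>n. cnj (form (p n) (s n) - form (p n) (p n))) \<longlonglongrightarrow> cnj 0"
      by (intro tendsto_cnj form_approx_same_limit[OF p s])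
    moreover have "cnj (form (p n) (s n) - form (p n) (p n)) = form (s n) (p n) - form (p n) (p n)" for n
      using form_cnj[OF domp domp, of n n] form_cnj[OF domp doms, of n n] by simp
    ultimately have sp: "(\<lambda>n. form (s n) (p n) - form (p n) (p n)) \<longlonglongrightarrow> 0" by simp
    \<comment> \<open>The mixed value telescopes from (p, r) through (p, p) and (s, p) to (s, s),
      each difference being negligible.\<close>
    have "(\<lambda>n. (form (p n) (r n) - form (p n) (p n)) - (form (s n) (p n) - form (p n) (p n))
        + (form (s n) (p n) - form (s n) (s n)) + form (s n) (s n)) \<longlonglongrightarrow> 0 - 0 + 0 + of_real (l\<^sup>2)"
      by (intro tendsto_add tendsto_diff form_approx_same_limit[OF p r]
          form_approx_same_limit[OF s p] sp ss)
    then have pr: "(\<lambda>n. form (p n) (r n)) \<longlonglongrightarrow> of_real (l\<^sup>2)" by simp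
    have "(\<lambda>n. form (p n) (r n) + of_real m * cinner (p n) (r n)) \<longlonglongrightarrow> L"
      unfolding L_def
      by (intro tendsto_intros cinner.tendsto pr form_approx_lim[OF p] form_approx_lim[OF r])
    then show ?thesis by (simp add: form_def)
  qed
  have "quad_form A x x = L"
    unfolding quad_form_def
  proof (rule the_equality)
    fix l assume "\<forall>p r. form_approx A p x \<longrightarrow> form_approx A r x \<longrightarrow>
        (\<lambda>n. cinner (p n) (op_apply A (r n))) \<longlonglongrightarrow> l"
    with s have "(\<lambda>n. cinner (s n) (op_apply A (s n))) \<longlonglongrightarrow> l" by blast
    with *[OF s s] show "l = L" using LIMSEQ_unique by blast
  qed (use * in blast)
  with *[OF s s] show ?thesis by simp
qed

lemma form_approx_const: "x \<in> Domain A \<Longrightarrow> form_approx A (\<lambda>_. x) x"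
  by (auto simp: form_approx_def op_apply_zero[OF is_oper])

lemma form_domain_Domain: "x \<in> Domain A \<Longrightarrow> x \<in> form_domain A"
  unfolding form_domain_def using form_approx_const by blast

lemma quad_form_Domain: "x \<in> Domain A \<Longrightarrow> quad_form A x x = cinner x (op_apply A x)"
  using LIMSEQ_unique[OF quad_form_tendsto[OF form_approx_const] tendsto_const] by simp

end

subsection \<open>Resolvents\<close>

text \<open>This is self-adjointness of a semibounded operator in a shape that passes to tensor
  products: the range condition for \<open>A + c\<close> can be checked on elementary
  tensors.\<close>

locale resolvent_oper = semibounded_oper +
  fixes c :: real
  assumes closed: "closed A"
    and shift_pos: "m + c > 0"
    and range_dense: "(\<And>x y. (x, y) \<in> A \<Longrightarrow> cinner w (y + c *\<^sub>R x) = 0) \<Longrightarrow> w = 0"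
begin

lemmas A_csubspace = is_oper_csubspace[OF is_oper]

lemma shift_lower_bound:
  assumes "(x, y) \<in> A"
  shows "(m + c) * (norm x)\<^sup>2 \<le> Re (cinner x (y + c *\<^sub>R x))"
  using assms lower_bound
  by (auto simp: lower_bound_op_def cinner_add_right cinner_scaleR_right cinner_self algebra_simps)

definition resolvent :: "'a \<Rightarrow> 'a"
  where "resolvent y = (THE x. (x, y - c *\<^sub>R x) \<in> A)"

lemma resolvent_unique:
  assumes "(x, y - c *\<^sub>R x) \<in> A" "(x', y - c *\<^sub>R x') \<in> A"
  shows "x = x'"
proof -
  have "(x - x', (y - c *\<^sub>R x) - (y - c *\<^sub>R x')) \<in> A"
    using assms by (rule oper_diff[OF A_csubspace])
  from shift_lower_bound[OF this] have "(m + c) * (norm (x - x'))\<^sup>2 \<le> 0"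
    by (simp add: algebra_simps)
  with shift_pos show ?thesis
    by (simp add: mult_le_0_iff)
qed

lemma resolvent_exists: "\<exists>x. (x, y - c *\<^sub>R x) \<in> A"
proof -
  let ?z = "- complex_of_real c"
  have z: "y - ?z *\<^sub>C x = y + c *\<^sub>R x" for x y :: 'a
    by (simp add: scaleR_scaleC)
  have "(\<lambda>(x, y). y - ?z *\<^sub>C x) ` A = UNIV"
  proof (rule range_shift_UNIV[OF A_csubspace closed], unfold z)
    fix x y assume xy: "(x, y) \<in> A"
    have "(m + c) * (norm x)\<^sup>2 \<le> norm x * norm (y + c *\<^sub>R x)"
      using shift_lower_bound[OF xy] complex_Re_le_cmod[of "cinner x (y + c *\<^sub>R x)"]
        norm_cinner_le[of x "y + c *\<^sub>R x"] by linarith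
    then have "(m + c) * norm x \<le> norm (y + c *\<^sub>R x)"
      by (cases "x = 0") (auto simp: power2_eq_square)
    then show "norm x \<le> inverse (m + c) * norm (y + c *\<^sub>R x)"
      using shift_pos by (simp add: field_simps)
  qed (rule range_dense)
  then have "y \<in> (\<lambda>(x, y). y - ?z *\<^sub>C x) ` A" by simp
  then obtain x w where "(x, w) \<in> A" "y = w - ?z *\<^sub>C x" by auto
  then have "(x, w) \<in> A" "y = w + c *\<^sub>R x" by (simp_all only: z)
  then show ?thesis by (intro exI[of _ x]) simp
qed

lemma resolvent_in: "(resolvent y, y - c *\<^sub>R resolvent y) \<in> A"
  unfolding resolvent_def using resolvent_exists resolvent_unique by (metis (no_types, lifting) theI)

lemma resolvent_eqI: "(x, y - c *\<^sub>R x) \<in> A \<Longrightarrow> resolvent y = x"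
  using resolvent_in resolvent_unique by blast

lemma resolvent_shift: "(x, y) \<in> A \<Longrightarrow> resolvent (y + c *\<^sub>R x) = x"
  by (rule resolvent_eqI) simp

lemma resolvent_add: "resolvent (x + y) = resolvent x + resolvent y"
  using oper_add[OF A_csubspace resolvent_in resolvent_in, of x y]
  by (intro resolvent_eqI) (simp add: algebra_simps)

lemma resolvent_scaleC: "resolvent (z *\<^sub>C x) = z *\<^sub>C resolvent x"
  using oper_scaleC[OF A_csubspace resolvent_in, of z x]
  by (intro resolvent_eqI)
    (simp add: scaleR_scaleC complex_vector.scale_right_diff_distrib mult.commute)

lemma resolvent_cinner: "cinner (resolvent x) y = cinner x (resolvent y)"
  using subset_adjoint_opD[OF symmetric resolvent_in resolvent_in, of x y]
  by (simp add: cinner_diff_left cinner_diff_right cinner_scaleR_left cinner_scaleR_right)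

lemma resolvent_pos: "(m + c) * (norm (resolvent x))\<^sup>2 \<le> Re (cinner (resolvent x) x)"
  using shift_lower_bound[OF resolvent_in, of x] by simp

lemma resolvent_pos_right: "(m + c) * (norm (resolvent x))\<^sup>2 \<le> Re (cinner x (resolvent x))"
  using resolvent_pos[of x] by (simp add: resolvent_cinner)

lemma resolvent_eq_0: "resolvent x = 0 \<Longrightarrow> x = 0"
  using resolvent_in[of x] op_apply_eq[OF is_oper, of 0 x] op_apply_zero[OF is_oper] by simp

lemma bounded_linear_resolvent: "bounded_linear resolvent"
proof (rule bounded_linear_intro)
  show "resolvent (x + y) = resolvent x + resolvent y" for x y by (rule resolvent_add)
  show "resolvent (r *\<^sub>R x) = r *\<^sub>R resolvent x" for r x
    by (simp add: scaleR_scaleC resolvent_scaleC)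
  show "norm (resolvent x) \<le> norm x * inverse (m + c)" for x
  proof -
    have "(m + c) * (norm (resolvent x))\<^sup>2 \<le> norm (resolvent x) * norm x"
      using resolvent_pos[of x] complex_Re_le_cmod norm_cinner_le by (meson order_trans)
    then have "(m + c) * norm (resolvent x) \<le> norm x"
      by (cases "resolvent x = 0") (auto simp: power2_eq_square)
    then show ?thesis using shift_pos by (simp add: field_simps)
  qed
qed

lemma csubspace_resolvent_vimage:
  assumes "csubspace K" shows "csubspace (resolvent -` K)"
  using assms resolvent_scaleC[of 0 0] complex_vector.subspace_0[OF assms]
  by (intro complex_vector.subspaceI)
    (auto simp: resolvent_add resolvent_scaleC
      intro: complex_vector.subspace_add complex_vector.subspace_scale)

lemma resolvent_closure_cspan:
  assumes K: "csubspace K" "closed K" and "x \<in> closure (cspan B)"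
    and B: "\<And>b. b \<in> B \<Longrightarrow> resolvent b \<in> K"
  shows "resolvent x \<in> K"
proof -
  have "cspan B \<subseteq> resolvent -` K"
    using B by (intro complex_vector.span_minimal csubspace_resolvent_vimage K) auto
  moreover have "closed (resolvent -` K)"
    using K by (intro closed_vimage bounded_linear.continuous_on[OF bounded_linear_resolvent]
        continuous_on_id)
  ultimately have "closure (cspan B) \<subseteq> resolvent -` K"
    by (rule closure_minimal)
  with assms(3) show ?thesis by auto
qed

text \<open>The resolvent is symmetric, so with \<open>K\<close> it also leaves the orthogonal
  complement invariant and hence commutes with the projection; writing \<open>x\<close> as a
  resolvent carries this over to \<open>A\<close>.\<close>

lemma reduced:
  assumes K: "csubspace K" "closed K" and inv: "\<And>x. x \<in> K \<Longrightarrow> resolvent x \<in> K"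
    and "(x, y) \<in> A"
  shows "(orth_proj K x, orth_proj K y) \<in> A"
proof -
  define w where "w = y + c *\<^sub>R x"
  have x: "x = resolvent w" using resolvent_shift[OF assms(4)] by (simp add: w_def)
  let ?P = "orth_proj K"
  have "resolvent (w - ?P w) \<in> orth_compl K"
    unfolding orth_compl_def
  proof clarify
    fix k assume "k \<in> K"
    then have "cinner (resolvent k) (w - ?P w) = 0"
      using inv orth_proj_orth[OF K, of w] by (auto simp: orth_compl_def)
    then show "cinner k (resolvent (w - ?P w)) = 0" by (simp add: resolvent_cinner)
  qed
  then have "?P (resolvent (?P w + (w - ?P w))) = ?P (resolvent (?P w))"
    unfolding resolvent_add orth_proj_add[OF K] by (simp add: orth_proj_zero[OF K])
  then have Px: "?P x = resolvent (?P w)"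
    using inv orth_proj_in[OF K] by (simp add: x orth_proj_id[OF K])
  have "?P w = ?P y + c *\<^sub>R ?P x"
    by (simp add: w_def orth_proj_add[OF K] scaleR_scaleC orth_proj_scaleC[OF K])
  then have "?P y = ?P w - c *\<^sub>R resolvent (?P w)"
    unfolding Px by (metis add_diff_cancel_right')
  with resolvent_in[of "?P w"] show ?thesis unfolding Px by metis
qed

lemma op_apply_reduced:
  assumes K: "csubspace K" "closed K" and inv: "\<And>x. x \<in> K \<Longrightarrow> resolvent x \<in> K"
    and x: "x \<in> K" "x \<in> Domain A"
  shows "op_apply A x \<in> K"
proof -
  have "(x, orth_proj K (op_apply A x)) \<in> A"
    using reduced[OF K inv op_apply_in[OF is_oper x(2)]] by (simp add: orth_proj_id[OF K x(1)])
  then have "op_apply A x = orth_proj K (op_apply A x)"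
    by (rule op_apply_eq[OF is_oper])
  also have "\<dots> \<in> K" by (rule orth_proj_in[OF K])
  finally show ?thesis .
qed

end

text \<open>A vector orthogonal to the range of \<open>A + c\<close> lies in the domain of the
  adjoint, which is \<open>A\<close>, and is mapped to \<open>- c\<close> times itself; as
  \<open>- c\<close> is below the lower bound, it vanishes.\<close>

lemma self_adjoint_resolvent_oper:
  assumes A: "self_adjoint_op A" and "lower_bound_op A m" "m + c > 0"
  shows "resolvent_oper A m c"
proof unfold_locales
  show "is_oper A" "A \<subseteq> adjoint_op A" using A by (auto simp: self_adjoint_op_def)
  show "closed A" using A closed_adjoint_op by (metis self_adjoint_op_def)
  fix w assume *: "\<And>x y. (x, y) \<in> A \<Longrightarrow> cinner w (y + c *\<^sub>R x) = 0"
  have "cinner w y = cinner (- c *\<^sub>R w) x" if "(x, y) \<in> A" for x y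
    using *[OF that]
    by (simp add: cinner_add_right cinner_scaleR_right cinner_scaleR_left cinner_minus_left
        eq_neg_iff_add_eq_0)
  then have "(w, - c *\<^sub>R w) \<in> adjoint_op A"
    by (auto simp: adjoint_op_def)
  then have "(w, - c *\<^sub>R w) \<in> A" using A by (simp add: self_adjoint_op_def)
  then have "m * (norm w)\<^sup>2 \<le> Re (cinner w (- c *\<^sub>R w))"
    using assms(2) by (auto simp: lower_bound_op_def)
  then have "(m + c) * (norm w)\<^sup>2 \<le> 0"
    by (simp add: cinner_minus_right cinner_scaleR_right cinner_self algebra_simps)
  with assms(3) show "w = 0" by (simp add: mult_le_0_iff)
qed (use assms in auto)

section \<open>Operators on tensor products\<close>

lemma adjoint_op_cspan: "adjoint_op (cspan B) = adjoint_op B"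
proof
  show "adjoint_op (cspan B) \<subseteq> adjoint_op B"
    unfolding adjoint_op_def using complex_vector.span_superset[of B] by blast
  have "csubspace {p. cinner y (snd p) - cinner z (fst p) = 0}" for y z :: 'a
    by (rule complex_vector.subspaceI)
      (auto simp: scaleC_prod_def cinner_add_right cinner_scaleC_right)
  then have "cspan B \<subseteq> {p. cinner y (snd p) - cinner z (fst p) = 0}"
    if "(y, z) \<in> adjoint_op B" for y z
    using that by (intro complex_vector.span_minimal) (auto simp: adjoint_op_def)
  then show "adjoint_op B \<subseteq> adjoint_op (cspan B)"
    by (fastforce simp: adjoint_op_def)
qed

locale tensor =
  fixes T :: "'a::chilbert_space \<Rightarrow> 'f::chilbert_space \<Rightarrow> 'h::chilbert_space"
  assumes T: "hilbert_tensor T"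
begin

lemma cinner_T: "cinner (T x u) (T y v) = cinner x y * cinner u v"
  using T by (simp add: hilbert_tensor_def)

lemma T_dense: "closure (cspan {T x u |x u. True}) = UNIV"
  using T by (simp add: hilbert_tensor_def)

lemma orth_T: "(\<And>x u. cinner w (T x u) = 0) \<Longrightarrow> w = 0"
  using orthogonal_closure_cspan[of w "{T x u |x u. True}" w] T_dense by auto

lemma T_eqI: "(\<And>y v. cinner p (T y v) = cinner q (T y v)) \<Longrightarrow> p = q"
  using orth_T[of "p - q"] by (simp add: cinner_diff_left)

lemma T_add_left: "T (x + y) u = T x u + T y u"
  by (rule T_eqI) (simp add: cinner_T cinner_add_left algebra_simps)

lemma T_add_right: "T x (u + v) = T x u + T x v"
  by (rule T_eqI) (simp add: cinner_T cinner_add_left algebra_simps)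

lemma T_scaleC_left: "T (c *\<^sub>C x) u = c *\<^sub>C T x u"
  by (rule T_eqI) (simp add: cinner_T cinner_scaleC_left)

lemma T_scaleC_right: "T x (c *\<^sub>C u) = c *\<^sub>C T x u"
  by (rule T_eqI) (simp add: cinner_T cinner_scaleC_left)

lemma norm_T: "norm (T x u) = norm x * norm u"
proof -
  have "complex_of_real ((norm (T x u))\<^sup>2) = of_real ((norm x * norm u)\<^sup>2)"
    using cinner_T[of x u x u] by (simp add: cinner_self power_mult_distrib)
  then have "(norm (T x u))\<^sup>2 = (norm x * norm u)\<^sup>2"
    using of_real_eq_iff by blast
  then show ?thesis by (simp add: power2_eq_iff_nonneg)
qed

lemma bounded_bilinear_T: "bounded_bilinear T"
  by unfold_locales
    (auto simp: T_add_left T_add_right scaleR_scaleC T_scaleC_left T_scaleC_right norm_T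
      intro!: exI[of _ 1])

sublocale T: bounded_bilinear T by (rule bounded_bilinear_T)

text \<open>Exchanging the factors turns \<open>one_tensor\<close> into \<open>tensor_one\<close>,
  so that results on lifted operators are proved for one factor only.\<close>

lemma swap: "hilbert_tensor (\<lambda>u x. T x u)"
proof -
  have "{T x u |u x. True} = {T x u |x u. True}" by blast
  with T show ?thesis by (simp add: hilbert_tensor_def mult.commute)
qed

lemma one_tensor_swap: "one_tensor T B = tensor_one (\<lambda>u x. T x u) B"
proof -
  have "{(T x u, T x v) |x u v. (u, v) \<in> B} = {(T x u, T x v) |u v x. (u, v) \<in> B}" by blast
  then show ?thesis by (simp add: one_tensor_def tensor_one_def)
qed

lemma cinner_T_orthonormal:
  assumes "finite E" "\<forall>e\<in>E. \<forall>e'\<in>E. cinner e e' = (if e = e' then 1 else 0)"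
  shows "cinner (\<Sum>e\<in>E. T (f e) e) (\<Sum>e\<in>E. T (g e) e) = (\<Sum>e\<in>E. cinner (f e) (g e))"
proof -
  have "cinner (\<Sum>e\<in>E. T (f e) e) (\<Sum>e\<in>E. T (g e) e) =
      (\<Sum>e\<in>E. \<Sum>e'\<in>E. cinner (f e) (g e') * cinner e e')"
    unfolding cinner_sum_left by (simp add: cinner_sum_right cinner_T)
  also have "\<dots> = (\<Sum>e\<in>E. \<Sum>e'\<in>E. if e = e' then cinner (f e) (g e') else 0)"
    using assms(2) by (intro sum.cong refl) auto
  also have "\<dots> = (\<Sum>e\<in>E. cinner (f e) (g e))"
    using assms(1) by (simp add: sum.delta')
  finally show ?thesis .
qed

text \<open>Gram--Schmidt on the second factors.\<close>

lemma tensor_span_orthonormal: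
  assumes A: "csubspace A" and p: "p \<in> cspan {(T x u, T y u) |x y u. (x, y) \<in> A}"
  shows "\<exists>E f g. finite E \<and> (\<forall>e\<in>E. \<forall>e'\<in>E. cinner e e' = (if e = e' then 1 else 0)) \<and>
    (\<forall>e\<in>E. (f e, g e) \<in> A) \<and> p = (\<Sum>e\<in>E. T (f e) e, \<Sum>e\<in>E. T (g e) e)"
  using p
proof (induction rule: complex_vector.span_induct_alt)
  case base
  show ?case by (intro exI[of _ "{}"]) (auto simp: zero_prod_def)
next
  case (step c q p)
  from step.hyps obtain x0 y0 u where q: "q = (T x0 u, T y0 u)" "(x0, y0) \<in> A" by blast
  define x y where "x = c *\<^sub>C x0" and "y = c *\<^sub>C y0"
  have xy: "(x, y) \<in> A" "c *\<^sub>C q = (T x u, T y u)"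
    using q by (auto simp: x_def y_def oper_scaleC[OF A] scaleC_prod_def T_scaleC_left)
  from step.IH obtain E f g where E: "finite E"
      "\<forall>e\<in>E. \<forall>e'\<in>E. cinner e e' = (if e = e' then 1 else 0)"
      "\<forall>e\<in>E. (f e, g e) \<in> A" and p: "p = (\<Sum>e\<in>E. T (f e) e, \<Sum>e\<in>E. T (g e) e)"
    by (elim exE conjE)
  \<comment> \<open>\<open>r\<close> is the part of \<open>u\<close> orthogonal to \<open>E\<close>;
    it contributes at most one new basis vector.\<close>
  define r where "r = u - (\<Sum>e\<in>E. cinner e u *\<^sub>C e)"
  have r_orth: "cinner e r = 0" if "e \<in> E" for e
  proof -
    have "(\<Sum>e'\<in>E. cinner e' u * cinner e e') = (\<Sum>e'\<in>E. if e' = e then cinner e' u else 0)"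
      using E(2) that by (intro sum.cong refl) auto
    then show ?thesis
      using E(1) that by (simp add: r_def cinner_diff_right cinner_sum_right cinner_scaleC_right)
  qed
  have u: "u = r + (\<Sum>e\<in>E. cinner e u *\<^sub>C e)" by (simp add: r_def)
  \<comment> \<open>The part of \<open>u\<close> in the span of \<open>E\<close> is absorbed into
    the old coefficients, which stay in \<open>A\<close> by linearity.\<close>
  define f' g' where "f' e = cinner e u *\<^sub>C x + f e" and "g' e = cinner e u *\<^sub>C y + g e" for e
  have fg': "(f' e, g' e) \<in> A" if "e \<in> E" for e
    unfolding f'_def g'_def using E(3) that by (intro oper_add[OF A oper_scaleC[OF A xy(1)]]) blast
  have Tu: "T z u = T z r + (\<Sum>e\<in>E. T (cinner e u *\<^sub>C z) e)" for z
    by (subst u) (simp add: T_add_right T.sum_right T_scaleC_right T_scaleC_left)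
  have sum': "c *\<^sub>C q + p = (T x r + (\<Sum>e\<in>E. T (f' e) e), T y r + (\<Sum>e\<in>E. T (g' e) e))"
    by (simp add: xy(2) p f'_def g'_def T_add_left sum.distrib Tu[of x] Tu[of y] add.assoc)
  show ?case
  proof (cases "r = 0")
    case True
    with sum' have "c *\<^sub>C q + p = (\<Sum>e\<in>E. T (f' e) e, \<Sum>e\<in>E. T (g' e) e)"
      by (simp add: T.zero_right)
    with E(1,2) fg' show ?thesis
      by (intro exI[of _ E] exI[of _ f'] exI[of _ g'] conjI ballI) simp_all
  next
    case False
    define e0 where "e0 = (1 / norm r) *\<^sub>R r"
    have r: "r = of_real (norm r) *\<^sub>C e0"
      using False by (simp add: e0_def scaleC_of_real)
    have e0: "cinner e0 e0 = 1"
      using False by (simp add: e0_def cinner_scaleR_left cinner_scaleR_right cinner_self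
          power2_eq_square)
    have e0_orth: "cinner e e0 = 0" "cinner e0 e = 0" if "e \<in> E" for e
      using r_orth[OF that] cinner_zero_commute
      by (auto simp: e0_def cinner_scaleR_left cinner_scaleR_right)
    have e0E: "e0 \<notin> E" using e0 e0_orth by force
    define h k where "h e = (if e = e0 then of_real (norm r) *\<^sub>C x else f' e)"
      and "k e = (if e = e0 then of_real (norm r) *\<^sub>C y else g' e)" for e
    have hE: "(\<Sum>e\<in>E. T (h e) e) = (\<Sum>e\<in>E. T (f' e) e)"
      "(\<Sum>e\<in>E. T (k e) e) = (\<Sum>e\<in>E. T (g' e) e)"
      using e0E by (auto simp: h_def k_def intro!: sum.cong)
    have "T z r = T (of_real (norm r) *\<^sub>C z) e0" for z
      by (subst r) (simp only: T_scaleC_left T_scaleC_right)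
    then have "c *\<^sub>C q + p = (\<Sum>e\<in>insert e0 E. T (h e) e, \<Sum>e\<in>insert e0 E. T (k e) e)"
      using E(1) e0E by (simp add: sum' hE) (simp add: h_def k_def)
    moreover have "\<forall>e\<in>insert e0 E. (h e, k e) \<in> A"
      using fg' e0E oper_scaleC[OF A xy(1)] by (auto simp: h_def k_def)
    moreover have "\<forall>e\<in>insert e0 E. \<forall>e'\<in>insert e0 E. cinner e e' = (if e = e' then 1 else 0)"
      using E(2) e0 e0_orth e0E by auto
    ultimately show ?thesis
      using E(1) by (intro exI[of _ "insert e0 E"] exI[of _ h] exI[of _ k]) auto
  qed
qed

text \<open>For general sums of tensors the mixed terms have no sign. With orthonormal second
  factors, norm and form both split into sums over \<open>E\<close>, so the bound for
  \<open>A\<close> applies term by term; being a closed condition, it survives the closure.\<close>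

lemma lower_bound_tensor_one:
  assumes A: "csubspace A" and m: "lower_bound_op A m"
  shows "lower_bound_op (tensor_one T A) m"
proof -
  let ?S = "cspan {(T x u, T y u) |x y u. (x, y) \<in> A}"
  let ?C = "{p. m * (norm (fst p))\<^sup>2 \<le> Re (cinner (fst p) (snd p))}"
  have "?S \<subseteq> ?C"
  proof
    fix p assume "p \<in> ?S"
    from tensor_span_orthonormal[OF A this] obtain E f g where E: "finite E"
      "\<forall>e\<in>E. \<forall>e'\<in>E. cinner e e' = (if e = e' then 1 else 0)"
      "\<forall>e\<in>E. (f e, g e) \<in> A" and p: "p = (\<Sum>e\<in>E. T (f e) e, \<Sum>e\<in>E. T (g e) e)"
      by (elim exE conjE)
    note orthonormal = cinner_T_orthonormal[OF E(1,2)]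
    have "m * (norm (fst p))\<^sup>2 = m * Re (cinner (fst p) (fst p))"
      by (simp add: cinner_self)
    also have "\<dots> = (\<Sum>e\<in>E. m * (norm (f e))\<^sup>2)"
      unfolding p fst_conv orthonormal by (simp add: cinner_self sum_distrib_left)
    also have "\<dots> \<le> (\<Sum>e\<in>E. Re (cinner (f e) (g e)))"
      using m E(3) by (intro sum_mono) (auto simp: lower_bound_op_def)
    also have "\<dots> = Re (cinner (fst p) (snd p))"
      by (simp add: p orthonormal)
    finally show "p \<in> ?C" by simp
  qed
  moreover have "closed ?C"
    by (intro closed_Collect_le continuous_intros cinner.continuous_on)
  ultimately have "closure ?S \<subseteq> ?C" by (rule closure_minimal)
  then show ?thesis by (fastforce simp: lower_bound_op_def tensor_one_def)
qed

lemma tensor_one_in: "(x, y) \<in> A \<Longrightarrow> (T x u, T y u) \<in> tensor_one T A"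
  unfolding tensor_one_def
  by (rule subsetD[OF closure_subset], rule complex_vector.span_base) blast

lemma dense_Domain_tensor_one:
  assumes A: "csubspace A" and dense: "closure (Domain A) = UNIV"
  shows "closure (Domain (tensor_one T A)) = UNIV"
proof (rule dense_if_orth_trivial)
  show "csubspace (Domain (tensor_one T A))"
    unfolding tensor_one_def by (intro csubspace_Domain closure_csubspace complex_vector.subspace_span)
  fix w assume w: "\<And>y. y \<in> Domain (tensor_one T A) \<Longrightarrow> cinner y w = 0"
  show "w = 0"
  proof (rule orth_T)
    fix x u
    have "closed {x. cinner w (T x u) = 0}"
      by (intro closed_Collect_eq continuous_intros cinner.continuous_on T.continuous_on)
    moreover have "Domain A \<subseteq> {x. cinner w (T x u) = 0}"
      using w[OF DomainI[OF tensor_one_in]] cinner_zero_commute by blast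
    ultimately have "closure (Domain A) \<subseteq> {x. cinner w (T x u) = 0}"
      by (rule closure_minimal[rotated])
    with dense show "cinner w (T x u) = 0" by auto
  qed
qed

lemma symmetric_tensor_one:
  assumes A: "A \<subseteq> adjoint_op A"
  shows "tensor_one T A \<subseteq> adjoint_op (tensor_one T A)"
proof -
  let ?B = "{(T x u, T y u) |x y u. (x, y) \<in> A}"
  have "?B \<subseteq> adjoint_op ?B"
    using subset_adjoint_opD[OF A] by (auto intro!: subset_adjoint_opI simp: cinner_T)
  then have "cspan ?B \<subseteq> adjoint_op ?B"
    by (intro complex_vector.span_minimal csubspace_adjoint_op)
  then show ?thesis
    unfolding tensor_one_def by (intro symmetric_closure) (simp add: adjoint_op_cspan)
qed

text \<open>Since (A + c) R x = x for the resolvent R, the range of the shifted lifted operator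
  contains every elementary tensor and is therefore total.\<close>

lemma resolvent_oper_tensor_one:
  assumes A: "resolvent_oper A m c" and dense: "closure (Domain A) = UNIV"
  shows "resolvent_oper (tensor_one T A) m c"
proof -
  interpret A: resolvent_oper A m c by (rule A)
  show ?thesis
  proof unfold_locales
    have "A \<subseteq> adjoint_op A" by (rule A.symmetric)
    then show sym: "tensor_one T A \<subseteq> adjoint_op (tensor_one T A)"
      by (rule symmetric_tensor_one)
    show cl: "closed (tensor_one T A)" by (simp add: tensor_one_def)
    show "lower_bound_op (tensor_one T A) m"
      by (rule lower_bound_tensor_one[OF A.A_csubspace A.lower_bound])
    show "m + c > 0" by (rule A.shift_pos)
    have "csubspace (tensor_one T A)"
      unfolding tensor_one_def by (intro closure_csubspace complex_vector.subspace_span)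
    from is_oper_closure[OF this sym dense_Domain_tensor_one[OF A.A_csubspace dense]] cl
    show "is_oper (tensor_one T A)" by simp
    fix w assume w: "\<And>x y. (x, y) \<in> tensor_one T A \<Longrightarrow> cinner w (y + c *\<^sub>R x) = 0"
    show "w = 0"
    proof (rule orth_T)
      fix x u
      show "cinner w (T x u) = 0"
        using w[OF tensor_one_in[OF A.resolvent_in], of x u]
        by (simp add: T.scaleR_left[symmetric] T_add_left[symmetric])
    qed
  qed
qed

lemma resolvent_tensor_one:
  assumes A: "resolvent_oper A m c" and dense: "closure (Domain A) = UNIV"
  shows "resolvent_oper.resolvent (tensor_one T A) c (T x u) =
    T (resolvent_oper.resolvent A c x) u"
proof -
  interpret A: resolvent_oper A m c by (rule A)
  interpret TA: resolvent_oper "tensor_one T A" m c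
    by (rule resolvent_oper_tensor_one[OF A dense])
  show ?thesis
    using tensor_one_in[OF A.resolvent_in, of x u]
    by (intro TA.resolvent_eqI) (simp add: T.diff_left T.scaleR_left)
qed

end

section \<open>Approximate solutions in the form domain\<close>

text \<open>\<open>V\<close> with the form of \<open>G\<close> need not be complete, so the
  functional x -> <\<psi>, G x> is represented only approximately. The approximate minimizers are
  Cauchy for the form and hence for the norm, and \<open>G_total\<close> identifies their limit as
  \<psi>. The last conclusion serves to replace \<psi> by \<open>s n\<close> in <\<psi>, G (s
  n)>.\<close>

lemma form_limit:
  fixes G :: "'h::chilbert_space \<Rightarrow> 'h"
  assumes V: "csubspace V" "V \<subseteq> K" and K: "csubspace K" "closed K"
    and G_add: "\<And>x y. x \<in> V \<Longrightarrow> y \<in> V \<Longrightarrow> G (x + y) = G x + G y"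
    and G_scaleC: "\<And>x z. x \<in> V \<Longrightarrow> G (z *\<^sub>C x) = z *\<^sub>C G x"
    and G_sym: "\<And>x y. x \<in> V \<Longrightarrow> y \<in> V \<Longrightarrow> cinner x (G y) = cinner (G x) y"
    and G_pos: "\<And>x. x \<in> V \<Longrightarrow> (norm x)\<^sup>2 \<le> Re (cinner x (G x))"
    and G_total: "\<And>w. w \<in> K \<Longrightarrow> (\<And>x. x \<in> V \<Longrightarrow> cinner w (G x) = 0) \<Longrightarrow> w = 0"
    and \<psi>: "\<psi> \<in> K"
    and bound: "\<And>x. x \<in> V \<Longrightarrow> Re (cinner \<psi> (G x)) \<le> c * sqrt (Re (cinner x (G x)))"
  obtains s where "\<And>n. s n \<in> V" "s \<longlonglongrightarrow> \<psi>"
    "\<And>e. e > 0 \<Longrightarrow> \<exists>N. \<forall>i\<ge>N. \<forall>j\<ge>N. Re (cinner (s i - s j) (G (s i - s j))) < e"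
    "(\<lambda>n. cinner (s n) (G (s n)) - cinner \<psi> (G (s n))) \<longlonglongrightarrow> 0"
proof -
  define q where "q x = Re (cinner x (G x))" for x
  have q: "0 \<le> q x" "norm x \<le> sqrt (q x)" if "x \<in> V" for x
    using G_pos[OF that] order_trans[OF zero_le_power2]
    by (auto simp: q_def intro: real_le_rsqrt)
  have "\<exists>s\<in>V. \<forall>x\<in>V. \<bar>Re (cinner s (G x)) - Re (cinner \<psi> (G x))\<bar> \<le> e * sqrt (q x)"
    if "e > 0" for e
    unfolding q_def
  proof (rule riesz_approx[where c = c])
    fix x y assume "x \<in> V" "y \<in> V"
    then have "cinner x (G y) = cnj (cinner y (G x))"
      using G_sym cinner_commute by metis
    then show "Re (cinner x (G y)) = Re (cinner y (G x))" by simp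
  qed (use that bound q in \<open>auto simp: V csubspace_subspace G_add G_scaleC scaleR_scaleC
        cinner_add_right cinner_scaleC_right q_def\<close>)
  then have "\<forall>n. \<exists>s\<in>V. \<forall>x\<in>V. \<bar>Re (cinner s (G x)) - Re (cinner \<psi> (G x))\<bar>
      \<le> inverse (real (Suc n)) * sqrt (q x)"
    by simp
  then obtain s where s: "\<And>n. s n \<in> V" and
    approx: "\<And>n x. x \<in> V \<Longrightarrow> \<bar>Re (cinner (s n) (G x)) - Re (cinner \<psi> (G x))\<bar>
      \<le> inverse (real (Suc n)) * sqrt (q x)"
    by metis
  have diff: "sqrt (q (s i - s j)) \<le> inverse (real (Suc i)) + inverse (real (Suc j))" for i j
  proof -
    let ?d = "s i - s j"
    have d: "?d \<in> V" using s V by (simp add: complex_vector.subspace_diff)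
    have "sqrt (q ?d) * sqrt (q ?d) = q ?d" using q[OF d] by simp
    also have "q ?d = (Re (cinner (s i) (G ?d)) - Re (cinner \<psi> (G ?d)))
        - (Re (cinner (s j) (G ?d)) - Re (cinner \<psi> (G ?d)))"
      by (simp add: q_def cinner_diff_left)
    also have "\<dots> \<le> inverse (real (Suc i)) * sqrt (q ?d) + inverse (real (Suc j)) * sqrt (q ?d)"
      using approx[OF d, of i] approx[OF d, of j] by linarith
    also have "\<dots> = (inverse (real (Suc i)) + inverse (real (Suc j))) * sqrt (q ?d)"
      by (simp add: algebra_simps)
    finally have le: "sqrt (q ?d) * sqrt (q ?d) \<le> \<dots>" .
    show ?thesis
    proof (cases "q ?d = 0")
      case False
      with q(1)[OF d] have "0 < sqrt (q ?d)" by simp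
      with le show ?thesis by (rule mult_right_le_imp_le)
    qed simp
  qed
  have small: "\<exists>N. \<forall>i\<ge>N. \<forall>j\<ge>N. sqrt (q (s i - s j)) < e" if "e > 0" for e
  proof -
    obtain N where N: "inverse (real (Suc N)) < e / 2"
      using reals_Archimedean half_gt_zero \<open>e > 0\<close> by blast
    have "sqrt (q (s i - s j)) < e" if "i \<ge> N" "j \<ge> N" for i j
    proof -
      have "inverse (real (Suc i)) \<le> inverse (real (Suc N))"
        "inverse (real (Suc j)) \<le> inverse (real (Suc N))"
        using that by (auto intro!: le_imp_inverse_le)
      with diff[of i j] N show ?thesis by linarith
    qed
    then show ?thesis by blast
  qed
  have sd: "s i - s j \<in> V" for i j using s V by (simp add: complex_vector.subspace_diff)
  have "Cauchy s"
  proof (rule CauchyI)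
    fix e :: real assume "e > 0"
    from small[OF this] show "\<exists>N. \<forall>i\<ge>N. \<forall>j\<ge>N. norm (s i - s j) < e"
      using q(2)[OF sd] by (meson le_less_trans)
  qed
  then obtain \<eta> where \<eta>: "s \<longlonglongrightarrow> \<eta>"
    using Cauchy_convergent convergent_def by blast
  have "\<eta> \<in> K"
  proof (rule closed_sequentially[OF K(2) _ \<eta>])
    show "s n \<in> K" for n using s V(2) by (rule subsetD[rotated])
  qed
  have inv_lim: "(\<lambda>n. inverse (real (Suc n)) * a) \<longlonglongrightarrow> 0" for a
    using tendsto_mult_left_zero[OF LIMSEQ_inverse_real_of_nat] by simp
  have Re0: "Re (cinner (\<eta> - \<psi>) (G x)) = 0" if x: "x \<in> V" for x
  proof -
    have "(\<lambda>n. \<bar>Re (cinner (s n) (G x)) - Re (cinner \<psi> (G x))\<bar>) \<longlonglongrightarrow> 0"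
      by (rule tendsto_sandwich[OF _ _ tendsto_const inv_lim[of "sqrt (q x)"]]) (use approx[OF x] in auto)
    moreover have "(\<lambda>n. \<bar>Re (cinner (s n) (G x)) - Re (cinner \<psi> (G x))\<bar>) \<longlonglongrightarrow>
        \<bar>Re (cinner \<eta> (G x)) - Re (cinner \<psi> (G x))\<bar>"
      by (intro tendsto_intros cinner.tendsto \<eta>)
    ultimately have "\<bar>Re (cinner \<eta> (G x)) - Re (cinner \<psi> (G x))\<bar> = 0"
      using LIMSEQ_unique by blast
    then show ?thesis by (simp add: cinner_diff_left)
  qed
  have "\<eta> - \<psi> = 0"
  proof (rule G_total)
    show "\<eta> - \<psi> \<in> K" using \<open>\<eta> \<in> K\<close> \<psi> K by (simp add: complex_vector.subspace_diff)
    fix x assume x: "x \<in> V"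
    have "Re (cinner (\<eta> - \<psi>) (G (\<i> *\<^sub>C x))) = 0"
      using x V by (intro Re0 complex_vector.subspace_scale)
    with Re0[OF x] show "cinner (\<eta> - \<psi>) (G x) = 0"
      using x by (simp add: G_scaleC cinner_scaleC_right complex_eq_iff)
  qed
  with \<eta> have lim: "s \<longlonglongrightarrow> \<psi>" by simp
  \<comment> \<open>Testing the approximate equation for \<open>s n\<close> on \<open>s n\<close>
    itself bounds its form norm uniformly.\<close>
  have q_bound: "sqrt (q (s n)) \<le> \<bar>c\<bar> + 1" for n
  proof -
    have "sqrt (q (s n)) * sqrt (q (s n)) = q (s n)" using q[OF s] by simp
    also have "\<dots> \<le> c * sqrt (q (s n)) + inverse (real (Suc n)) * sqrt (q (s n))"
      using approx[OF s, of n n] bound[OF s, of n] by (simp add: q_def)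
    also have "\<dots> \<le> \<bar>c\<bar> * sqrt (q (s n)) + 1 * sqrt (q (s n))"
      using q(1)[OF s] by (intro add_mono mult_right_mono) (auto simp: inverse_le_1_iff)
    also have "\<dots> = (\<bar>c\<bar> + 1) * sqrt (q (s n))" by (simp add: algebra_simps)
    finally have le: "sqrt (q (s n)) * sqrt (q (s n)) \<le> \<dots>" .
    show ?thesis
    proof (cases "q (s n) = 0")
      case False
      with q(1)[OF s, of n] have "0 < sqrt (q (s n))" by simp
      with le show ?thesis by (rule mult_right_le_imp_le)
    qed simp
  qed
  let ?D = "\<lambda>n. cinner (s n) (G (s n)) - cinner \<psi> (G (s n))"
  have D: "norm (?D n) \<le> inverse (real (Suc n)) * (2 * (\<bar>c\<bar> + 1))" for n
  proof -
    \<comment> \<open>The approximate equation controls real parts only; the vector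
      \<open>\<i> *\<^sub>C s n\<close> supplies the imaginary part.\<close>
    have isn: "\<i> *\<^sub>C s n \<in> V" using s V by (intro complex_vector.subspace_scale)
    have "q (\<i> *\<^sub>C s n) = q (s n)"
      using s by (simp add: q_def G_scaleC cinner_scaleC_left cinner_scaleC_right)
    then have "\<bar>Im (?D n)\<bar> \<le> inverse (real (Suc n)) * sqrt (q (s n))"
      using approx[OF isn, of n] s by (simp add: G_scaleC cinner_scaleC_right)
    moreover have "\<bar>Re (?D n)\<bar> \<le> inverse (real (Suc n)) * sqrt (q (s n))"
      using approx[OF s, of n n] by simp
    ultimately have "norm (?D n) \<le> inverse (real (Suc n)) * (2 * sqrt (q (s n)))"
      using cmod_le[of "?D n"] by linarith
    also have "\<dots> \<le> inverse (real (Suc n)) * (2 * (\<bar>c\<bar> + 1))"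
      using q_bound[of n] by (intro mult_left_mono) auto
    finally show ?thesis .
  qed
  have "?D \<longlonglongrightarrow> 0"
    by (rule Lim_null_comparison[OF _ inv_lim[of "2 * (\<bar>c\<bar> + 1)"]]) (use D in auto)
  moreover have "\<exists>N. \<forall>i\<ge>N. \<forall>j\<ge>N. Re (cinner (s i - s j) (G (s i - s j))) < e" if "e > 0" for e
  proof -
    have "sqrt e > 0" using that by simp
    from small[OF this] show ?thesis by (simp add: q_def)
  qed
  ultimately show ?thesis using that s lim by blast
qed

section \<open>Particle number sectors\<close>

locale fock_tensor = tensor T
  for T :: "'a::chilbert_space \<Rightarrow> 'f::chilbert_space \<Rightarrow> 'h::chilbert_space" +
  fixes S :: "'b::chilbert_space list \<Rightarrow> 'f"
  assumes S: "symmetric_fock S"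
begin

abbreviation "\<F> \<equiv> fock_sector S"
abbreviation "\<K> \<equiv> sector T S"
abbreviation "P \<equiv> component T S"

lemma csubspace_\<F>: "csubspace (\<F> k)"
  unfolding fock_sector_def by (auto intro!: closure_csubspace)

lemma closed_\<F>: "closed (\<F> k)"
  by (simp add: fock_sector_def)

lemma S_in_\<F>: "S xs \<in> \<F> (int (length xs))"
  using subsetD[OF closure_subset complex_vector.span_base[of "S xs" "{S ys |ys. length ys = length xs}"]]
  by (auto simp: fock_sector_def)

lemma \<F>_orth:
  assumes "u \<in> \<F> k" "v \<in> \<F> l" "k \<noteq> l" shows "cinner u v = 0"
proof (cases "k < 0 \<or> l < 0")
  case True
  with assms show ?thesis by (auto simp: fock_sector_def)
next
  case False
  then have "u \<in> closure (cspan {S xs |xs. int (length xs) = k})"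
    "v \<in> closure (cspan {S xs |xs. int (length xs) = l})"
    using assms by (auto simp: fock_sector_def)
  then show ?thesis
    by (rule orthogonal_closure_cspans) (use S assms(3) in \<open>auto simp: symmetric_fock_def\<close>)
qed

lemma csubspace_\<K>: "csubspace (\<K> k)" and closed_\<K>: "closed (\<K> k)"
  by (simp_all add: sector_def closure_csubspace)

lemma T_in_\<K>: "u \<in> \<F> k \<Longrightarrow> T x u \<in> \<K> k"
  unfolding sector_def
  by (rule subsetD[OF closure_subset], rule complex_vector.span_base) blast

lemma \<K>_orth:
  assumes "x \<in> \<K> k" "y \<in> \<K> l" "k \<noteq> l" shows "cinner x y = 0"
  using assms(1,2) unfolding sector_def
  by (rule orthogonal_closure_cspans) (auto simp: cinner_T \<F>_orth[OF _ _ assms(3)])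

lemma \<K>_neg: "k < 0 \<Longrightarrow> x \<in> \<K> k \<Longrightarrow> x = 0"
proof -
  assume k: "k < 0" and x: "x \<in> \<K> k"
  have "cinner x x = 0"
    using x unfolding sector_def
    by (rule orthogonal_closure_cspan) (use k in \<open>auto simp: fock_sector_def T.zero_right\<close>)
  then show "x = 0" by simp
qed

text \<open>The vectors \<open>T x (S xs)\<close> lie in sectors, and for fixed \<open>x\<close> the
  second factor extends from the span of \<open>range S\<close> to the whole Fock space by
  continuity.\<close>

lemma \<K>_total:
  assumes "\<And>n y. y \<in> \<K> (int n) \<Longrightarrow> cinner w y = 0" shows "w = 0"
proof (rule orth_T)
  fix x u
  have "csubspace {u. cinner w (T x u) = 0}"
    by (rule complex_vector.subspaceI)
      (auto simp: T.zero_right T_add_right T_scaleC_right cinner_add_right cinner_scaleC_right)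
  moreover have "range S \<subseteq> {u. cinner w (T x u) = 0}"
    using assms[OF T_in_\<K>[OF S_in_\<F>]] by auto
  ultimately have "cspan (range S) \<subseteq> {u. cinner w (T x u) = 0}"
    by (rule complex_vector.span_minimal[rotated])
  moreover have "closed {u. cinner w (T x u) = 0}"
    by (intro closed_Collect_eq continuous_intros cinner.continuous_on T.continuous_on)
  ultimately have "closure (cspan (range S)) \<subseteq> {u. cinner w (T x u) = 0}"
    by (rule closure_minimal)
  then show "cinner w (T x u) = 0"
    using S by (auto simp: symmetric_fock_def)
qed

lemma P_in: "P k x \<in> \<K> k"
  unfolding component_def by (rule orth_proj_in[OF csubspace_\<K> closed_\<K>])

lemma cinner_P: "y \<in> \<K> k \<Longrightarrow> cinner y (P k x) = cinner y x"
  unfolding component_def by (rule cinner_orth_proj[OF csubspace_\<K> closed_\<K>])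

lemma cinner_P_left: "y \<in> \<K> k \<Longrightarrow> cinner (P k x) y = cinner x y"
  unfolding component_def by (rule cinner_orth_proj_left[OF csubspace_\<K> closed_\<K>])

lemma P_id: "x \<in> \<K> k \<Longrightarrow> P k x = x"
  unfolding component_def by (rule orth_proj_id[OF csubspace_\<K> closed_\<K>])

lemma P_other: "x \<in> \<K> k \<Longrightarrow> k \<noteq> l \<Longrightarrow> P l x = 0"
  unfolding component_def
  by (rule orth_proj_zero[OF csubspace_\<K> closed_\<K>]) (auto simp: orth_compl_def \<K>_orth)

lemma P_add: "P k (x + y) = P k x + P k y"
  and P_diff: "P k (x - y) = P k x - P k y"
  and P_scaleC: "P k (z *\<^sub>C x) = z *\<^sub>C P k x"
  and P_sum: "P k (sum f I) = (\<Sum>i\<in>I. P k (f i))"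
  and norm_P_le: "norm (P k x) \<le> norm x"
  unfolding component_def
  by (rule orth_proj_add orth_proj_diff orth_proj_scaleC orth_proj_sum norm_orth_proj_le;
      rule csubspace_\<K> closed_\<K>)+

lemma P_sum_components:
  assumes "finite J" "\<And>j. j \<in> J \<Longrightarrow> v j \<in> \<K> j"
  shows "P k (sum v J) = (if k \<in> J then v k else 0)"
proof -
  have "P k (sum v J) = (\<Sum>j\<in>J. if j = k then v j else 0)"
    unfolding P_sum using assms(2) by (intro sum.cong refl) (auto simp: P_id intro: P_other)
  then show ?thesis using assms(1) by simp
qed

lemma P_eq_0: "(\<And>n::nat. P (int n) x = 0) \<Longrightarrow> x = 0"
  using \<K>_total[of x] cinner_P_left[of _ _ x] by (metis cinner_zero_left)

lemma bessel:
  assumes "finite J"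
  shows "(\<Sum>k\<in>J. (norm (P k x))\<^sup>2) \<le> (norm x)\<^sup>2"
proof -
  define \<Phi> where "\<Phi> = (\<Sum>k\<in>J. P k x)"
  have P\<Phi>: "P k \<Phi> = P k x" if "k \<in> J" for k
    using P_sum_components[of J "\<lambda>k. P k x" k, OF assms P_in] that by (simp add: \<Phi>_def)
  have *: "cinner \<Phi> y = (\<Sum>k\<in>J. of_real ((norm (P k x))\<^sup>2))"
    if "\<And>k. k \<in> J \<Longrightarrow> P k y = P k x" for y
    unfolding cinner_sum_left \<Phi>_def using cinner_P[OF P_in, of _ x y] that
    by (intro sum.cong refl) (metis cinner_self)
  have "cinner \<Phi> \<Phi> = cinner \<Phi> x"
    using *[of \<Phi>] *[of x] P\<Phi> by simp
  then have "(norm \<Phi>)\<^sup>2 = Re (cinner \<Phi> x)" by (metis Re_cinner power2_norm_eq_inner)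
  also have "\<dots> \<le> norm \<Phi> * norm x"
    using complex_Re_le_cmod norm_cinner_le by (rule order_trans)
  finally have "norm \<Phi> \<le> norm x"
    by (cases "\<Phi> = 0") (auto simp: power2_eq_square)
  moreover have "complex_of_real ((norm \<Phi>)\<^sup>2) = of_real (\<Sum>k\<in>J. (norm (P k x))\<^sup>2)"
    using *[of \<Phi>] P\<Phi> by (simp add: cinner_self)
  then have "(norm \<Phi>)\<^sup>2 = (\<Sum>k\<in>J. (norm (P k x))\<^sup>2)"
    using of_real_eq_iff by blast
  ultimately show ?thesis by (metis norm_ge_zero power_mono)
qed

lemma sum_near_le: "(\<Sum>i\<in>{-2..2}. (norm (P (int n + i) x))\<^sup>2) \<le> (norm x)\<^sup>2"
proof -
  have "(\<Sum>i\<in>{-2..2}. (norm (P (int n + i) x))\<^sup>2) =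
      (\<Sum>k\<in>(\<lambda>i. int n + i) ` {-2..2}. (norm (P k x))\<^sup>2)"
    by (subst sum.reindex) (auto simp: inj_on_def)
  also have "\<dots> \<le> (norm x)\<^sup>2" by (rule bessel) simp
  finally show ?thesis .
qed

text \<open>In terms of components, membership becomes a linear condition that is easy to combine;
  the negative sectors are zero, so a bound on the particle number from above is enough.\<close>

lemma finite_particle_iff:
  "x \<in> finite_particle T S \<longleftrightarrow> (\<exists>N::nat. \<forall>k. k > int N \<longrightarrow> P k x = 0)"
proof
  assume "x \<in> finite_particle T S"
  then obtain n :: nat and v
    where v: "x = (\<Sum>k\<in>{0..int n}. v k)" "\<And>k. k \<in> {0..int n} \<Longrightarrow> v k \<in> \<K> k"
    by (auto simp: finite_particle_def sector_sum_def)
  have "P k x = (if k \<in> {0..int n} then v k else 0)" for k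
    unfolding v(1) by (rule P_sum_components[OF finite_atLeastAtMost_int v(2)])
  then show "\<exists>N::nat. \<forall>k. k > int N \<longrightarrow> P k x = 0"
    by (intro exI[of _ n]) simp
next
  assume "\<exists>N::nat. \<forall>k. k > int N \<longrightarrow> P k x = 0"
  then obtain N :: nat where N: "\<And>k. k > int N \<Longrightarrow> P k x = 0" by blast
  have "x - (\<Sum>k\<in>{0..int N}. P k x) = 0"
    by (rule P_eq_0) (use N in \<open>auto simp: P_diff P_sum_components P_in\<close>)
  then have "x = (\<Sum>k\<in>{0..int N}. P k x)" by simp
  then show "x \<in> finite_particle T S"
    unfolding finite_particle_def sector_sum_def using P_in by blast
qed

lemma csubspace_finite_particle: "csubspace (finite_particle T S)"
proof (rule complex_vector.subspaceI)
  show "0 \<in> finite_particle T S"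
    using P_id[OF complex_vector.subspace_0[OF csubspace_\<K>]] by (auto simp: finite_particle_iff)
next
  fix x y assume "x \<in> finite_particle T S" "y \<in> finite_particle T S"
  then obtain M N :: nat where "\<And>k. k > int M \<Longrightarrow> P k x = 0" "\<And>k. k > int N \<Longrightarrow> P k y = 0"
    by (auto simp: finite_particle_iff)
  then show "x + y \<in> finite_particle T S"
    by (auto simp: finite_particle_iff P_add intro!: exI[of _ "max M N"])
next
  fix z x assume "x \<in> finite_particle T S"
  then show "z *\<^sub>C x \<in> finite_particle T S"
    by (auto simp: finite_particle_iff P_scaleC)
qed

lemma \<K>_finite_particle: "x \<in> \<K> (int n) \<Longrightarrow> x \<in> finite_particle T S"
  unfolding finite_particle_iff using P_other by (intro exI[of _ n]) auto

lemma finite_particle_sum: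
  assumes "x \<in> finite_particle T S"
  obtains N :: nat where "x = (\<Sum>n\<le>N. P (int n) x)"
proof -
  obtain N :: nat where N: "\<And>k. k > int N \<Longrightarrow> P k x = 0"
    using assms by (auto simp: finite_particle_iff)
  have "x - (\<Sum>n\<le>N. P (int n) x) = 0"
  proof (rule P_eq_0)
    fix k
    have "P (int k) (\<Sum>n\<le>N. P (int n) x) = (\<Sum>n\<le>N. if n = k then P (int n) x else 0)"
      unfolding P_sum by (intro sum.cong refl) (auto simp: P_id P_in intro: P_other[OF P_in])
    also have "\<dots> = P (int k) x"
      using N[of "int k"] by simp
    finally show "P (int k) (x - (\<Sum>n\<le>N. P (int n) x)) = 0"
      by (simp add: P_diff)
  qed
  then show ?thesis using that[of N] by simp
qed

end

section \<open>The free Hamiltonian\<close>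

text \<open>Invariance under \<open>U (- t)\<close> makes \<open>U t\<close> preserve the orthogonal
  complement of \<open>F\<close>, so the projection commutes with the group; differentiating at 0
  passes this on to the generator.\<close>

lemma reduced_by_unitary_group:
  fixes B :: "'f::chilbert_space oper"
  assumes U: "unitary_group_of B U" and F: "csubspace F" "closed F" and inv: "\<And>t. U t ` F \<subseteq> F"
    and xy: "(x, y) \<in> B"
  shows "(orth_proj F x, orth_proj F y) \<in> B"
proof -
  have U_add: "U t (x + y) = U t x + U t y" and U_cinner: "cinner (U t x) (U t y) = cinner x y"
    for t x y
    using U unfolding unitary_group_of_def Vector_Spaces.linear_iff by blast+
  have U_inv: "U t (U (- t) x) = x" for t x
  proof -
    have "U (t + - t) = U t \<circ> U (- t)" "U 0 = id"
      using U unfolding unitary_group_of_def by blast+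
    then show ?thesis by (metis add.right_inverse comp_apply id_apply)
  qed
  have B: "(x, y) \<in> B \<longleftrightarrow> ((\<lambda>t. U t x) has_vector_derivative \<i> *\<^sub>C y) (at 0)" for x y
    using U unfolding unitary_group_of_def by blast
  let ?P = "orth_proj F"
  have commute: "?P (U t z) = U t (?P z)" for t z
  proof (rule orth_proj_eqI[OF F(1)])
    show "U t (?P z) \<in> F" using inv orth_proj_in[OF F] by blast
    have eq: "U t z - U t (?P z) = U t (z - ?P z)"
      using U_add[of t "z - ?P z" "?P z"] by simp
    show "U t z - U t (?P z) \<in> orth_compl F"
      unfolding eq orth_compl_def
    proof clarify
      fix y assume "y \<in> F"
      then have "U (- t) y \<in> F" using inv by blast
      then have "cinner (U (- t) y) (z - ?P z) = 0"
        using orth_proj_orth[OF F, of z] by (auto simp: orth_compl_def)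
      then show "cinner y (U t (z - ?P z)) = 0"
        using U_cinner[of t "U (- t) y" "z - ?P z"] by (simp add: U_inv)
    qed
  qed
  have "((\<lambda>t. U t x) has_vector_derivative \<i> *\<^sub>C y) (at 0)" using xy B by blast
  from bounded_linear.has_vector_derivative[OF bounded_linear_orth_proj[OF F] this]
  have "((\<lambda>t. U t (?P x)) has_vector_derivative \<i> *\<^sub>C ?P y) (at 0)"
    by (simp add: commute orth_proj_scaleC[OF F])
  then show ?thesis using B by blast
qed

locale free_hamiltonian = fock_tensor T S
  for T :: "'a::chilbert_space \<Rightarrow> 'f::chilbert_space \<Rightarrow> 'h::chilbert_space"
    and S :: "'b::chilbert_space list \<Rightarrow> 'f" +
  fixes H01 :: "'a oper" and H02 :: "'f oper" and M1 M2 :: real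
  assumes A0: "cond_A0 S H01 H02 M1 M2"
begin

text \<open>Absolute values weaken the lower bounds to match the constant in the form norm, and each
  shift leaves a gap of 1/2, so that the two shifts add up to that constant.\<close>

lemma resolvent_oper_H01: "resolvent_oper H01 (- \<bar>M1\<bar>) (\<bar>M1\<bar> + 1 / 2)"
  and resolvent_oper_H02: "resolvent_oper H02 (- \<bar>M2\<bar>) (\<bar>M2\<bar> + 1 / 2)"
proof -
  have weaken: "lower_bound_op B (- \<bar>M\<bar>)" if "lower_bound_op B (- M)"
    for B :: "'c::chilbert_space oper" and M
    unfolding lower_bound_op_def
  proof clarify
    fix x y assume "(x, y) \<in> B"
    then have "- M * (norm x)\<^sup>2 \<le> Re (cinner x y)"
      using that by (auto simp: lower_bound_op_def)
    moreover have "- \<bar>M\<bar> * (norm x)\<^sup>2 \<le> - M * (norm x)\<^sup>2"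
      by (rule mult_right_mono) auto
    ultimately show "- \<bar>M\<bar> * (norm x)\<^sup>2 \<le> Re (cinner x y)" by linarith
  qed
  show "resolvent_oper H01 (- \<bar>M1\<bar>) (\<bar>M1\<bar> + 1 / 2)"
    "resolvent_oper H02 (- \<bar>M2\<bar>) (\<bar>M2\<bar> + 1 / 2)"
    using A0 by (auto simp: cond_A0_def intro!: self_adjoint_resolvent_oper weaken)
qed

sublocale H01: resolvent_oper H01 "- \<bar>M1\<bar>" "\<bar>M1\<bar> + 1 / 2"
  by (rule resolvent_oper_H01)

sublocale H02: resolvent_oper H02 "- \<bar>M2\<bar>" "\<bar>M2\<bar> + 1 / 2"
  by (rule resolvent_oper_H02)

lemma dense_H01: "closure (Domain H01) = UNIV" and dense_H02: "closure (Domain H02) = UNIV"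
  using A0 by (auto simp: cond_A0_def self_adjoint_op_def)

abbreviation "A \<equiv> tensor_one T H01"
abbreviation "B \<equiv> one_tensor T H02"

sublocale A: resolvent_oper A "- \<bar>M1\<bar>" "\<bar>M1\<bar> + 1 / 2"
  by (rule resolvent_oper_tensor_one[OF resolvent_oper_H01 dense_H01])

sublocale B: resolvent_oper B "- \<bar>M2\<bar>" "\<bar>M2\<bar> + 1 / 2"
  unfolding one_tensor_swap
  by (rule tensor.resolvent_oper_tensor_one[OF tensor.intro[OF swap] resolvent_oper_H02 dense_H02])

lemma A_resolvent_T: "A.resolvent (T x u) = T (H01.resolvent x) u"
  by (rule resolvent_tensor_one[OF resolvent_oper_H01 dense_H01])

lemma B_resolvent_T: "B.resolvent (T x u) = T x (H02.resolvent u)"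
  unfolding one_tensor_swap
  by (rule tensor.resolvent_tensor_one[OF tensor.intro[OF swap] resolvent_oper_H02 dense_H02])

text \<open>On elementary tensors the two resolvents act on different factors; linearity,
  boundedness and totality extend this to all vectors.\<close>

lemma resolvents_commute: "A.resolvent (B.resolvent x) = B.resolvent (A.resolvent x)"
proof -
  let ?E = "{x. A.resolvent (B.resolvent x) - B.resolvent (A.resolvent x) = 0}"
  have "csubspace ?E"
    using A.resolvent_scaleC[of 0 0] B.resolvent_scaleC[of 0 0]
    by (intro complex_vector.subspaceI)
      (auto simp: A.resolvent_add B.resolvent_add A.resolvent_scaleC B.resolvent_scaleC)
  then have "cspan {T x u |x u. True} \<subseteq> ?E"
    by (intro complex_vector.span_minimal) (auto simp: A_resolvent_T B_resolvent_T)
  moreover have "closed ?E"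
    by (intro closed_Collect_eq continuous_intros
        bounded_linear.continuous_on[OF A.bounded_linear_resolvent]
        bounded_linear.continuous_on[OF B.bounded_linear_resolvent])
  ultimately have "closure (cspan {T x u |x u. True}) \<subseteq> ?E" by (rule closure_minimal)
  then show ?thesis using T_dense by auto
qed

lemma A_resolvent_\<K>: "x \<in> \<K> k \<Longrightarrow> A.resolvent x \<in> \<K> k"
  by (rule A.resolvent_closure_cspan[OF csubspace_\<K> closed_\<K>, of x "{T x u |x u. u \<in> \<F> k}"])
    (auto simp: sector_def[of T S k, symmetric] A_resolvent_T T_in_\<K>)

text \<open>The projection of \<open>H02.resolvent u\<close> onto the sector solves the same
  resolvent equation, because the unitary group reduces \<open>H02\<close>; uniqueness identifies
  the two.\<close>

lemma H02_resolvent_\<F>: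
  assumes u: "u \<in> \<F> (int n)" shows "H02.resolvent u \<in> \<F> (int n)"
proof -
  obtain U where U: "unitary_group_of H02 U" "\<And>t. U t ` \<F> (int n) \<subseteq> \<F> (int n)"
    using A0 by (auto simp: cond_A0_def)
  note F = csubspace_\<F>[of "int n"] closed_\<F>[of "int n"]
  let ?P = "orth_proj (\<F> (int n))" and ?c = "\<bar>M2\<bar> + 1 / 2"
  have "(?P (H02.resolvent u), ?P (u - ?c *\<^sub>R H02.resolvent u)) \<in> H02"
    by (rule reduced_by_unitary_group[OF U(1) F U(2) H02.resolvent_in])
  then have "(?P (H02.resolvent u), u - ?c *\<^sub>R ?P (H02.resolvent u)) \<in> H02"
    by (simp add: orth_proj_diff[OF F] scaleR_scaleC orth_proj_scaleC[OF F] orth_proj_id[OF F u])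
  then have "H02.resolvent u = ?P (H02.resolvent u)"
    by (rule H02.resolvent_eqI)
  also have "\<dots> \<in> \<F> (int n)" by (rule orth_proj_in[OF F])
  finally show ?thesis .
qed

lemma B_resolvent_\<K>: "x \<in> \<K> (int n) \<Longrightarrow> B.resolvent x \<in> \<K> (int n)"
  by (rule B.resolvent_closure_cspan[OF csubspace_\<K> closed_\<K>,
        of x "{T x u |x u. u \<in> \<F> (int n)}"])
    (auto simp: sector_def[of T S "int n", symmetric] B_resolvent_T T_in_\<K> H02_resolvent_\<F>)

section \<open>The shifted free operator and its form on a single sector\<close>

definition V :: "nat \<Rightarrow> 'h set"
  where "V n = Domain A \<inter> Domain B \<inter> \<K> (int n)"

lemma csubspace_V: "csubspace (V n)"
  unfolding V_def
  by (intro complex_vector.subspace_inter A.csubspace_dom B.csubspace_dom csubspace_\<K>)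

lemma V_dest: "x \<in> V n \<Longrightarrow> x \<in> Domain A" "x \<in> V n \<Longrightarrow> x \<in> Domain B" "x \<in> V n \<Longrightarrow> x \<in> \<K> (int n)"
  by (simp_all add: V_def)

lemma P_V: "x \<in> Domain A \<Longrightarrow> x \<in> Domain B \<Longrightarrow> P (int n) x \<in> V n"
  unfolding V_def component_def
  using A.reduced[OF csubspace_\<K> closed_\<K> A_resolvent_\<K>]
    B.reduced[OF csubspace_\<K> closed_\<K> B_resolvent_\<K>]
    P_in[of "int n" x, unfolded component_def] by blast

definition M :: real where "M = \<bar>M1\<bar> + \<bar>M2\<bar> + 1"

definition G :: "'h \<Rightarrow> 'h"
  where "G x = op_apply A x + op_apply B x + M *\<^sub>R x"

abbreviation "X \<equiv> X_norm_sq T H01 H02 M1 M2"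
abbreviation "Q \<equiv> Q_space T S H01 H02"

lemma M_ge: "M \<ge> 1" by (simp add: M_def)

lemma V_Q: "x \<in> V n \<Longrightarrow> x \<in> Q n"
  by (simp add: V_def Q_space_def A.form_domain_Domain B.form_domain_Domain)

text \<open>After each form has been made positive by its own bound, exactly 1 is left of the
  constant \<open>M\<close>.\<close>

lemma Re_G: "Re (cinner x (G x)) = A.formq x + B.formq x + (norm x)\<^sup>2"
  by (simp add: G_def A.formq_def A.form_def B.formq_def B.form_def cinner_add_right
      cinner_scaleR_right cinner_self M_def algebra_simps)

lemma X_V: "x \<in> V n \<Longrightarrow> X x = Re (cinner x (G x))"
  by (simp add: X_norm_sq_def A.quad_form_Domain B.quad_form_Domain V_def G_def cinner_add_right
      cinner_scaleR_right cinner_self M_def)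

lemma G_add: "x \<in> V n \<Longrightarrow> y \<in> V n \<Longrightarrow> G (x + y) = G x + G y"
  by (simp add: G_def V_def op_apply_add[OF A.is_oper] op_apply_add[OF B.is_oper] algebra_simps
      del: Domain_iff)

lemma G_scaleC: "x \<in> V n \<Longrightarrow> G (c *\<^sub>C x) = c *\<^sub>C G x"
  by (simp add: G_def V_def op_apply_scaleC[OF A.is_oper] op_apply_scaleC[OF B.is_oper]
      scaleC_add_right scaleR_scaleC mult.commute del: Domain_iff)

lemma G_sym: "x \<in> V n \<Longrightarrow> y \<in> V n \<Longrightarrow> cinner x (G y) = cinner (G x) y"
  by (simp add: G_def V_def A.cinner_op_apply B.cinner_op_apply cinner_add_left cinner_add_right
      cinner_scaleR_left cinner_scaleR_right del: Domain_iff)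

lemma G_pos: "x \<in> V n \<Longrightarrow> (norm x)\<^sup>2 \<le> Re (cinner x (G x))"
  unfolding Re_G using A.formq_nonneg[OF V_dest(1)] B.formq_nonneg[OF V_dest(2)] by force

lemma G_in: assumes "x \<in> V n" shows "G x \<in> \<K> (int n)"
proof -
  have "op_apply A x \<in> \<K> (int n)"
    using assms by (intro A.op_apply_reduced csubspace_\<K> closed_\<K> A_resolvent_\<K>) (auto simp: V_def)
  moreover have "op_apply B x \<in> \<K> (int n)"
    using assms by (intro B.op_apply_reduced csubspace_\<K> closed_\<K> B_resolvent_\<K>) (auto simp: V_def)
  ultimately show ?thesis
    unfolding G_def using assms
    by (intro complex_vector.subspace_add csubspace_\<K> csubspace_scaleR) (auto simp: V_def)
qed

lemma resolvents_V:
  assumes "y \<in> \<K> (int n)"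
  shows "A.resolvent (B.resolvent y) \<in> V n"
    and "G (A.resolvent (B.resolvent y)) = A.resolvent y + B.resolvent y"
proof -
  let ?x = "A.resolvent (B.resolvent y)"
  have A: "(?x, B.resolvent y - (\<bar>M1\<bar> + 1 / 2) *\<^sub>R ?x) \<in> A" by (rule A.resolvent_in)
  \<comment> \<open>Commuting the resolvents exhibits the same vector as a value of
    \<open>B.resolvent\<close>.\<close>
  have B: "(?x, A.resolvent y - (\<bar>M2\<bar> + 1 / 2) *\<^sub>R ?x) \<in> B"
    unfolding resolvents_commute by (rule B.resolvent_in)
  have M: "M *\<^sub>R ?x = (\<bar>M1\<bar> + 1 / 2) *\<^sub>R ?x + (\<bar>M2\<bar> + 1 / 2) *\<^sub>R ?x"
    by (simp add: M_def scaleR_add_left[symmetric])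
  show "?x \<in> V n"
    unfolding V_def using A B assms A_resolvent_\<K> B_resolvent_\<K> by blast
  show "G ?x = A.resolvent y + B.resolvent y"
    unfolding G_def op_apply_eq[OF A.is_oper A] op_apply_eq[OF B.is_oper B] M by simp
qed

text \<open>If \<open>w\<close> is orthogonal to \<open>G (R\<^sub>A R\<^sub>B w) = R\<^sub>A w + R\<^sub>B w\<close>, where \<open>R\<^sub>A\<close> and \<open>R\<^sub>B\<close> are the
  commuting positive injective resolvents, then \<open>w = 0\<close>.\<close>

lemma G_total:
  assumes w: "w \<in> \<K> (int n)" and orth: "\<And>x. x \<in> V n \<Longrightarrow> cinner w (G x) = 0"
  shows "w = 0"
proof -
  have "cinner w (A.resolvent w + B.resolvent w) = 0"
    using orth[OF resolvents_V(1)[OF w]] resolvents_V(2)[OF w] by simp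
  then have "Re (cinner w (A.resolvent w)) + Re (cinner w (B.resolvent w)) = 0"
    by (metis cinner_add_right plus_complex.sel(1) zero_complex.sel(1))
  moreover have "(norm (A.resolvent w))\<^sup>2 / 2 \<le> Re (cinner w (A.resolvent w))"
    "(norm (B.resolvent w))\<^sup>2 / 2 \<le> Re (cinner w (B.resolvent w))"
    using A.resolvent_pos_right[of w] B.resolvent_pos_right[of w] by simp_all
  ultimately have "(norm (A.resolvent w))\<^sup>2 \<le> 0"
    using zero_le_power2[of "norm (B.resolvent w)"] by linarith
  then show ?thesis by - (rule A.resolvent_eq_0, simp)
qed

text \<open>The vectors \<open>A.resolvent (B.resolvent y)\<close> lie in \<open>V n\<close>; moved
  over to \<open>w\<close>, the symmetric injective resolvents reduce the claim to totality of the
  sectors. This makes the domain \<open>D\<close> below dense.\<close>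

lemma resolvents_total:
  assumes orth: "\<And>n x. x \<in> V n \<Longrightarrow> cinner x w = 0" shows "w = 0"
proof -
  have "B.resolvent (A.resolvent w) = 0"
  proof (rule \<K>_total)
    fix n y assume "y \<in> \<K> (int n)"
    then have "cinner (A.resolvent (B.resolvent y)) w = 0"
      using orth resolvents_V(1) by blast
    then have "cinner y (B.resolvent (A.resolvent w)) = 0"
      by (simp add: A.resolvent_cinner B.resolvent_cinner)
    then show "cinner (B.resolvent (A.resolvent w)) y = 0"
      using cinner_zero_commute by blast
  qed
  then show ?thesis using A.resolvent_eq_0 B.resolvent_eq_0 by blast
qed

lemma V_form_approx:
  assumes s: "\<And>k. s k \<in> V n" and lim: "s \<longlonglongrightarrow> \<psi>"
    and Cauchy: "\<And>e. e > 0 \<Longrightarrow> \<exists>N. \<forall>i\<ge>N. \<forall>j\<ge>N. Re (cinner (s i - s j) (G (s i - s j))) < e"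
  shows "form_approx A s \<psi>" "form_approx B s \<psi>"
proof -
  have d: "s i - s j \<in> V n" for i j
    using s by (intro complex_vector.subspace_diff csubspace_V)
  have le: "A.formq (s i - s j) + (norm (s i - s j))\<^sup>2 \<le> Re (cinner (s i - s j) (G (s i - s j)))"
    "B.formq (s i - s j) + (norm (s i - s j))\<^sup>2 \<le> Re (cinner (s i - s j) (G (s i - s j)))" for i j
    unfolding Re_G using A.formq_nonneg[OF V_dest(1)[OF d]] B.formq_nonneg[OF V_dest(2)[OF d]] by simp_all
  show "form_approx A s \<psi>"
    by (rule A.form_approxI[OF V_dest(1)[OF s] lim]) (meson Cauchy le(1) le_less_trans)
  show "form_approx B s \<psi>"
    by (rule B.form_approxI[OF V_dest(2)[OF s] lim]) (meson Cauchy le(2) le_less_trans)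
qed

lemma X_tendsto:
  assumes s: "form_approx A s \<psi>" "form_approx B s \<psi>"
  shows "(\<lambda>k. Re (cinner (s k) (G (s k)))) \<longlonglongrightarrow> X \<psi>"
proof -
  have "(\<lambda>k. Re (cinner (s k) (op_apply A (s k))) + Re (cinner (s k) (op_apply B (s k)))
      + M * (norm (s k))\<^sup>2) \<longlonglongrightarrow> X \<psi>"
    unfolding X_norm_sq_def M_def
    by (intro tendsto_intros A.quad_form_tendsto B.quad_form_tendsto A.form_approx_lim s)
  then show ?thesis
    by (simp add: G_def cinner_add_right cinner_scaleR_right cinner_self)
qed

lemma Q_in_\<K>: "x \<in> Q n \<Longrightarrow> x \<in> \<K> (int n)"
  by (simp add: Q_space_def)

text \<open>A vector of \<open>Q n\<close> may have unrelated approximating sequences for the two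
  forms, so each lower bound is passed to the limit separately; the remaining 1 in the constant
  gives the squared norm.\<close>

lemma X_ge:
  assumes "x \<in> Q n" shows "(norm x)\<^sup>2 \<le> X x"
proof -
  have A: "0 \<le> Re (quad_form A x x) + \<bar>M1\<bar> * (norm x)\<^sup>2"
  proof -
    obtain s where s: "form_approx A s x"
      using assms by (auto simp: Q_space_def form_domain_def)
    have "(\<lambda>k. Re (cinner (s k) (op_apply A (s k))) + \<bar>M1\<bar> * (norm (s k))\<^sup>2) \<longlonglongrightarrow>
        Re (quad_form A x x) + \<bar>M1\<bar> * (norm x)\<^sup>2"
      by (intro tendsto_intros A.quad_form_tendsto A.form_approx_lim s)
    moreover have "0 \<le> Re (cinner (s k) (op_apply A (s k))) + \<bar>M1\<bar> * (norm (s k))\<^sup>2" for k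
      using A.formq_nonneg[OF A.form_approx_dom[OF s]]
      by (simp add: A.formq_def A.form_def cinner_self)
    ultimately show ?thesis by (intro LIMSEQ_le_const) auto
  qed
  have B: "0 \<le> Re (quad_form B x x) + \<bar>M2\<bar> * (norm x)\<^sup>2"
  proof -
    obtain s where s: "form_approx B s x"
      using assms by (auto simp: Q_space_def form_domain_def)
    have "(\<lambda>k. Re (cinner (s k) (op_apply B (s k))) + \<bar>M2\<bar> * (norm (s k))\<^sup>2) \<longlonglongrightarrow>
        Re (quad_form B x x) + \<bar>M2\<bar> * (norm x)\<^sup>2"
      by (intro tendsto_intros B.quad_form_tendsto B.form_approx_lim s)
    moreover have "0 \<le> Re (cinner (s k) (op_apply B (s k))) + \<bar>M2\<bar> * (norm (s k))\<^sup>2" for k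
      using B.formq_nonneg[OF B.form_approx_dom[OF s]]
      by (simp add: B.formq_def B.form_def cinner_self)
    ultimately show ?thesis by (intro LIMSEQ_le_const) auto
  qed
  from A B show ?thesis by (simp add: X_norm_sq_def algebra_simps)
qed

end

section \<open>Deficiency vectors of the interacting Hamiltonian\<close>

text \<open>\<open>HI_bounded\<close> is a common consequence of both conditions, with a constant
  that may depend on \<open>n\<close>; the growth in \<open>n\<close> enters only through
  \<open>ess_self_adjointI\<close>.\<close>

locale hamiltonian = free_hamiltonian T S H01 H02 M1 M2
  for T :: "'a::chilbert_space \<Rightarrow> 'f::chilbert_space \<Rightarrow> 'h::chilbert_space"
    and S :: "'b::chilbert_space list \<Rightarrow> 'f" and H01 H02 M1 M2 +
  fixes HI :: "'h oper"
  assumes common: "cond_common T S H01 H02 HI"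
    and HI_bounded: "\<exists>c. \<forall>\<psi>. \<forall>\<phi>\<in>Q_space T S H01 H02 n.
      cmod (cinner \<psi> (op_apply HI \<phi>)) \<le> c * norm \<psi> * sqrt (X_norm_sq T H01 H02 M1 M2 \<phi>)"
begin

abbreviation "D \<equiv> Domain A \<inter> Domain B \<inter> finite_particle T S"
abbreviation "H \<equiv> op_restrict (op_plus (op_plus A B) HI) D"

lemma is_oper_HI: "is_oper HI" and HI_sym: "HI \<subseteq> adjoint_op HI"
  and HI_dense: "closure (Domain HI) = UNIV"
  using common by (auto simp: cond_common_def symmetric_op_def)

lemma Q_HI: "x \<in> Q n \<Longrightarrow> x \<in> Domain HI"
  and HI_Q: "x \<in> Q n \<Longrightarrow> op_apply HI x \<in> sector_sum T S {int n - 2..int n + 2}"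
  using common unfolding cond_common_def by blast+

lemma HI_cinner:
  "x \<in> Domain HI \<Longrightarrow> y \<in> Domain HI \<Longrightarrow> cinner x (op_apply HI y) = cinner (op_apply HI x) y"
  by (rule subset_adjoint_opD[OF HI_sym op_apply_in[OF is_oper_HI] op_apply_in[OF is_oper_HI]])

lemma D_HI: assumes "x \<in> D" shows "x \<in> Domain HI"
proof -
  obtain N :: nat where x: "x = (\<Sum>n\<le>N. P (int n) x)"
    using assms finite_particle_sum by blast
  have "(\<Sum>n\<le>N. P (int n) x) \<in> Domain HI"
    using op_apply_sum[OF is_oper_HI, of "{..N}" "\<lambda>n. P (int n) x"] Q_HI[OF V_Q[OF P_V]] assms
    by blast
  with x show ?thesis by metis
qed

lemma V_in_D: "x \<in> V n \<Longrightarrow> x \<in> D"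
  unfolding V_def using \<K>_finite_particle by blast

lemma csubspace_D: "csubspace D"
  by (intro complex_vector.subspace_inter A.csubspace_dom B.csubspace_dom csubspace_finite_particle)

lemma H_iff: "(x, y) \<in> H \<longleftrightarrow> x \<in> D \<and> y = op_apply A x + op_apply B x + op_apply HI x"
proof -
  note AB = op_plus_iff[OF A.is_oper B.is_oper]
  show ?thesis
  proof (cases "x \<in> D")
    case True
    then have "(x, op_apply A x + op_apply B x) \<in> op_plus A B"
      unfolding AB by blast
    then have "op_apply (op_plus A B) x = op_apply A x + op_apply B x" "x \<in> Domain (op_plus A B)"
      by (blast intro: op_apply_eq is_oper_op_plus A.is_oper B.is_oper)+
    then show ?thesis
      unfolding op_restrict_def
      using D_HI[OF True] True
      by (simp add: op_plus_iff[OF is_oper_op_plus[OF A.is_oper B.is_oper] is_oper_HI]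
          del: Domain_iff)
  qed (unfold op_restrict_def, blast)
qed

lemma D_Domain: "D \<subseteq> Domain (op_plus (op_plus A B) HI)"
  using H_iff unfolding op_restrict_def by blast

lemma symmetric_op_H: "symmetric_op H"
  unfolding symmetric_op_def
proof (intro conjI)
  show H: "is_oper H"
    by (intro is_oper_op_restrict is_oper_op_plus A.is_oper B.is_oper is_oper_HI csubspace_D)
  have Domain_H: "Domain H = D" using H_iff by blast
  show "closure (Domain H) = UNIV"
    unfolding Domain_H using csubspace_D
    by (rule dense_if_orth_trivial) (use resolvents_total V_in_D in blast)
  show "H \<subseteq> adjoint_op H"
  proof (rule subset_adjoint_opI)
    fix x y x' y' assume "(x, y) \<in> H" "(x', y') \<in> H"
    then have *: "x \<in> D" "y = op_apply A x + op_apply B x + op_apply HI x"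
      "x' \<in> D" "y' = op_apply A x' + op_apply B x' + op_apply HI x'"
      unfolding H_iff by blast+
    then have "cinner x (op_apply A x') = cinner (op_apply A x) x'"
      "cinner x (op_apply B x') = cinner (op_apply B x) x'"
      "cinner x (op_apply HI x') = cinner (op_apply HI x) x'"
      by (intro A.cinner_op_apply B.cinner_op_apply HI_cinner D_HI; blast)+
    with * show "cinner x y' = cinner y x'"
      by (simp add: cinner_add_left cinner_add_right)
  qed
qed

text \<open>The bound by the form norm makes the images Cauchy. Their limit is identified by pairing
  with the dense domain of \<open>HI\<close>, where symmetry moves \<open>HI\<close> off the
  sequence.\<close>

lemma HI_tendsto:
  assumes s: "\<And>k. s k \<in> V n" and lim: "s \<longlonglongrightarrow> \<psi>" and \<psi>: "\<psi> \<in> Domain HI"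
    and Cauchy: "\<And>e. e > 0 \<Longrightarrow> \<exists>N. \<forall>i\<ge>N. \<forall>j\<ge>N. Re (cinner (s i - s j) (G (s i - s j))) < e"
  shows "(\<lambda>k. op_apply HI (s k)) \<longlonglongrightarrow> op_apply HI \<psi>"
proof -
  have dV: "s i - s j \<in> V n" for i j
    using s by (intro complex_vector.subspace_diff csubspace_V)
  have sHI: "s k \<in> Domain HI" for k by (rule Q_HI[OF V_Q[OF s]])
  obtain c where c: "\<And>\<psi> \<phi>. \<phi> \<in> Q n \<Longrightarrow> cmod (cinner \<psi> (op_apply HI \<phi>)) \<le> c * norm \<psi> * sqrt (X \<phi>)"
    using HI_bounded by metis
  have "Cauchy (\<lambda>k. op_apply HI (s k))"
  proof (rule CauchyI)
    fix e :: real assume e: "e > 0"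
    have "(e / (\<bar>c\<bar> + 1))\<^sup>2 > 0" using e by simp
    from Cauchy[OF this] obtain N where
      N: "\<And>i j. i \<ge> N \<Longrightarrow> j \<ge> N \<Longrightarrow> Re (cinner (s i - s j) (G (s i - s j))) < (e / (\<bar>c\<bar> + 1))\<^sup>2"
      by blast
    have "norm (op_apply HI (s i) - op_apply HI (s j)) < e" if "i \<ge> N" "j \<ge> N" for i j
    proof -
      let ?d = "s i - s j"
      let ?h = "op_apply HI ?d"
      \<comment> \<open>Testing with the image itself turns the weak bound into a bound for its
        norm.\<close>
      have "norm ?h * norm ?h = cmod (cinner ?h ?h)"
        by (simp add: cinner_self norm_power power2_eq_square norm_mult)
      also have "\<dots> \<le> c * norm ?h * sqrt (X ?d)" by (rule c[OF V_Q[OF dV]])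
      also have "\<dots> = (c * sqrt (X ?d)) * norm ?h" by simp
      finally have "norm ?h * norm ?h \<le> (c * sqrt (X ?d)) * norm ?h" .
      then have "norm ?h \<le> c * sqrt (X ?d) \<or> norm ?h = 0"
        using mult_right_le_imp_le[of "norm ?h" "norm ?h" "c * sqrt (X ?d)"] by fastforce
      moreover have "c * sqrt (X ?d) \<le> \<bar>c\<bar> * (e / (\<bar>c\<bar> + 1))"
      proof -
        have "sqrt (X ?d) \<le> e / (\<bar>c\<bar> + 1)"
          using N[OF that] X_V[OF dV, of i j] e by (intro real_le_lsqrt) auto
        moreover have "0 \<le> sqrt (X ?d)"
          by (intro real_sqrt_ge_zero order_trans[OF zero_le_power2 X_ge[OF V_Q[OF dV]]])
        ultimately show ?thesis by (intro mult_mono) auto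
      qed
      moreover have "\<bar>c\<bar> * (e / (\<bar>c\<bar> + 1)) < e" using e by (simp add: field_simps)
      ultimately have "norm ?h < e" using e by auto
      then show ?thesis by (simp add: op_apply_diff[OF is_oper_HI sHI sHI])
    qed
    then show "\<exists>N. \<forall>i\<ge>N. \<forall>j\<ge>N. norm (op_apply HI (s i) - op_apply HI (s j)) < e" by blast
  qed
  then obtain y where y: "(\<lambda>k. op_apply HI (s k)) \<longlonglongrightarrow> y"
    using Cauchy_convergent convergent_def by blast
  have "y - op_apply HI \<psi> = 0"
    using HI_dense
  proof (rule orth_dense)
    fix u assume u: "u \<in> Domain HI"
    have "(\<lambda>k. cinner (op_apply HI u) (s k)) \<longlonglongrightarrow> cinner (op_apply HI u) \<psi>"
      by (intro cinner.tendsto tendsto_const lim)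
    moreover have "(\<lambda>k. cinner u (op_apply HI (s k))) \<longlonglongrightarrow> cinner u y"
      by (intro cinner.tendsto tendsto_const y)
    ultimately have "cinner u y = cinner (op_apply HI u) \<psi>"
      using LIMSEQ_unique HI_cinner[OF u sHI] by simp
    then have "cinner u (y - op_apply HI \<psi>) = 0"
      using HI_cinner[OF u \<psi>] by (simp add: cinner_diff_right)
    then show "cinner (y - op_apply HI \<psi>) u = 0"
      using cinner_zero_commute by blast
  qed
  with y show ?thesis by simp
qed

section \<open>Consequences of the existence of a deficiency vector\<close>

context
  fixes w :: 'h and z :: complex
  assumes z: "z\<^sup>2 = -1"
    and deficiency: "\<And>x y. (x, y) \<in> H \<Longrightarrow> cinner w (y - z *\<^sub>C x) = 0"
begin

text \<open>\<open>G x\<close> lies in the \<open>n\<close>-th sector and sees only that component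
  of \<open>w\<close>, whereas the interaction also reaches neighbouring sectors, so
  \<open>w\<close> stays there in full.\<close>

lemma deficiency_V:
  assumes x: "x \<in> V n"
  shows "cinner (P (int n) w) (G x) = (z + of_real M) * cinner w x - cinner w (op_apply HI x)"
proof -
  have "cinner w (op_apply A x + op_apply B x + op_apply HI x - z *\<^sub>C x) = 0"
    using V_in_D[OF x] by (intro deficiency) (simp add: H_iff del: Domain_iff)
  then show ?thesis
    using cinner_P_left[OF G_in[OF x], of w]
    by (simp add: G_def cinner_add_right cinner_diff_right cinner_scaleC_right cinner_scaleR_right
        algebra_simps)
qed

text \<open>By \<open>deficiency_V\<close>, \<open>x \<mapsto> \<langle>w\<^sub>n, G x\<rangle>\<close> is bounded in the form norm, so that the \<open>n\<close>-th
  component \<open>w\<^sub>n\<close> lies in the form domain and can be used as a test vector itself.\<close>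

lemma deficiency_component:
  shows "P (int n) w \<in> Q n"
    and "cinner w (op_apply HI (P (int n) w)) =
      (z + of_real M) * of_real ((norm (P (int n) w))\<^sup>2) - of_real (X (P (int n) w))"
proof -
  let ?\<psi> = "P (int n) w"
  obtain c where c: "\<And>\<psi> \<phi>. \<phi> \<in> Q n \<Longrightarrow> cmod (cinner \<psi> (op_apply HI \<phi>)) \<le> c * norm \<psi> * sqrt (X \<phi>)"
    using HI_bounded by metis
  let ?K = "cmod (z + of_real M) * norm w + c * norm w"
  obtain s where s: "\<And>k. s k \<in> V n" and lim: "s \<longlonglongrightarrow> ?\<psi>" and
    Cauchy: "\<And>e. e > 0 \<Longrightarrow> \<exists>N. \<forall>i\<ge>N. \<forall>j\<ge>N. Re (cinner (s i - s j) (G (s i - s j))) < e" and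
    lim0: "(\<lambda>k. cinner (s k) (G (s k)) - cinner ?\<psi> (G (s k))) \<longlonglongrightarrow> 0"
  proof (rule form_limit[of "V n" "\<K> (int n)" G ?\<psi> ?K])
    show "csubspace (V n)" "csubspace (\<K> (int n))" "closed (\<K> (int n))" "?\<psi> \<in> \<K> (int n)"
      by (rule csubspace_V csubspace_\<K> closed_\<K> P_in)+
    show "V n \<subseteq> \<K> (int n)" by (simp add: V_def)
    show "G (x + y) = G x + G y" "cinner x (G y) = cinner (G x) y" if "x \<in> V n" "y \<in> V n" for x y
      by (rule G_add[OF that], rule G_sym[OF that])
    show "G (c *\<^sub>C x) = c *\<^sub>C G x" "(norm x)\<^sup>2 \<le> Re (cinner x (G x))" if "x \<in> V n" for x c
      by (rule G_scaleC[OF that], rule G_pos[OF that])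
    show "v = 0" if "v \<in> \<K> (int n)" "\<And>x. x \<in> V n \<Longrightarrow> cinner v (G x) = 0" for v
      using that by (rule G_total)
    fix x assume x: "x \<in> V n"
    have "norm x \<le> sqrt (X x)"
      using X_ge[OF V_Q[OF x]] by (rule real_le_rsqrt)
    have "Re (cinner ?\<psi> (G x)) \<le> cmod ((z + of_real M) * cinner w x - cinner w (op_apply HI x))"
      unfolding deficiency_V[OF x, symmetric] by (rule complex_Re_le_cmod)
    also have "\<dots> \<le> cmod (z + of_real M) * cmod (cinner w x) + cmod (cinner w (op_apply HI x))"
      by (rule order_trans[OF norm_triangle_ineq4]) (simp add: norm_mult)
    also have "\<dots> \<le> cmod (z + of_real M) * (norm w * sqrt (X x)) + c * norm w * sqrt (X x)"
      using norm_cinner_le[of w x] \<open>norm x \<le> sqrt (X x)\<close> c[OF V_Q[OF x], of w]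
      by (intro add_mono mult_left_mono order_trans[OF norm_cinner_le mult_left_mono]) auto
    finally show "Re (cinner ?\<psi> (G x)) \<le> ?K * sqrt (Re (cinner x (G x)))"
      using X_V[OF x] by (simp add: algebra_simps)
  qed blast
  have approx: "form_approx A s ?\<psi>" "form_approx B s ?\<psi>"
    using V_form_approx[of s n ?\<psi>] s lim Cauchy by blast+
  then show Q: "?\<psi> \<in> Q n"
    using P_in by (auto simp: Q_space_def form_domain_def)
  have HI_lim: "(\<lambda>k. op_apply HI (s k)) \<longlonglongrightarrow> op_apply HI ?\<psi>"
    using HI_tendsto[of s n ?\<psi>] s lim Q_HI[OF Q] Cauchy by blast
  have "(\<lambda>k. (z + of_real M) * cinner w (s k) - cinner w (op_apply HI (s k))) \<longlonglongrightarrow>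
      (z + of_real M) * cinner w ?\<psi> - cinner w (op_apply HI ?\<psi>)"
    by (intro tendsto_intros cinner.tendsto lim HI_lim)
  then have "(\<lambda>k. cinner ?\<psi> (G (s k))) \<longlonglongrightarrow>
      (z + of_real M) * cinner w ?\<psi> - cinner w (op_apply HI ?\<psi>)"
    by (simp add: deficiency_V[OF s])
  \<comment> \<open>\<open>lim0\<close> replaces the fixed component in the first argument by
    \<open>s k\<close>, which turns the left side into the form itself.\<close>
  from tendsto_add[OF lim0 this] have lim1: "(\<lambda>k. cinner (s k) (G (s k))) \<longlonglongrightarrow>
      (z + of_real M) * cinner w ?\<psi> - cinner w (op_apply HI ?\<psi>)"
    by simp
  have "cinner (s k) (G (s k)) = of_real (Re (cinner (s k) (G (s k))))" for k
    using G_sym[OF s s, of k k] cinner_commute[of "G (s k)" "s k"]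
    by (metis Reals_cnj_iff of_real_Re)
  moreover have "(\<lambda>k. complex_of_real (Re (cinner (s k) (G (s k))))) \<longlonglongrightarrow> of_real (X ?\<psi>)"
    by (intro tendsto_of_real X_tendsto approx)
  ultimately have "(\<lambda>k. cinner (s k) (G (s k))) \<longlonglongrightarrow> of_real (X ?\<psi>)" by presburger
  from LIMSEQ_unique[OF this lim1]
  have "of_real (X ?\<psi>) = (z + of_real M) * cinner w ?\<psi> - cinner w (op_apply HI ?\<psi>)" .
  moreover have "cinner w ?\<psi> = of_real ((norm ?\<psi>)\<^sup>2)"
    using cinner_P_left[OF P_in, of "int n" w w] cinner_self by metis
  ultimately show "cinner w (op_apply HI ?\<psi>) =
      (z + of_real M) * of_real ((norm ?\<psi>)\<^sup>2) - of_real (X ?\<psi>)"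
    by simp
qed

text \<open>By symmetry of \<open>HI\<close>, pairing the components up to \<open>N\<close> among
  themselves gives a real number; imaginary parts can come only from this rest.\<close>

definition tail :: "nat \<Rightarrow> 'h"
  where "tail N = w - (\<Sum>n\<le>N. P (int n) w)"

text \<open>These are the five sectors that \<open>HI\<close> can reach from the \<open>n\<close>-th
  one; components of negative index vanish.\<close>

definition near :: "nat \<Rightarrow> real"
  where "near n = (\<Sum>i\<in>{-2..2}. (norm (P (int n + i) w))\<^sup>2)"

lemma P_tail: "P k (tail N) = (if 0 \<le> k \<and> k \<le> int N then 0 else P k w)"
proof -
  have "(\<Sum>n\<le>N. P k (P (int n) w)) = (\<Sum>n\<le>N. if int n = k then P k w else 0)"
    by (intro sum.cong refl) (auto simp: P_id P_in intro: P_other[OF P_in])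
  also have "\<dots> = (if 0 \<le> k \<and> k \<le> int N then P k w else 0)"
  proof (cases "0 \<le> k")
    case True
    then obtain m where "k = int m" using nonneg_int_cases by blast
    then show ?thesis by simp
  qed (auto intro!: sum.neutral)
  finally show ?thesis by (simp add: tail_def P_diff P_sum)
qed

lemma norm_P_tail: "norm (P k (tail N)) \<le> norm (P k w)"
  by (simp add: P_tail)

lemma near_nonneg: "0 \<le> near n"
  by (simp add: near_def sum_nonneg)

lemma norm_P_near:
  assumes "i \<in> {-2..2}" shows "norm (P (int n + i) w) \<le> sqrt (near n)"
proof (rule real_le_rsqrt)
  show "(norm (P (int n + i) w))\<^sup>2 \<le> near n"
    unfolding near_def using assms by (intro member_le_sum) auto
qed

lemma summable_near: "summable near"
  unfolding near_def
proof (rule summable_sum)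
  fix i :: int
  show "summable (\<lambda>n. (norm (P (int n + i) w))\<^sup>2)"
  proof (rule summableI_nonneg_bounded)
    fix m
    have "(\<Sum>n<m. (norm (P (int n + i) w))\<^sup>2) = (\<Sum>k\<in>(\<lambda>n. int n + i) ` {..<m}. (norm (P k w))\<^sup>2)"
      by (subst sum.reindex) (auto simp: inj_on_def)
    also have "\<dots> \<le> (norm w)\<^sup>2" by (rule bessel) simp
    finally show "(\<Sum>n<m. (norm (P (int n + i) w))\<^sup>2) \<le> (norm w)\<^sup>2" .
  qed simp
qed

text \<open>Take the imaginary part of \<open>deficiency_component\<close> and sum over \<open>n \<le> N\<close>: since \<open>HI\<close> is
  symmetric and changes the particle number by at most two, only two boundary terms survive.\<close>

lemma sum_components_le_boundary:
  "(\<Sum>n\<le>Suc N. (norm (P (int n) w))\<^sup>2) \<le>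
    cmod (cinner (tail (Suc N)) (op_apply HI (P (int N) w))) +
    cmod (cinner (tail (Suc N)) (op_apply HI (P (int (Suc N)) w)))"
proof -
  let ?w = "\<lambda>n. P (int n) w"
  let ?J = "{..Suc N}"
  define \<Phi> where "\<Phi> = sum ?w ?J"
  have wHI: "?w n \<in> Domain HI" for n by (rule Q_HI[OF deficiency_component(1)])
  from op_apply_sum[OF is_oper_HI, of ?J ?w] wHI
  have \<Phi>: "\<Phi> \<in> Domain HI" "op_apply HI \<Phi> = (\<Sum>n\<in>?J. op_apply HI (?w n))"
    unfolding \<Phi>_def by blast+
  define b where "b n = cinner (tail (Suc N)) (op_apply HI (?w n))" for n
  \<comment> \<open>\<Phi> is \<open>w\<close> minus \<open>tail (Suc N)\<close>, so symmetry
    equates the imaginary part of the sum of the <w, H_I w_n> with that of the sum of the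
    \<open>b n\<close>; in the former only \<open>Im z\<close> survives, as \<open>M\<close> and
    \<open>X\<close> are real.\<close>
  have "Im (cinner \<Phi> (op_apply HI \<Phi>)) = 0"
    by (rule symmetric_Im_zero[OF HI_sym op_apply_in[OF is_oper_HI \<Phi>(1)]])
  moreover have "cinner \<Phi> (op_apply HI \<Phi>) = (\<Sum>n\<in>?J. cinner w (op_apply HI (?w n)) - b n)"
    unfolding \<Phi>(2) cinner_sum_right b_def tail_def \<Phi>_def[symmetric]
    by (simp add: cinner_diff_left)
  ultimately have "(\<Sum>n\<in>?J. Im z * (norm (?w n))\<^sup>2) = Im (\<Sum>n\<in>?J. b n)"
    by (simp add: sum_subtractf deficiency_component(2))
  \<comment> \<open>For n < N the image reaches at most sector n + 2 <= N + 1, where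
    \<open>tail (Suc N)\<close> has no component; hence just n = N and n = N + 1 remain.\<close>
  moreover have b0: "b n = 0" if "n < N" for n
  proof -
    obtain v where v: "op_apply HI (?w n) = (\<Sum>k\<in>{int n - 2..int n + 2}. v k)"
      "\<And>k. k \<in> {int n - 2..int n + 2} \<Longrightarrow> v k \<in> \<K> k"
      using HI_Q[OF deficiency_component(1), of n] by (auto simp: sector_sum_def)
    have "cinner (tail (Suc N)) (v k) = 0" if k: "k \<in> {int n - 2..int n + 2}" for k
    proof (cases "k < 0")
      case True
      then show ?thesis using \<K>_neg[OF True v(2)[OF k]] by simp
    next
      case False
      then have "P k (tail (Suc N)) = 0" using k \<open>n < N\<close> by (simp add: P_tail)
      then show ?thesis using cinner_P_left[OF v(2)[OF k], of "tail (Suc N)"] by simp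
    qed
    then show ?thesis by (simp add: b_def v(1) cinner_sum_right)
  qed
  have "(\<Sum>n\<in>?J. b n) = (\<Sum>n\<in>{N, Suc N}. b n)"
  proof (rule sum.mono_neutral_right)
    show "\<forall>n\<in>?J - {N, Suc N}. b n = 0"
    proof
      fix n assume "n \<in> ?J - {N, Suc N}"
      then have "n < N" by auto
      then show "b n = 0" by (rule b0)
    qed
  qed auto
  ultimately have eq: "Im z * (\<Sum>n\<in>?J. (norm (?w n))\<^sup>2) = Im (b N + b (Suc N))"
    by (simp add: sum_distrib_left del: sum.atMost_Suc)
  have "z\<^sup>2 = \<i>\<^sup>2" using z by simp
  then have "z = \<i> \<or> z = - \<i>" by (simp only: power2_eq_iff)
  then have "(\<Sum>n\<in>?J. (norm (?w n))\<^sup>2) \<le> \<bar>Im z * (\<Sum>n\<in>?J. (norm (?w n))\<^sup>2)\<bar>"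
    by auto
  also have "\<dots> \<le> cmod (b N + b (Suc N))"
    unfolding eq by (rule abs_Im_le_cmod)
  also have "\<dots> \<le> cmod (b N) + cmod (b (Suc N))"
    by (rule norm_triangle_ineq)
  finally show ?thesis by (simp add: b_def)
qed

text \<open>Otherwise \<open>near N + near (N + 1)\<close> would be bounded from below by a multiple of \<open>1 / (N + 2)\<close>,
  although it is summable.\<close>

lemma deficiency_zero:
  assumes C: "\<And>n N. n \<le> N \<Longrightarrow>
    cmod (cinner (tail N) (op_apply HI (P (int n) w))) \<le> C * (real n + 1) * near n"
  shows "w = 0"
proof (rule ccontr)
  assume "w \<noteq> 0"
  then obtain n0 where n0: "P (int n0) w \<noteq> 0" using P_eq_0 by blast
  define c where "c = (norm (P (int n0) w))\<^sup>2"
  have c: "c > 0" using n0 by (simp add: c_def)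
  \<comment> \<open>From \<open>n0\<close> on the partial sums are at least \<open>c\<close>;
    \<open>real N + 2\<close> bounds both growth factors \<open>real N + 1\<close> and
    \<open>real (Suc N) + 1\<close>.\<close>
  have bound: "c * inverse (real N + 2) \<le> \<bar>C\<bar> * (near N + near (Suc N))" if "N \<ge> n0" for N
  proof -
    have "c \<le> (\<Sum>n\<le>Suc N. (norm (P (int n) w))\<^sup>2)"
      unfolding c_def using that by (intro member_le_sum) auto
    also have "\<dots> \<le> C * (real N + 1) * near N + C * (real (Suc N) + 1) * near (Suc N)"
      by (rule order_trans[OF sum_components_le_boundary add_mono[OF C C]]) auto
    also have "\<dots> \<le> \<bar>C\<bar> * (real N + 2) * near N + \<bar>C\<bar> * (real N + 2) * near (Suc N)"
    proof (rule add_mono)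
      show "C * (real N + 1) * near N \<le> \<bar>C\<bar> * (real N + 2) * near N"
        by (intro mult_right_mono[OF mult_mono near_nonneg]) auto
      show "C * (real (Suc N) + 1) * near (Suc N) \<le> \<bar>C\<bar> * (real N + 2) * near (Suc N)"
        by (intro mult_right_mono[OF mult_mono near_nonneg]) auto
    qed
    also have "\<dots> = \<bar>C\<bar> * (near N + near (Suc N)) * (real N + 2)"
      by (simp add: algebra_simps)
    finally show ?thesis by (simp add: field_simps)
  qed
  have "summable (\<lambda>N. \<bar>C\<bar> * (near N + near (Suc N)))"
    using summable_near by (intro summable_mult summable_add) (simp_all add: summable_Suc_iff)
  then have "summable (\<lambda>N. c * inverse (real N + 2))"
    by (rule summable_comparison_test') (use bound c in auto)
  then have "summable (\<lambda>N. inverse (real (N + 2)))"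
    using c by (simp add: summable_cmult_iff add.commute)
  then have "summable (\<lambda>N. inverse (real N))"
    by (subst (asm) summable_iff_shift)
  then show False using not_summable_harmonic[where 'a = real] by simp
qed

end

text \<open>This isolates what each condition must still deliver: a boundary estimate linear in
  \<open>n\<close>, whose constant may depend on \<open>w\<close> but not on \<open>n\<close> or
  \<open>N\<close>.\<close>

lemma ess_self_adjointI:
  assumes "\<And>w z. z\<^sup>2 = -1 \<Longrightarrow> (\<And>x y. (x, y) \<in> H \<Longrightarrow> cinner w (y - z *\<^sub>C x) = 0) \<Longrightarrow>
    \<exists>C. \<forall>N. \<forall>n\<le>N. cmod (cinner (tail w N) (op_apply HI (P (int n) w))) \<le> C * (real n + 1) * near w n"
  shows "ess_self_adjoint_on (op_plus (op_plus A B) HI) D"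
  unfolding ess_self_adjoint_on_def
proof (intro conjI D_Domain ess_self_adjoint_opI symmetric_op_H)
  fix w z assume *: "z\<^sup>2 = -1" "\<And>x y. (x, y) \<in> H \<Longrightarrow> cinner w (y - z *\<^sub>C x) = 0"
  from assms[OF this] obtain C where
    "\<And>n N. n \<le> N \<Longrightarrow> cmod (cinner (tail w N) (op_apply HI (P (int n) w))) \<le> C * (real n + 1) * near w n"
    by blast
  with * show "w = 0" by (rule deficiency_zero)
qed

end

section \<open>Essential self-adjointness\<close>

context free_hamiltonian
begin

lemma ess_self_adjoint_AI:
  assumes AI: "cond_AI T S H01 H02 M1 M2 HI"
  shows "ess_self_adjoint_on (op_plus (op_plus A B) HI) (Domain A \<inter> Domain B \<inter> finite_particle T S)"
proof -
  obtain C where C: "C > 0" and bound: "\<And>n \<psi> \<phi>. \<phi> \<in> Q n \<Longrightarrow>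
      (cmod (cinner \<psi> (op_apply HI \<phi>)))\<^sup>2
        \<le> C\<^sup>2 * (\<Sum>i\<in>{-2..2}. (norm (P (int n + i) \<psi>))\<^sup>2) *
          ((real n + 1)\<^sup>2 * (norm \<phi>)\<^sup>2 + (real n + 1) * X \<phi>)"
    using AI unfolding cond_AI_def by blast
  interpret hamiltonian T S H01 H02 M1 M2 HI
  proof
    show "cond_common T S H01 H02 HI" using AI by (simp add: cond_AI_def)
    fix n
    have "cmod (cinner \<psi> (op_apply HI \<phi>)) \<le> (2 * C * (real n + 1)) * norm \<psi> * sqrt (X \<phi>)"
      if \<phi>: "\<phi> \<in> Q n" for \<psi> \<phi>
    proof (rule power2_le_imp_le)
      have X: "(norm \<phi>)\<^sup>2 \<le> X \<phi>" "0 \<le> X \<phi>"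
        using X_ge[OF \<phi>] order_trans[OF zero_le_power2 X_ge[OF \<phi>]] by auto
      let ?p = "real n + 1"
      have "?p * X \<phi> \<le> ?p\<^sup>2 * X \<phi>"
        using X(2) by (intro mult_right_mono) (auto simp: power2_eq_square)
      moreover have "?p\<^sup>2 * (norm \<phi>)\<^sup>2 \<le> ?p\<^sup>2 * X \<phi>"
        using X(1) by (rule mult_left_mono) simp
      moreover have "0 \<le> ?p\<^sup>2 * X \<phi>" using X(2) by simp
      \<comment> \<open>Each summand is at most \<open>?p\<^sup>2 * X \<phi>\<close>; taking 4 in
        place of 2 makes the square root the factor 2 of the claim.\<close>
      ultimately have "?p\<^sup>2 * (norm \<phi>)\<^sup>2 + ?p * X \<phi> \<le> 4 * (?p\<^sup>2 * X \<phi>)" by linarith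
      moreover have "0 \<le> ?p\<^sup>2 * (norm \<phi>)\<^sup>2 + ?p * X \<phi>" using X(2) by simp
      ultimately have "C\<^sup>2 * (\<Sum>i\<in>{-2..2}. (norm (P (int n + i) \<psi>))\<^sup>2) *
          (?p\<^sup>2 * (norm \<phi>)\<^sup>2 + ?p * X \<phi>) \<le> C\<^sup>2 * (norm \<psi>)\<^sup>2 * (4 * (?p\<^sup>2 * X \<phi>))"
        using sum_near_le[of n \<psi>] by (intro mult_mono) (auto intro: sum_nonneg)
      with bound[OF \<phi>, of \<psi>]
      have "(cmod (cinner \<psi> (op_apply HI \<phi>)))\<^sup>2 \<le> C\<^sup>2 * (norm \<psi>)\<^sup>2 * (4 * (?p\<^sup>2 * X \<phi>))"
        by linarith
      also have "\<dots> = (2 * C * ?p * norm \<psi> * sqrt (X \<phi>))\<^sup>2"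
        using X(2) by (simp add: power_mult_distrib)
      finally show "(cmod (cinner \<psi> (op_apply HI \<phi>)))\<^sup>2 \<le> (2 * C * ?p * norm \<psi> * sqrt (X \<phi>))\<^sup>2" .
      show "0 \<le> 2 * C * ?p * norm \<psi> * sqrt (X \<phi>)" using C X by simp
    qed
    then show "\<exists>c. \<forall>\<psi>. \<forall>\<phi>\<in>Q n. cmod (cinner \<psi> (op_apply HI \<phi>)) \<le> c * norm \<psi> * sqrt (X \<phi>)"
      by blast
  qed
  show ?thesis
  proof (rule ess_self_adjointI)
    fix w z
    assume wz: "z\<^sup>2 = -1" "\<And>x y. (x, y) \<in> H \<Longrightarrow> cinner w (y - z *\<^sub>C x) = 0"
    let ?near = "near w"
    \<comment> \<open>Solving the inequalities below for \<open>X'\<close> gives X' <= 2 M a + C^2 p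
      N2 + p a, hence the coefficient \<open>2 * M + C\<^sup>2 + 1\<close> of \<open>p * N2\<close>;
      one more 1 accounts for the summand \<open>p * a\<close> in
      \<open>Y = p * (p * a + X')\<close>.\<close>
    let ?L = "2 * M + C\<^sup>2 + 2"
    have "Re z = 0"
    proof -
      have "z\<^sup>2 = \<i>\<^sup>2" using wz(1) by simp
      then have "z = \<i> \<or> z = - \<i>" by (simp only: power2_eq_iff)
      then show ?thesis by auto
    qed
    have "cmod (cinner (tail w N) (op_apply HI (P (int n) w))) \<le> (C * sqrt ?L) * (real n + 1) * ?near n"
      if "n \<le> N" for n N
    proof -
      let ?w = "P (int n) w"
      define p a N2 X' Y where "p = real n + 1" and "a = (norm ?w)\<^sup>2" and "N2 = ?near n"
        and "X' = X ?w" and "Y = p\<^sup>2 * a + p * X'"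
      note component = deficiency_component[OF wz, of n]
      have p: "p \<ge> 1" by (simp add: p_def)
      have "0 \<le> N2" unfolding N2_def by (rule near_nonneg[OF wz])
      have a: "0 \<le> a" "a \<le> N2"
        using norm_P_near[OF wz, of 0 n] \<open>0 \<le> N2\<close>
        by (auto simp: a_def N2_def sqrt_le_D real_le_rsqrt dest: power_mono[of _ _ 2])
      have X': "a \<le> X'" using X_ge[OF component(1)] by (simp add: a_def X'_def)
      define v where "v = cmod (cinner w (op_apply HI ?w))"
      have Y: "Y = p * (p * a + X')" by (simp add: Y_def power2_eq_square algebra_simps)
      have v2: "v\<^sup>2 \<le> C\<^sup>2 * N2 * Y"
        using bound[OF component(1), of w]
        by (simp add: v_def N2_def near_def[OF wz] Y_def p_def a_def X'_def)
      \<comment> \<open>The factors are grouped so that the arithmetic-geometric mean inequality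
        leaves \<open>X'\<close> with coefficient 1/2, which can be absorbed by the left side of X'
        <= M a + v.\<close>
      also have "\<dots> = (C\<^sup>2 * p * N2) * (p * a + X')" by (simp add: Y algebra_simps)
      also have "\<dots> \<le> ((C\<^sup>2 * p * N2 + (p * a + X')) / 2)\<^sup>2"
      proof -
        have "((s + t) / 2)\<^sup>2 - s * t = ((s - t) / 2)\<^sup>2" for s t :: real
          by (simp add: power2_eq_square field_simps)
        then have "s * t \<le> ((s + t) / 2)\<^sup>2" for s t :: real
          by (metis diff_ge_0_iff_ge zero_le_power2)
        then show ?thesis .
      qed
      finally have "v \<le> (C\<^sup>2 * p * N2 + (p * a + X')) / 2"
        by (rule power2_le_imp_le) (use C p a X' \<open>0 \<le> N2\<close> in simp)
      \<comment> \<open>This is the real part of the identity for the component, \<open>z\<close>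
        being purely imaginary.\<close>
      moreover have "X' \<le> M * a + v"
      proof -
        have "X' = M * a - Re (cinner w (op_apply HI ?w))"
          using arg_cong[OF component(2), of Re] \<open>Re z = 0\<close> by (simp add: a_def X'_def)
        then show ?thesis
          using abs_Re_le_cmod[of "cinner w (op_apply HI ?w)"] by (simp add: v_def)
      qed
      moreover have "M * a \<le> M * (p * N2)" "p * a \<le> p * N2"
        using M_ge p a by (auto intro!: mult_left_mono order_trans[OF _ mult_right_mono[of 1 p N2]])
      ultimately have "X' \<le> (2 * M + C\<^sup>2 + 1) * (p * N2)" by (simp add: algebra_simps)
      then have "p * (p * a + X') \<le> p * (p * N2 + (2 * M + C\<^sup>2 + 1) * (p * N2))"
        using \<open>p * a \<le> p * N2\<close> p by (intro mult_left_mono add_mono) auto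
      then have Y_le: "Y \<le> ?L * p\<^sup>2 * N2" by (simp add: Y power2_eq_square algebra_simps)
      have "0 \<le> Y" using p a X' by (simp add: Y_def)
      let ?v = "cmod (cinner (tail w N) (op_apply HI ?w))"
      \<comment> \<open>The bound is used a second time, now against the tail, whose components are
        no larger than those of \<open>w\<close>; \<open>Y\<close> is the same since it involves
        only \<open>?w\<close>.\<close>
      have "?v\<^sup>2 \<le> C\<^sup>2 * (\<Sum>i\<in>{-2..2}. (norm (P (int n + i) (tail w N)))\<^sup>2) * Y"
        using bound[OF component(1), of "tail w N"] by (simp add: Y_def p_def a_def X'_def)
      also have "\<dots> \<le> C\<^sup>2 * N2 * (?L * p\<^sup>2 * N2)"
        using norm_P_tail[OF wz] \<open>0 \<le> Y\<close> \<open>0 \<le> N2\<close> Y_le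
        by (intro mult_mono) (auto simp: N2_def near_def[OF wz] intro!: sum_mono power_mono sum_nonneg)
      also have "\<dots> = (C * sqrt ?L * p * N2)\<^sup>2"
        using M_ge by (simp add: power_mult_distrib power2_eq_square)
      finally have "?v \<le> C * sqrt ?L * p * N2"
        by (rule power2_le_imp_le) (use C p \<open>0 \<le> N2\<close> M_ge in simp)
      then show ?thesis by (simp add: p_def N2_def)
    qed
    then show "\<exists>C. \<forall>N. \<forall>n\<le>N.
        cmod (cinner (tail w N) (op_apply HI (P (int n) w))) \<le> C * (real n + 1) * near w n"
      by blast
  qed
qed

lemma ess_self_adjoint_AI':
  assumes AI': "cond_AI' T S H01 H02 M1 M2 HI"
  shows "ess_self_adjoint_on (op_plus (op_plus A B) HI) (Domain A \<inter> Domain B \<inter> finite_particle T S)"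
proof -
  obtain Hdiag H2 C where opers: "is_oper Hdiag" "is_oper H2" and HI: "HI = op_plus Hdiag H2"
    and diag: "\<And>n. \<exists>C>0. \<forall>\<psi>. \<forall>\<phi>\<in>Q n. (cmod (cinner \<psi> (op_apply Hdiag \<phi>)))\<^sup>2
        \<le> C\<^sup>2 * (norm (P (int n) \<psi>))\<^sup>2 * X \<phi>"
    and C: "C > 0" and H2: "\<And>n \<psi> \<phi>. \<phi> \<in> \<K> (int n) \<Longrightarrow> cmod (cinner \<psi> (op_apply H2 \<phi>))
        \<le> C * (real n + 1) * norm \<phi> * (\<Sum>i\<in>{-2, -1, 1, 2}. norm (P (int n + i) \<psi>))"
    using AI' unfolding cond_AI'_def by blast
  have common: "cond_common T S H01 H02 HI" using AI' by (simp add: cond_AI'_def)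
  have split: "op_apply HI \<phi> = op_apply Hdiag \<phi> + op_apply H2 \<phi>" if "\<phi> \<in> Q n" for \<phi> n
  proof -
    have "(\<phi>, op_apply HI \<phi>) \<in> HI"
      using common that
      by (intro op_apply_in) (auto simp: cond_common_def symmetric_op_def simp del: Domain_iff)
    then show ?thesis
      unfolding HI op_plus_iff[OF opers] by blast
  qed
  have diag': "\<exists>C. \<forall>\<psi>. \<forall>\<phi>\<in>Q n. cmod (cinner \<psi> (op_apply Hdiag \<phi>)) \<le> C * norm (P (int n) \<psi>) * sqrt (X \<phi>)"
    for n
  proof -
    obtain C where "C > 0" and C: "\<And>\<psi> \<phi>. \<phi> \<in> Q n \<Longrightarrow>
        (cmod (cinner \<psi> (op_apply Hdiag \<phi>)))\<^sup>2 \<le> C\<^sup>2 * (norm (P (int n) \<psi>))\<^sup>2 * X \<phi>"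
      using diag by metis
    have "cmod (cinner \<psi> (op_apply Hdiag \<phi>)) \<le> C * norm (P (int n) \<psi>) * sqrt (X \<phi>)"
      if "\<phi> \<in> Q n" for \<psi> \<phi>
    proof (rule power2_le_imp_le)
      have "0 \<le> X \<phi>" using order_trans[OF zero_le_power2 X_ge[OF that]] .
      then show "(cmod (cinner \<psi> (op_apply Hdiag \<phi>)))\<^sup>2 \<le> (C * norm (P (int n) \<psi>) * sqrt (X \<phi>))\<^sup>2"
        using C[OF that, of \<psi>] by (simp add: power_mult_distrib)
      show "0 \<le> C * norm (P (int n) \<psi>) * sqrt (X \<phi>)"
        using \<open>C > 0\<close> \<open>0 \<le> X \<phi>\<close> by simp
    qed
    then show ?thesis by blast
  qed
  interpret hamiltonian T S H01 H02 M1 M2 HI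
  proof
    show "cond_common T S H01 H02 HI" by (rule common)
    fix n
    obtain C1 where C1: "\<And>\<psi> \<phi>. \<phi> \<in> Q n \<Longrightarrow>
        cmod (cinner \<psi> (op_apply Hdiag \<phi>)) \<le> C1 * norm (P (int n) \<psi>) * sqrt (X \<phi>)"
      using diag' by metis
    have "cmod (cinner \<psi> (op_apply HI \<phi>)) \<le> (\<bar>C1\<bar> + C * (real n + 1) * 4) * norm \<psi> * sqrt (X \<phi>)"
      if \<phi>: "\<phi> \<in> Q n" for \<psi> \<phi>
    proof -
      have X: "norm \<phi> \<le> sqrt (X \<phi>)" using X_ge[OF \<phi>] by (rule real_le_rsqrt)
      have "cmod (cinner \<psi> (op_apply Hdiag \<phi>)) \<le> \<bar>C1\<bar> * norm \<psi> * sqrt (X \<phi>)"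
        using order_trans[OF norm_ge_zero X] norm_P_le[of "int n" \<psi>]
        by (intro order_trans[OF C1[OF \<phi>]] mult_right_mono mult_mono) auto
      moreover have "cmod (cinner \<psi> (op_apply H2 \<phi>)) \<le> C * (real n + 1) * sqrt (X \<phi>) * (4 * norm \<psi>)"
      proof (rule order_trans[OF H2[OF Q_in_\<K>[OF \<phi>]]], rule mult_mono)
        show "(\<Sum>i\<in>{-2, -1, 1, 2}. norm (P (int n + i) \<psi>)) \<le> 4 * norm \<psi>"
          using sum_bounded_above[of "{-2, -1, 1, 2 :: int}" "\<lambda>i. norm (P (int n + i) \<psi>)" "norm \<psi>"]
          by (simp add: norm_P_le)
        show "C * (real n + 1) * norm \<phi> \<le> C * (real n + 1) * sqrt (X \<phi>)"
          using C X by (intro mult_left_mono) auto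
        show "0 \<le> C * (real n + 1) * sqrt (X \<phi>)"
          using C order_trans[OF norm_ge_zero X] by simp
      qed (intro sum_nonneg norm_ge_zero)
      moreover have "cmod (cinner \<psi> (op_apply HI \<phi>)) \<le>
          cmod (cinner \<psi> (op_apply Hdiag \<phi>)) + cmod (cinner \<psi> (op_apply H2 \<phi>))"
        unfolding split[OF \<phi>] cinner_add_right by (rule norm_triangle_ineq)
      ultimately show ?thesis by (simp add: algebra_simps)
    qed
    then show "\<exists>c. \<forall>\<psi>. \<forall>\<phi>\<in>Q n. cmod (cinner \<psi> (op_apply HI \<phi>)) \<le> c * norm \<psi> * sqrt (X \<phi>)"
      by blast
  qed
  show ?thesis
  proof (rule ess_self_adjointI)
    fix w z
    assume wz: "z\<^sup>2 = -1" "\<And>x y. (x, y) \<in> H \<Longrightarrow> cinner w (y - z *\<^sub>C x) = 0"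
    have "cmod (cinner (tail w N) (op_apply HI (P (int n) w))) \<le> (4 * C) * (real n + 1) * near w n"
      if "n \<le> N" for n N
    proof -
      let ?w = "P (int n) w" and ?s = "sqrt (near w n)"
      have Q: "?w \<in> Q n" by (rule deficiency_component(1)[OF wz])
      have s: "0 \<le> ?s" using near_nonneg[OF wz] by simp
      \<comment> \<open>Since n <= N, the tail has no component in sector n, which kills the
        diagonal part whatever its constant.\<close>
      have "P (int n) (tail w N) = 0" using that by (simp add: P_tail[OF wz])
      moreover obtain C1 where "cmod (cinner (tail w N) (op_apply Hdiag ?w)) \<le>
          C1 * norm (P (int n) (tail w N)) * sqrt (X ?w)"
        using diag' Q by blast
      ultimately have "cinner (tail w N) (op_apply Hdiag ?w) = 0" by simp
      then have "cmod (cinner (tail w N) (op_apply HI ?w)) = cmod (cinner (tail w N) (op_apply H2 ?w))"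
        unfolding split[OF Q] cinner_add_right by simp
      also have "\<dots> \<le> C * (real n + 1) * norm ?w * (\<Sum>i\<in>{-2, -1, 1, 2}. norm (P (int n + i) (tail w N)))"
        by (rule H2[OF P_in])
      \<comment> \<open>The component and each of its four neighbours in the tail are at most the
        root of \<open>near w n\<close>, so the product is linear in
        \<open>near w n\<close>.\<close>
      also have "\<dots> \<le> C * (real n + 1) * ?s * (4 * ?s)"
      proof (rule mult_mono)
        have "norm (P (int n + i) (tail w N)) \<le> ?s" if "i \<in> {-2..2}" for i
          using norm_P_tail[OF wz] norm_P_near[OF wz that] by (rule order_trans)
        from this[of "-2"] this[of "-1"] this[of 1] this[of 2]
        show "(\<Sum>i\<in>{-2, -1, 1, 2}. norm (P (int n + i) (tail w N))) \<le> 4 * ?s"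
          by simp
        show "C * (real n + 1) * norm ?w \<le> C * (real n + 1) * ?s"
          using C norm_P_near[OF wz, of 0 n] by (intro mult_left_mono) auto
        show "0 \<le> C * (real n + 1) * ?s" using C s by simp
      qed (intro sum_nonneg norm_ge_zero)
      also have "\<dots> = 4 * C * (real n + 1) * (?s * ?s)" by simp
      also have "?s * ?s = near w n" using near_nonneg[OF wz] by simp
      finally show ?thesis .
    qed
    then show "\<exists>C. \<forall>N. \<forall>n\<le>N.
        cmod (cinner (tail w N) (op_apply HI (P (int n) w))) \<le> C * (real n + 1) * near w n"
      by blast
  qed
qed

end

theorem theorem3p1:
  fixes T :: "'a::chilbert_space \<Rightarrow> 'f::chilbert_space \<Rightarrow> 'h::chilbert_space"
    and S :: "'b::chilbert_space list \<Rightarrow> 'f"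
    and H01 :: "'a oper" and H02 :: "'f oper" and HI :: "'h oper"
    and M1 M2 :: real
  assumes "separable_space (euclidean :: 'a topology)"
    and "separable_space (euclidean :: 'b topology)"
    and "symmetric_fock S"
    and "hilbert_tensor T"
    and "cond_A0 S H01 H02 M1 M2"
    and "cond_AI T S H01 H02 M1 M2 HI \<or> cond_AI' T S H01 H02 M1 M2 HI"
  shows "ess_self_adjoint_on
    (op_plus (op_plus (tensor_one T H01) (one_tensor T H02)) HI)
    (Domain (tensor_one T H01) \<inter> Domain (one_tensor T H02) \<inter> finite_particle T S)"
proof -
  interpret free_hamiltonian T S H01 H02 M1 M2
    using assms by unfold_locales
  show ?thesis
    using assms(6) ess_self_adjoint_AI ess_self_adjoint_AI' by blast
qed

end
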